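(* Assume there is a constant $u^*>0$ such that $$\min_{\sigma\in[s,u^*]}g(\sigma)>f(s)\ \text{ for } 0<s<u^*,\qquad \max_{\sigma\in[u^*,s]}g(\sigma)<f(s)\ \text{ for } u^*<s\le B,$$ and that $f'(0),g'(0)$ exist with $g'(0)>f'(0)>0$, and $f(s)>f(0)$ for all $s>0$. Assume there is a unique constant $M>0$ such that $g(M)=\max_{s\in[0,\infty)}g(s)$, and that $g$ is nondecreasing on $(0,M)$ and nonincreasing on $(M,B)$. Then the positive steady state $u^*$ of problem (P) is globally attractive provided that $u^*\le M$ and $\phi\in X_+\setminus\{0\}$.
   Context: Let $\tau>0$, let $\Omega\subset\mathbb R^N$ be a bounded domain with smooth boundary, let $\partial/\partial n$ be the outward normal derivative on $\partial\Omega$, and let $h$ be a positive (integrable) function on $[0,\tau]$ with $\int_0^\tau h(a)\,da=1$. The functions $f,g:\mathbb R\to\mathbb R$ satisfy: (T1) $f,g$ are Lipschitz continuous and $f(0)=g(0)$; (T2) $g(s)>g(0)$ for all $s>0$ and there is a number $B>0$ with $\max_{v\in[0,s]}g(v)<f(s)$ for all $s>B$. Let $X_+=C(\bar\Omega\times[-\tau,0],[0,\infty))$ with the supremum norm. Problem (P) is $$u_t(x,t)-\Delta u(x,t)=-f(u(x,t))+\int_0^\tau h(a)g(u(x,t-a))\,da\ (x\in\Omega,\ t>0),$$ $$\frac{\partial u}{\partial n}=0\ \text{ on }\partial\Omega,\ t>0,\qquad u(x,t)=\phi(x,t)\ \text{ for }(x,t)\in\bar\Omega\times[-\tau,0].$$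 For $\phi\in X_+$ the solution of (P) is the unique global mild solution, i.e. the continuous $u:\bar\Omega\times[-\tau,\infty)\to[0,\infty)$ with $u=\phi$ on $\bar\Omega\times[-\tau,0]$ and $u(\cdot,t)=T(t)\phi(\cdot,0)+\int_0^tT(t-s)F(u_s)\,ds$ for $t\ge0$, where $T(t)$ is the semigroup on $C(\bar\Omega,\mathbb R)$ generated by the Laplacian with homogeneous Neumann condition, $u_s(x,\theta)=u(x,s+\theta)$ for $\theta\in[-\tau,0]$, and $F(\psi)(x)=-f(\psi(x,0))+\int_0^\tau h(a)g(\psi(x,-a))\,da$. "Globally attractive" means: for every $\phi\in X_+\setminus\{0\}$ the solution satisfies $u(x,t)\to u^*$ as $t\to\infty$, uniformly in $x\in\bar\Omega$. *)

theory Defs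
  imports "HOL-Analysis.Analysis"
begin

definition partial_deriv :: "'a::euclidean_space \<Rightarrow> ('a \<Rightarrow> real) \<Rightarrow> 'a \<Rightarrow> real" where
  "partial_deriv b u x = frechet_derivative u (at x) b"

text \<open>C^k regularity on a set \<open>S\<close>, meant for open \<open>S\<close>.\<close>

primrec Ck_on :: "nat \<Rightarrow> ('a::euclidean_space \<Rightarrow> real) \<Rightarrow> 'a set \<Rightarrow> bool" where
  "Ck_on 0 u S \<longleftrightarrow> continuous_on S u"
| "Ck_on (Suc k) u S \<longleftrightarrow>
     (\<forall>x\<in>S. u differentiable (at x)) \<and> (\<forall>b\<in>Basis. Ck_on k (partial_deriv b u) S)"

definition smooth_on :: "('a::euclidean_space \<Rightarrow> real) \<Rightarrow> 'a set \<Rightarrow> bool" where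
  "smooth_on u S \<longleftrightarrow> (\<forall>k. Ck_on k u S)"

definition laplacian :: "('a::euclidean_space \<Rightarrow> real) \<Rightarrow> 'a \<Rightarrow> real" where
  "laplacian u x = (\<Sum>b\<in>Basis. partial_deriv b (partial_deriv b u) x)"

text \<open>A smooth function \<open>\<rho>\<close> without critical points describes \<open>\<Omega>\<close> near \<open>p\<close> as its negativity set;
  then the boundary near \<open>p\<close> is the zero set of \<open>\<rho>\<close> and the gradient of \<open>\<rho>\<close> points outwards.\<close>

definition defining_function ::
    "'a::euclidean_space set \<Rightarrow> 'a \<Rightarrow> 'a set \<Rightarrow> ('a \<Rightarrow> real) \<Rightarrow> bool" where
  "defining_function \<Omega> p U \<rho> \<longleftrightarrow>
     open U \<and> p \<in> U \<and> smooth_on \<rho> U \<and> (\<forall>x\<in>U. \<not> (GDERIV \<rho> x :> 0)) \<and>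
     \<Omega> \<inter> U = {x \<in> U. \<rho> x < 0}"

definition smooth_bounded_domain :: "'a::euclidean_space set \<Rightarrow> bool" where
  "smooth_bounded_domain \<Omega> \<longleftrightarrow>
     open \<Omega> \<and> connected \<Omega> \<and> \<Omega> \<noteq> {} \<and> bounded \<Omega> \<and>
     (\<forall>p\<in>frontier \<Omega>. \<exists>U \<rho>. defining_function \<Omega> p U \<rho>)"

definition outward_normal :: "'a::euclidean_space set \<Rightarrow> 'a \<Rightarrow> 'a \<Rightarrow> bool" where
  "outward_normal \<Omega> p \<nu> \<longleftrightarrow>
     (\<exists>U \<rho> D. defining_function \<Omega> p U \<rho> \<and> (GDERIV \<rho> p :> D) \<and> \<nu> = sgn D)"

text \<open>Elements of \<open>C(closure \<Omega>)\<close> are represented by functions on the whole space whose values outside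
  \<open>closure \<Omega>\<close> are irrelevant; convergence in the supremum norm is \<open>uniform_limit (closure \<Omega>)\<close>.\<close>

abbreviation C_closure :: "'a::euclidean_space set \<Rightarrow> ('a \<Rightarrow> real) set" where
  "C_closure \<Omega> \<equiv> {u. continuous_on (closure \<Omega>) u}"

text \<open>The graph of the Laplacian on the functions in \<open>C\<^sup>2(\<Omega>) \<inter> C\<^sup>1(closure \<Omega>)\<close> with Laplacian in
  \<open>C(closure \<Omega>)\<close> and vanishing normal derivative. The field \<open>G\<close> is the (unique) continuous
  extension of the gradient of \<open>u\<close> to \<open>closure \<Omega>\<close>.\<close>

definition neumann_laplacian ::
    "'a::euclidean_space set \<Rightarrow> ('a \<Rightarrow> real) \<Rightarrow> ('a \<Rightarrow> real) \<Rightarrow> bool" where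
  "neumann_laplacian \<Omega> u w \<longleftrightarrow>
     u \<in> C_closure \<Omega> \<and> w \<in> C_closure \<Omega> \<and> Ck_on 2 u \<Omega> \<and> (\<forall>x\<in>\<Omega>. laplacian u x = w x) \<and>
     (\<exists>G. continuous_on (closure \<Omega>) G \<and> (\<forall>x\<in>\<Omega>. GDERIV u x :> G x) \<and>
          (\<forall>p\<in>frontier \<Omega>. \<forall>\<nu>. outward_normal \<Omega> p \<nu> \<longrightarrow> G p \<bullet> \<nu> = 0))"

text \<open>The closure of that graph in \<open>C(closure \<Omega>) \<times> C(closure \<Omega>)\<close>.\<close>

definition neumann_laplacian_closure ::
    "'a::euclidean_space set \<Rightarrow> ('a \<Rightarrow> real) \<Rightarrow> ('a \<Rightarrow> real) \<Rightarrow> bool" where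
  "neumann_laplacian_closure \<Omega> u w \<longleftrightarrow>
     (\<exists>un wn. (\<forall>n::nat. neumann_laplacian \<Omega> (un n) (wn n)) \<and>
        uniform_limit (closure \<Omega>) un u sequentially \<and>
        uniform_limit (closure \<Omega>) wn w sequentially)"

text \<open>Strongly continuous semigroups of bounded linear operators on \<open>C(closure \<Omega>)\<close>. The boundedness
  clause (with \<open>K = 0\<close>) and linearity force \<open>T t u\<close> on \<open>closure \<Omega>\<close> to depend only on \<open>u\<close> on
  \<open>closure \<Omega>\<close>.\<close>

definition C0_semigroup ::
    "'a::euclidean_space set \<Rightarrow> (real \<Rightarrow> ('a \<Rightarrow> real) \<Rightarrow> 'a \<Rightarrow> real) \<Rightarrow> bool" where
  "C0_semigroup \<Omega> T \<longleftrightarrow>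
     (\<forall>t\<ge>0. \<forall>u\<in>C_closure \<Omega>. T t u \<in> C_closure \<Omega>) \<and>
     (\<forall>t\<ge>0. \<forall>u\<in>C_closure \<Omega>. \<forall>v\<in>C_closure \<Omega>. \<forall>c d. \<forall>x\<in>closure \<Omega>.
        T t (\<lambda>y. c * u y + d * v y) x = c * T t u x + d * T t v x) \<and>
     (\<forall>t\<ge>0. \<exists>C. \<forall>u\<in>C_closure \<Omega>. \<forall>K.
        (\<forall>x\<in>closure \<Omega>. \<bar>u x\<bar> \<le> K) \<longrightarrow> (\<forall>x\<in>closure \<Omega>. \<bar>T t u x\<bar> \<le> C * K)) \<and>
     (\<forall>u\<in>C_closure \<Omega>. \<forall>x\<in>closure \<Omega>. T 0 u x = u x) \<and>
     (\<forall>s\<ge>0. \<forall>t\<ge>0. \<forall>u\<in>C_closure \<Omega>. \<forall>x\<in>closure \<Omega>. T (s + t) u x = T s (T t u) x) \<and>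
     (\<forall>u\<in>C_closure \<Omega>. uniform_limit (closure \<Omega>) (\<lambda>t. T t u) u (at_right 0))"

definition generator ::
    "'a::euclidean_space set \<Rightarrow> (real \<Rightarrow> ('a \<Rightarrow> real) \<Rightarrow> 'a \<Rightarrow> real) \<Rightarrow>
     ('a \<Rightarrow> real) \<Rightarrow> ('a \<Rightarrow> real) \<Rightarrow> bool" where
  "generator \<Omega> T u w \<longleftrightarrow>
     u \<in> C_closure \<Omega> \<and> w \<in> C_closure \<Omega> \<and>
     uniform_limit (closure \<Omega>) (\<lambda>t x. (T t u x - u x) / t) w (at_right 0)"

definition neumann_semigroup ::
    "'a::euclidean_space set \<Rightarrow> (real \<Rightarrow> ('a \<Rightarrow> real) \<Rightarrow> 'a \<Rightarrow> real) \<Rightarrow> bool" where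
  "neumann_semigroup \<Omega> T \<longleftrightarrow>
     C0_semigroup \<Omega> T \<and> (\<forall>u w. generator \<Omega> T u w \<longleftrightarrow> neumann_laplacian_closure \<Omega> u w)"

definition X_plus :: "'a::euclidean_space set \<Rightarrow> real \<Rightarrow> ('a \<Rightarrow> real \<Rightarrow> real) set" where
  "X_plus \<Omega> \<tau> =
     {\<phi>. continuous_on (closure \<Omega> \<times> {-\<tau>..0}) (\<lambda>(x, t). \<phi> x t) \<and>
         (\<forall>x\<in>closure \<Omega>. \<forall>t\<in>{-\<tau>..0}. 0 \<le> \<phi> x t)}"

definition history :: "('a \<Rightarrow> real \<Rightarrow> real) \<Rightarrow> real \<Rightarrow> 'a \<Rightarrow> real \<Rightarrow> real" where
  "history u s = (\<lambda>x \<theta>. u x (s + \<theta>))"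

definition reaction ::
    "real \<Rightarrow> (real \<Rightarrow> real) \<Rightarrow> (real \<Rightarrow> real) \<Rightarrow> (real \<Rightarrow> real) \<Rightarrow> ('a \<Rightarrow> real \<Rightarrow> real) \<Rightarrow> 'a \<Rightarrow> real" where
  "reaction \<tau> h f g \<psi> x = - f (\<psi> x 0) + integral {0..\<tau>} (\<lambda>a. h a * g (\<psi> x (- a)))"

text \<open>The integral in the variation of constants formula is an integral of a continuous
  \<open>C(closure \<Omega>)\<close>-valued function; it is evaluated pointwise in \<open>x\<close>.\<close>

definition mild_solution ::
    "'a::euclidean_space set \<Rightarrow> (real \<Rightarrow> ('a \<Rightarrow> real) \<Rightarrow> 'a \<Rightarrow> real) \<Rightarrow> real \<Rightarrow> (real \<Rightarrow> real) \<Rightarrow>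
     (real \<Rightarrow> real) \<Rightarrow> (real \<Rightarrow> real) \<Rightarrow> ('a \<Rightarrow> real \<Rightarrow> real) \<Rightarrow> ('a \<Rightarrow> real \<Rightarrow> real) \<Rightarrow> bool" where
  "mild_solution \<Omega> T \<tau> h f g \<phi> u \<longleftrightarrow>
     continuous_on (closure \<Omega> \<times> {-\<tau>..}) (\<lambda>(x, t). u x t) \<and>
     (\<forall>x\<in>closure \<Omega>. \<forall>t\<ge>-\<tau>. 0 \<le> u x t) \<and>
     (\<forall>x\<in>closure \<Omega>. \<forall>t\<in>{-\<tau>..0}. u x t = \<phi> x t) \<and>
     (\<forall>t\<ge>0. \<forall>x\<in>closure \<Omega>.
        u x t = T t (\<lambda>y. \<phi> y 0) x +
                integral {0..t} (\<lambda>s. T (t - s) (reaction \<tau> h f g (history u s)) x))"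

definition steady_state ::
    "'a::euclidean_space set \<Rightarrow> (real \<Rightarrow> ('a \<Rightarrow> real) \<Rightarrow> 'a \<Rightarrow> real) \<Rightarrow> real \<Rightarrow> (real \<Rightarrow> real) \<Rightarrow>
     (real \<Rightarrow> real) \<Rightarrow> (real \<Rightarrow> real) \<Rightarrow> ('a \<Rightarrow> real) \<Rightarrow> bool" where
  "steady_state \<Omega> T \<tau> h f g p \<longleftrightarrow> mild_solution \<Omega> T \<tau> h f g (\<lambda>x _. p x) (\<lambda>x _. p x)"

definition globally_attractive ::
    "'a::euclidean_space set \<Rightarrow> (real \<Rightarrow> ('a \<Rightarrow> real) \<Rightarrow> 'a \<Rightarrow> real) \<Rightarrow> real \<Rightarrow> (real \<Rightarrow> real) \<Rightarrow>
     (real \<Rightarrow> real) \<Rightarrow> (real \<Rightarrow> real) \<Rightarrow> real \<Rightarrow> bool" where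
  "globally_attractive \<Omega> T \<tau> h f g c \<longleftrightarrow>
     (\<forall>\<phi>\<in>X_plus \<Omega> \<tau>. \<forall>u.
        (\<exists>x\<in>closure \<Omega>. \<exists>t\<in>{-\<tau>..0}. \<phi> x t \<noteq> 0) \<longrightarrow> mild_solution \<Omega> T \<tau> h f g \<phi> u \<longrightarrow>
        uniform_limit (closure \<Omega>) (\<lambda>t x. u x t) (\<lambda>_. c) at_top)"

end

theory Submission
  imports Defs
begin

text \<open>The solution is squeezed to \<open>ustar\<close> from both sides by a scalar comparison. Fix \<open>\<kappa>\<close> above the Lipschitz
  constant of \<open>f\<close> and write the equation as \<open>u\<^sub>t = \<Delta>u - \<kappa> u + (\<kappa> u - f u + average of g u)\<close>. The bracket is
  nondecreasing in the present value of \<open>u\<close>, and the Neumann semigroup neither lowers minima nor raises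
  maxima. Hence, if \<open>u \<le> m\<close> and \<open>g u \<le> G\<close> hold from some time on, then \<open>u\<close> relaxes at rate \<open>\<kappa>\<close> to values
  below \<open>m + (G - f m) / \<kappa>\<close>, and the mirrored statement holds for lower bounds (\<open>solution_upper\<close>,
  \<open>solution_lower\<close>).

  Let \<open>S\<close> be the limit superior of \<open>u\<close>, uniformly in space. If \<open>S > ustar\<close>, the maximum \<open>G\<close> of \<open>g\<close> on \<open>[0,S]\<close> is
  smaller than \<open>f S\<close>, so the relaxation bound pushes \<open>u\<close> strictly below \<open>S\<close>; this is where \<open>ustar \<le> M\<close> enters,
  because \<open>g\<close> then rises on \<open>[0,ustar]\<close> and its maximum over \<open>[0,s]\<close> is already attained on \<open>[ustar,s]\<close>. Once
  the values of \<open>u\<close> are known to stay below \<open>ustar\<close> up to a small error, only the values of \<open>g\<close> between the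
  limit inferior \<open>I\<close> and \<open>ustar\<close> matter, and they exceed \<open>f I\<close> whenever \<open>0 < I < ustar\<close>; so \<open>I < ustar\<close> would
  be improved in the same way.

  It remains to exclude \<open>I = 0\<close>. The Neumann semigroup makes a nonnegative nonzero function positive at every
  point at some time (\<open>semigroup_strictly_positive\<close>). The delay turns this into positivity for all later
  times: as \<open>h > 0\<close>, a positive value of \<open>u\<close> at \<open>x\<close> within the last \<open>\<tau>\<close> time units makes the source at \<open>x\<close>
  positive now (\<open>positivity_persists\<close>). By compactness \<open>u\<close> is positive everywhere after some time, and
  from then on the lower relaxation bound keeps it above a small positive constant (\<open>persistence\<close>).

  All properties of the semigroup come from its generator, the closure of the classical Neumann Laplacian.
  Every function in its domain has a minimizer at which the Laplacian is nonnegative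
  (\<open>neumann_laplacian_closure_minimum\<close>): a Gaussian centred inside \<open>\<Omega>\<close> near a boundary point decreases in
  the outward direction, so that a Neumann function minus a multiple of it has no minimum on the nearby boundary,
  and the second derivative test applies to its minima in the ball. This comparison passes to uniform limits. With the
  centre at a point where an orbit is positive, the same Gaussian spreads positivity over a ball.
  The minimum principle carries over to the orbits by looking at a minimum over space and time, where the left
  derivative of the orbit is needed. That derivative exists because the operators are bounded uniformly on
  compact time intervals, a consequence of the uniform boundedness principle.\<close>

section \<open>Uniform boundedness for functionals on continuous functions\<close>

text \<open>A gliding hump argument, which avoids the Baire category theorem and hence a complete metric on the space of
  continuous functions. If the norms were unbounded, choose functionals of norm at least \<open>4\<^sup>j\<close> together with almost
  maximizing functions, and add these functions with weights \<open>\<plusminus> 3\<^sup>-\<^sup>j\<close>. The sign is chosen such that the \<open>j\<close>-th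
  functional is large on the \<open>j\<close>-th partial sum; the tail of the series is too small to cancel this.\<close>
lemma uniform_boundedness_continuous_functions:
  fixes L :: "nat \<Rightarrow> ('a::topological_space \<Rightarrow> real) \<Rightarrow> real"
  assumes lin: "\<And>n u v c d. continuous_on K u \<Longrightarrow> continuous_on K v \<Longrightarrow>
      L n (\<lambda>x. c * u x + d * v x) = c * L n u + d * L n v"
    and bdd: "\<And>n. \<exists>C. \<forall>u k. continuous_on K u \<longrightarrow> (\<forall>x\<in>K. \<bar>u x\<bar> \<le> k) \<longrightarrow> \<bar>L n u\<bar> \<le> C * k"
    and ptw: "\<And>u. continuous_on K u \<Longrightarrow> \<exists>B. \<forall>n. \<bar>L n u\<bar> \<le> B"
  shows "\<exists>B. \<forall>n u. continuous_on K u \<longrightarrow> (\<forall>x\<in>K. \<bar>u x\<bar> \<le> 1) \<longrightarrow> \<bar>L n u\<bar> \<le> B"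
proof (rule ccontr)
  assume contra: "\<not> ?thesis"
  \<comment> \<open>The factor \<open>4/3\<close> makes \<open>v\<close> an almost maximizing function: the tail, of norm at most half of the current
    weight, then costs at most two thirds of the gain.\<close>
  have pick: "\<exists>n v. continuous_on K v \<and> (\<forall>x\<in>K. \<bar>v x\<bar> \<le> 1) \<and> 4 ^ j \<le> \<bar>L n v\<bar> \<and>
      (\<forall>w. continuous_on K w \<longrightarrow> (\<forall>x\<in>K. \<bar>w x\<bar> \<le> 1) \<longrightarrow> \<bar>L n w\<bar> \<le> 4/3 * \<bar>L n v\<bar>)" for j :: nat
  proof -
    obtain n u0 where u0: "continuous_on K u0" "\<forall>x\<in>K. \<bar>u0 x\<bar> \<le> 1" "\<not> \<bar>L n u0\<bar> \<le> 2 * 4 ^ j"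
      using contra by blast
    define U where "U = {\<bar>L n w\<bar> | w. continuous_on K w \<and> (\<forall>x\<in>K. \<bar>w x\<bar> \<le> 1)}"
    have bU: "bdd_above U"
    proof -
      obtain C where "\<forall>u k. continuous_on K u \<longrightarrow> (\<forall>x\<in>K. \<bar>u x\<bar> \<le> k) \<longrightarrow> \<bar>L n u\<bar> \<le> C * k"
        using bdd by blast
      then show ?thesis unfolding U_def by (intro bdd_aboveI[of _ "C * 1"]) blast
    qed
    have u0U: "\<bar>L n u0\<bar> \<in> U" unfolding U_def using u0 by blast
    then have SU: "2 * 4 ^ j < Sup U" using u0(3) cSup_upper[OF _ bU] by fastforce
    then have "3/4 * Sup U < Sup U" using zero_less_power[of "4::real" j] by linarith
    then obtain r where r: "r \<in> U" "3/4 * Sup U < r" using less_cSup_iff[OF _ bU] u0U by blast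
    then obtain v where v: "r = \<bar>L n v\<bar>" "continuous_on K v" "\<forall>x\<in>K. \<bar>v x\<bar> \<le> 1"
      unfolding U_def by blast
    have "4 ^ j \<le> \<bar>L n v\<bar>" using r SU v(1) zero_less_power[of "4::real" j] by linarith
    moreover have "\<bar>L n w\<bar> \<le> 4/3 * \<bar>L n v\<bar>" if "continuous_on K w" "\<forall>x\<in>K. \<bar>w x\<bar> \<le> 1" for w
    proof -
      have "\<bar>L n w\<bar> \<le> Sup U" using that bU by (intro cSup_upper) (auto simp: U_def)
      then show ?thesis using r v(1) by linarith
    qed
    ultimately show ?thesis using v by blast
  qed
  obtain N V where V: "\<And>j. continuous_on K (V j)" "\<And>j x. x \<in> K \<Longrightarrow> \<bar>V j x\<bar> \<le> 1"
      "\<And>j::nat. 4 ^ j \<le> \<bar>L (N j) (V j)\<bar>"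
      "\<And>j w. continuous_on K w \<Longrightarrow> (\<And>x. x \<in> K \<Longrightarrow> \<bar>w x\<bar> \<le> 1) \<Longrightarrow> \<bar>L (N j) w\<bar> \<le> 4/3 * \<bar>L (N j) (V j)\<bar>"
    using pick by metis
  define pm where "pm j S = (if (1/3)^j * \<bar>L (N j) (V j)\<bar> \<le> \<bar>L (N j) (\<lambda>x. 1 * S x + (1/3)^j * V j x)\<bar>
     then (1/3)^j else - ((1/3)^j) :: real)" for j S
  define S where "S = rec_nat (\<lambda>x. 0) (\<lambda>j S x. 1 * S x + pm j S * V j x)"
  have S0: "S 0 = (\<lambda>x. 0)" and SSuc: "S (Suc j) = (\<lambda>x. 1 * S j x + pm j (S j) * V j x)" for j
    by (simp_all add: S_def)
  have Scont: "continuous_on K (S j)" for j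
    by (induction j) (auto simp: S0 SSuc intro!: continuous_intros V(1))
  have pmabs: "\<bar>pm j s\<bar> = (1/3)^j" for j s by (simp add: pm_def)
  \<comment> \<open>One of \<open>a + b\<close> and \<open>a - b\<close> has absolute value at least \<open>\<bar>b\<bar>\<close>.\<close>
  have big: "(1/3)^j * \<bar>L (N j) (V j)\<bar> \<le> \<bar>L (N j) (S (Suc j))\<bar>" for j
  proof (cases "(1/3)^j * \<bar>L (N j) (V j)\<bar> \<le> \<bar>L (N j) (\<lambda>x. 1 * S j x + (1/3)^j * V j x)\<bar>")
    case True
    then show ?thesis by (simp add: SSuc pm_def)
  next
    case False
    define a b where "a = L (N j) (S j)" and "b = (1/3)^j * L (N j) (V j)"
    have "\<bar>b\<bar> = (1/3)^j * \<bar>L (N j) (V j)\<bar>" by (simp add: b_def abs_mult)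
    moreover have "L (N j) (\<lambda>x. 1 * S j x + (1/3)^j * V j x) = a + b"
      using lin[OF Scont V(1), of "N j" 1 j "(1/3)^j" j] by (simp add: a_def b_def)
    moreover have "L (N j) (S (Suc j)) = a - b"
      unfolding SSuc using lin[OF Scont V(1), of "N j" 1 j "pm j (S j)" j] False
      by (simp add: a_def b_def pm_def)
    ultimately show ?thesis using False by linarith
  qed
  define d where "d i x = pm i (S i) * V i x" for i x
  have Ssum: "S j x = (\<Sum>i<j. d i x)" for j x
    by (induction j) (auto simp: S0 SSuc d_def)
  have dle: "norm (d i x) \<le> (1/3)^i" if "x \<in> K" for i x
    using mult_left_mono[OF V(2)[OF that, of i], of "\<bar>pm i (S i)\<bar>"] by (simp add: d_def abs_mult pmabs)
  define u where "u x = (\<Sum>i. d i x)" for x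
  have ul: "uniform_limit K (\<lambda>n x. \<Sum>i<n. d i x) u sequentially"
    unfolding u_def by (rule Weierstrass_m_test[where M = "\<lambda>i. (1/3)^i"])
      (use dle in auto)
  have ucont: "continuous_on K u"
    by (rule uniform_limit_theorem[OF _ ul]) (auto simp flip: Ssum intro!: always_eventually Scont)
  have tail: "\<bar>u x - S (Suc j) x\<bar> \<le> 1/2 * (1/3)^j" if "x \<in> K" for x j
  proof -
    have sm: "summable (\<lambda>i. d i x)"
      by (rule summable_comparison_test'[where g = "\<lambda>i. (1/3)^i"]) (use dle that in auto)
    have sg: "summable (\<lambda>i. (1/3::real)^(i + Suc j))"
      using summable_ignore_initial_segment[of "\<lambda>i. (1/3::real)^i" "Suc j"] by (simp add: summable_geometric)
    have "u x - S (Suc j) x = (\<Sum>i. d (i + Suc j) x)"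
      unfolding u_def Ssum using suminf_split_initial_segment[OF sm, of "Suc j"] by simp
    also have "\<bar>\<dots>\<bar> \<le> (\<Sum>i. (1/3::real)^(i + Suc j))"
      unfolding real_norm_def[symmetric] by (rule norm_suminf_le[OF dle[OF that] sg])
    also have "\<dots> = (1/3)^Suc j * (\<Sum>i. (1/3::real)^i)"
      by (subst suminf_mult[OF summable_geometric, symmetric]) (simp_all add: power_add mult_ac)
    also have "\<dots> = 1/2 * (1/3)^j" by (simp add: suminf_geometric)
    finally show ?thesis .
  qed
  have low: "1/3 * (4/3)^j \<le> \<bar>L (N j) u\<bar>" for j
  proof -
    \<comment> \<open>The tail, scaled to norm at most one.\<close>
    define w where "w x = (2 * 3^j) * u x + (- (2 * 3^j)) * S (Suc j) x" for x
    have wc: "continuous_on K w" unfolding w_def by (intro continuous_intros ucont Scont)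
    have "\<bar>w x\<bar> \<le> 1" if "x \<in> K" for x
    proof -
      have "\<bar>w x\<bar> = (2 * 3^j) * \<bar>u x - S (Suc j) x\<bar>"
        by (simp add: w_def abs_mult flip: right_diff_distrib)
      also have "\<dots> \<le> (2 * 3^j) * (1/2 * (1/3)^j)" by (intro mult_left_mono tail that) auto
      also have "\<dots> = 1" by (simp add: power_divide)
      finally show ?thesis .
    qed
    from V(4)[OF wc this, of j] have "\<bar>L (N j) w\<bar> \<le> 4/3 * \<bar>L (N j) (V j)\<bar>" .
    moreover have "L (N j) w = (2 * 3^j) * (L (N j) u - L (N j) (S (Suc j)))"
      unfolding w_def lin[OF ucont Scont] by (simp add: algebra_simps)
    ultimately have "(2 * 3^j) * \<bar>L (N j) u - L (N j) (S (Suc j))\<bar> \<le> 4/3 * \<bar>L (N j) (V j)\<bar>"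
      by (simp add: abs_mult)
    then have "\<bar>L (N j) u - L (N j) (S (Suc j))\<bar> \<le> 2/3 * ((1/3)^j * \<bar>L (N j) (V j)\<bar>)"
      by (simp add: field_simps power_divide)
    with big[of j] have "1/3 * ((1/3)^j * \<bar>L (N j) (V j)\<bar>) \<le> \<bar>L (N j) u\<bar>" by linarith
    moreover have "(1/3)^j * 4^j \<le> (1/3)^j * \<bar>L (N j) (V j)\<bar>" by (intro mult_left_mono V(3)) auto
    moreover have "(1/3::real)^j * 4^j = (4/3)^j" by (simp flip: power_mult_distrib)
    ultimately show ?thesis by linarith
  qed
  obtain B where B: "\<forall>n. \<bar>L n u\<bar> \<le> B" using ptw[OF ucont] by blast
  obtain j where "3 * B < (4/3)^j" using real_arch_pow[of "4/3" "3 * B"] by auto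
  with low[of j] spec[OF B, of "N j"] show False by linarith
qed

section \<open>Strongly continuous semigroups on the closure of a bounded set\<close>

text \<open>Turns pointwise derivatives of a family of functions into uniform estimates: the increment is expressed by a
  derivative at a point that is as close to \<open>s\<close> as \<open>s'\<close> is.\<close>
lemma mean_value_between:
  fixes F :: "real \<Rightarrow> real"
  assumes der: "\<And>s. s \<in> {a..b} \<Longrightarrow> (F has_real_derivative F' s) (at s within {a..b})"
    and s: "s \<in> {a..b}" "s' \<in> {a..b}"
  shows "\<exists>\<xi>\<in>{a..b}. \<bar>\<xi> - s\<bar> \<le> \<bar>s' - s\<bar> \<and> F s' - F s = (s' - s) * F' \<xi>"
proof -
  have *: "\<exists>\<xi>\<in>{p..q}. F q - F p = (q - p) * F' \<xi>" if "p \<in> {a..b}" "q \<in> {a..b}" "p \<le> q" for p q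
  proof -
    have "\<exists>\<xi>\<in>{p..q}. F q - F p = (\<lambda>h. h * F' \<xi>) (q - p)"
    proof (rule mvt_very_simple[OF \<open>p \<le> q\<close>])
      fix x assume "p \<le> x" "x \<le> q"
      with that have "(F has_real_derivative F' x) (at x within {p..q})"
        by (intro DERIV_subset[OF der]) auto
      then show "(F has_derivative (\<lambda>h. h * F' x)) (at x within {p..q})"
        by (simp add: has_field_derivative_def mult_commute_abs)
    qed
    then show ?thesis by simp
  qed
  show ?thesis
  proof (cases "s \<le> s'")
    case True
    from *[OF s True] show ?thesis using s by force
  next
    case False
    then obtain \<xi> where "\<xi> \<in> {s'..s}" "F s - F s' = (s - s') * F' \<xi>" using *[OF s(2,1)] by auto
    then show ?thesis using s False by (intro bexI[of _ \<xi>]) (auto simp: algebra_simps)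
  qed
qed

text \<open>Curves in the space of continuous functions on a compact \<open>K\<close> are represented throughout by jointly continuous
  functions \<open>(x, s) \<mapsto> \<Psi> s x\<close>; the next two lemmas recover the slices and the continuity of \<open>s \<mapsto> \<Psi> s\<close> in the supremum
  norm.\<close>
lemma continuous_slices:
  assumes "continuous_on (K \<times> I) (\<lambda>(x, s). \<Psi> s x)"
  shows "s \<in> I \<Longrightarrow> continuous_on K (\<Psi> s)" "x \<in> K \<Longrightarrow> continuous_on I (\<lambda>s. \<Psi> s x)"
proof -
  show "continuous_on K (\<Psi> s)" if "s \<in> I"
  proof -
    have "continuous_on K (\<lambda>x. (x, s))" by (intro continuous_intros)
    from continuous_on_compose2[OF assms this] show ?thesis using that by auto
  qed
  show "continuous_on I (\<lambda>s. \<Psi> s x)" if "x \<in> K"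
  proof -
    have "continuous_on I (\<lambda>s. (x, s))" by (intro continuous_intros)
    from continuous_on_compose2[OF assms this] show ?thesis using that by auto
  qed
qed

lemma uniform_in_parameter:
  fixes \<Psi> :: "real \<Rightarrow> 'a::metric_space \<Rightarrow> real"
  assumes "continuous_on (K \<times> I) (\<lambda>(x, s). \<Psi> s x)" "compact K" "compact I" "e > 0"
  obtains d where "d > 0" "\<And>s s' x. s \<in> I \<Longrightarrow> s' \<in> I \<Longrightarrow> \<bar>s' - s\<bar> < d \<Longrightarrow> x \<in> K \<Longrightarrow> \<bar>\<Psi> s' x - \<Psi> s x\<bar> < e"
proof -
  have "uniformly_continuous_on (K \<times> I) (\<lambda>(x, s). \<Psi> s x)"
    using assms by (intro compact_uniformly_continuous compact_Times)
  then obtain d where d: "d > 0" "\<forall>p\<in>K \<times> I. \<forall>q\<in>K \<times> I. dist q p < d \<longrightarrow>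
      dist ((\<lambda>(x, s). \<Psi> s x) q) ((\<lambda>(x, s). \<Psi> s x) p) < e"
    unfolding uniformly_continuous_on_def using \<open>e > 0\<close> by blast
  show ?thesis
  proof (rule that[OF d(1)])
    fix s s' x assume "s \<in> I" "s' \<in> I" "\<bar>s' - s\<bar> < d" "x \<in> K"
    then show "\<bar>\<Psi> s' x - \<Psi> s x\<bar> < e"
      using d(2)[rule_format, of "(x, s)" "(x, s')"] by (auto simp: dist_Pair_Pair dist_real_def)
  qed
qed

locale semigroup_on_closure =
  fixes \<Omega> :: "'a::euclidean_space set" and T :: "real \<Rightarrow> ('a \<Rightarrow> real) \<Rightarrow> 'a \<Rightarrow> real"
  assumes nonempty: "\<Omega> \<noteq> {}" and bounded: "bounded \<Omega>" and C0: "C0_semigroup \<Omega> T"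
begin

abbreviation K where "K \<equiv> closure \<Omega>"

lemma compact_K: "compact K" using bounded by simp
lemma K_nonempty: "K \<noteq> {}" using nonempty by simp

lemma bounded_on_K:
  fixes u :: "'a \<Rightarrow> real"
  assumes "continuous_on K u"
  obtains k where "k \<ge> 0" "\<And>x. x \<in> K \<Longrightarrow> \<bar>u x\<bar> \<le> k"
proof -
  have "bounded (u ` K)" using assms compact_K by (intro compact_imp_bounded compact_continuous_image)
  then obtain k where "\<forall>x\<in>K. \<bar>u x\<bar> \<le> k" by (auto simp: bounded_iff)
  moreover obtain x0 where "x0 \<in> K" using K_nonempty ex_in_conv[of K] by metis
  then have "k \<ge> 0" using calculation by (metis abs_ge_zero order_trans)
  ultimately show ?thesis using that by blast
qed

lemma T_cont: "0 \<le> t \<Longrightarrow> continuous_on K u \<Longrightarrow> continuous_on K (T t u)"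
  using C0 unfolding C0_semigroup_def by blast

lemma T_lin:
  "0 \<le> t \<Longrightarrow> continuous_on K u \<Longrightarrow> continuous_on K v \<Longrightarrow> x \<in> K \<Longrightarrow>
     T t (\<lambda>y. c * u y + d * v y) x = c * T t u x + d * T t v x"
  using C0[unfolded C0_semigroup_def, THEN conjunct2, THEN conjunct1] by simp

lemma T_bounded:
  "0 \<le> t \<Longrightarrow> \<exists>C. \<forall>u k. continuous_on K u \<longrightarrow> (\<forall>x\<in>K. \<bar>u x\<bar> \<le> k) \<longrightarrow> (\<forall>x\<in>K. \<bar>T t u x\<bar> \<le> C * k)"
  using C0[unfolded C0_semigroup_def, THEN conjunct2, THEN conjunct2, THEN conjunct1, rule_format, of t]
  by (simp only: mem_Collect_eq) blast

lemma T_0: "continuous_on K u \<Longrightarrow> x \<in> K \<Longrightarrow> T 0 u x = u x"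
  using C0 unfolding C0_semigroup_def by blast

lemma T_add:
  "0 \<le> s \<Longrightarrow> 0 \<le> t \<Longrightarrow> continuous_on K u \<Longrightarrow> x \<in> K \<Longrightarrow> T (s + t) u x = T s (T t u) x"
  using C0 unfolding C0_semigroup_def by blast

lemma T_right_0: "continuous_on K u \<Longrightarrow> uniform_limit K (\<lambda>t. T t u) u (at_right 0)"
  using C0 unfolding C0_semigroup_def by blast

lemma T_scale: "0 \<le> t \<Longrightarrow> continuous_on K u \<Longrightarrow> x \<in> K \<Longrightarrow> T t (\<lambda>y. c * u y) x = c * T t u x"
  using T_lin[of t u u x c 0] by simp

lemma T_diff:
  "0 \<le> t \<Longrightarrow> continuous_on K u \<Longrightarrow> continuous_on K v \<Longrightarrow> x \<in> K \<Longrightarrow>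
     T t (\<lambda>y. u y - v y) x = T t u x - T t v x"
  using T_lin[of t u v x 1 "-1"] by simp

lemma T_plus:
  "0 \<le> t \<Longrightarrow> continuous_on K u \<Longrightarrow> continuous_on K v \<Longrightarrow> x \<in> K \<Longrightarrow>
     T t (\<lambda>y. u y + v y) x = T t u x + T t v x"
  using T_lin[of t u v x 1 1] by simp

lemma T_cong:
  assumes "0 \<le> t" "continuous_on K u" "continuous_on K v" "x \<in> K" "\<And>y. y \<in> K \<Longrightarrow> u y = v y"
  shows "T t u x = T t v x"
proof -
  obtain C where C: "\<forall>u k. continuous_on K u \<longrightarrow> (\<forall>x\<in>K. \<bar>u x\<bar> \<le> k) \<longrightarrow> (\<forall>x\<in>K. \<bar>T t u x\<bar> \<le> C * k)"
    using T_bounded[OF assms(1)] by blast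
  have "continuous_on K (\<lambda>y. u y - v y)" by (intro continuous_intros assms)
  with C[rule_format, of "\<lambda>y. u y - v y" 0 x] assms(4,5) have "\<bar>T t (\<lambda>y. u y - v y) x\<bar> \<le> C * 0" by simp
  then show ?thesis using T_diff[OF assms(1-4)] by simp
qed

text \<open>Otherwise there are \<open>t n \<rightarrow> 0\<close>, functions of norm at most one and points \<open>x n\<close> at which the images are larger
  than \<open>n\<close>. Strong continuity at \<open>0\<close> makes the functionals \<open>u \<mapsto> T (t n) u (x n)\<close> pointwise bounded, so they are
  uniformly bounded.\<close>
lemma bounded_near_0:
  "\<exists>\<delta>>0. \<exists>C. \<forall>t\<in>{0..\<delta>}. \<forall>u k. continuous_on K u \<longrightarrow> (\<forall>x\<in>K. \<bar>u x\<bar> \<le> k) \<longrightarrow> (\<forall>x\<in>K. \<bar>T t u x\<bar> \<le> C * k)"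
proof (rule ccontr)
  assume contra: "\<not> ?thesis"
  have "\<exists>t v x. t \<in> {0..1 / real (Suc n)} \<and> continuous_on K v \<and> (\<forall>x\<in>K. \<bar>v x\<bar> \<le> 1) \<and> x \<in> K \<and> \<bar>T t v x\<bar> > real n" for n
  proof -
    have "1 / real (Suc n) > 0" by simp
    then obtain t u k x where *: "t \<in> {0..1 / real (Suc n)}" "continuous_on K u" "\<forall>x\<in>K. \<bar>u x\<bar> \<le> k" "x \<in> K"
      "\<not> \<bar>T t u x\<bar> \<le> real n * k" using contra by blast
    have t: "0 \<le> t" using * by simp
    obtain C where C: "\<forall>u k. continuous_on K u \<longrightarrow> (\<forall>x\<in>K. \<bar>u x\<bar> \<le> k) \<longrightarrow> (\<forall>x\<in>K. \<bar>T t u x\<bar> \<le> C * k)"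
      using T_bounded[OF t] by blast
    have "k \<noteq> 0"
    proof
      assume "k = 0"
      with C[rule_format, of u 0 x] *(2,3,4) have "\<bar>T t u x\<bar> \<le> C * 0" by simp
      with * \<open>k = 0\<close> show False by simp
    qed
    moreover have "k \<ge> 0" using *(3,4) by force
    ultimately have k: "k > 0" by simp
    have "T t (\<lambda>y. (1/k) * u y) x = (1/k) * T t u x" using T_scale t * by blast
    moreover have "\<bar>(1/k) * T t u x\<bar> > real n" using *(5) k by (simp add: abs_mult field_simps)
    ultimately have "\<bar>T t (\<lambda>y. (1/k) * u y) x\<bar> > real n" by simp
    moreover have "\<forall>x\<in>K. \<bar>(1/k) * u x\<bar> \<le> 1" using *(3) k by (simp add: field_simps)
    moreover have "continuous_on K (\<lambda>y. (1/k) * u y)" by (intro continuous_intros *)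
    ultimately show ?thesis using *(1,4) by blast
  qed
  then obtain t v x where tvx: "\<And>n. t n \<in> {0..1 / real (Suc n)}" "\<And>n. continuous_on K (v n)"
    "\<And>n. \<forall>x\<in>K. \<bar>v n x\<bar> \<le> 1" "\<And>n. x n \<in> K" "\<And>n. \<bar>T (t n) (v n) (x n)\<bar> > real n" by metis
  have t0: "0 \<le> t n" for n using tvx(1)[of n] by simp
  have "\<exists>B. \<forall>n u. continuous_on K u \<longrightarrow> (\<forall>x\<in>K. \<bar>u x\<bar> \<le> 1) \<longrightarrow> \<bar>T (t n) u (x n)\<bar> \<le> B"
  proof (rule uniform_boundedness_continuous_functions)
    show "T (t n) (\<lambda>x. c * u x + d * v x) (x n) = c * T (t n) u (x n) + d * T (t n) v (x n)"
      if "continuous_on K u" "continuous_on K v" for n u v c d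
      by (rule T_lin[OF t0 that tvx(4)])
    show "\<exists>C. \<forall>u k. continuous_on K u \<longrightarrow> (\<forall>x\<in>K. \<bar>u x\<bar> \<le> k) \<longrightarrow> \<bar>T (t n) u (x n)\<bar> \<le> C * k" for n
      using T_bounded[OF t0[of n]] tvx(4)[of n] by blast
    show "\<exists>B. \<forall>n. \<bar>T (t n) u (x n)\<bar> \<le> B" if u: "continuous_on K u" for u
    proof -
      obtain k where k: "k \<ge> 0" "\<And>x. x \<in> K \<Longrightarrow> \<bar>u x\<bar> \<le> k" using bounded_on_K[OF u] by blast
      have "eventually (\<lambda>s. \<forall>x\<in>K. dist (T s u x) (u x) < 1) (at_right 0)"
        using T_right_0[OF u] by (auto simp: uniform_limit_iff)
      then obtain b where b: "b > 0" "\<And>s. s > 0 \<Longrightarrow> s < b \<Longrightarrow> \<forall>x\<in>K. dist (T s u x) (u x) < 1"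
        by (auto simp: eventually_at_right_field)
      obtain n0 where n0: "1 / real (Suc n0) < b" using b(1) by (metis nat_approx_posE)
      have "\<bar>T (t n) u (x n)\<bar> \<le> k + 1" if "n \<ge> n0" for n
      proof (cases "t n = 0")
        case True then show ?thesis using k(2)[OF tvx(4)[of n]] T_0[OF u tvx(4)[of n]] by simp
      next
        case False
        then have "t n > 0" using t0[of n] by simp
        moreover have "1 / real (Suc n) \<le> 1 / real (Suc n0)" using that by (simp add: field_simps)
        then have "t n < b" using tvx(1)[of n] n0 by auto
        ultimately have "dist (T (t n) u (x n)) (u (x n)) < 1" using b tvx(4) by blast
        then show ?thesis using k(2)[OF tvx(4)[of n]] by (simp add: dist_real_def)
      qed
      moreover have "\<bar>T (t n) u (x n)\<bar> \<le> (\<Sum>i<n0. \<bar>T (t i) u (x i)\<bar>)" if "n < n0" for n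
        using that by (intro member_le_sum) auto
      ultimately have "\<forall>n. \<bar>T (t n) u (x n)\<bar> \<le> max (k + 1) (\<Sum>i<n0. \<bar>T (t i) u (x i)\<bar>)"
        by (metis le_max_iff_disj not_le)
      then show ?thesis by blast
    qed
  qed
  then obtain B where "\<forall>n u. continuous_on K u \<longrightarrow> (\<forall>x\<in>K. \<bar>u x\<bar> \<le> 1) \<longrightarrow> \<bar>T (t n) u (x n)\<bar> \<le> B" by blast
  then have "\<bar>T (t n) (v n) (x n)\<bar> \<le> B" for n using tvx by blast
  then have "real n < B" for n using tvx(5)[of n] by (meson less_le_trans)
  then show False using reals_Archimedean2 less_asym by blast
qed

lemma locally_bounded:
  obtains C where "C > 0" "\<And>t u k x. t \<in> {0..S} \<Longrightarrow> continuous_on K u \<Longrightarrow> (\<And>x. x \<in> K \<Longrightarrow> \<bar>u x\<bar> \<le> k) \<Longrightarrow> x \<in> K \<Longrightarrow> \<bar>T t u x\<bar> \<le> C * k"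
proof -
  obtain \<delta> C0 where d: "\<delta> > 0" and "\<forall>t\<in>{0..\<delta>}. \<forall>u k. continuous_on K u \<longrightarrow> (\<forall>x\<in>K. \<bar>u x\<bar> \<le> k) \<longrightarrow> (\<forall>x\<in>K. \<bar>T t u x\<bar> \<le> C0 * k)"
    using bounded_near_0 by blast
  define C where "C = max C0 1"
  have C1: "C \<ge> 1" by (simp add: C_def)
  have C: "\<bar>T t u x\<bar> \<le> C * k" if "t \<in> {0..\<delta>}" "continuous_on K u" "\<And>x. x \<in> K \<Longrightarrow> \<bar>u x\<bar> \<le> k" "x \<in> K" for t u k x
  proof -
    have "\<bar>T t u x\<bar> \<le> C0 * k" using \<open>\<forall>t\<in>{0..\<delta>}. _\<close> that by blast
    moreover have "k \<ge> 0" using that(3)[OF that(4)] by simp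
    then have "C0 * k \<le> C * k" by (simp add: C_def mult_right_mono)
    ultimately show ?thesis by simp
  qed
  have *: "\<bar>T t u x\<bar> \<le> C ^ Suc n * k"
    if "t \<in> {0..real (Suc n) * \<delta>}" "continuous_on K u" "\<And>x. x \<in> K \<Longrightarrow> \<bar>u x\<bar> \<le> k" "x \<in> K" for n t u k x
    using that
  proof (induction n arbitrary: t u x k)
    case 0 then show ?case using C by auto
  next
    case (Suc n)
    show ?case
    proof (cases "t \<le> \<delta>")
      case True
      have "\<bar>T t u x\<bar> \<le> C * k" using C Suc.prems True by auto
      also have "\<dots> \<le> C ^ Suc (Suc n) * k"
        using Suc.prems(3)[OF Suc.prems(4)] C1 power_increasing[of 1 "Suc (Suc n)" C]
        by (intro mult_right_mono) auto
      finally show ?thesis .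
    next
      case False
      have "\<bar>T \<delta> (T (t - \<delta>) u) x\<bar> \<le> C * (C ^ Suc n * k)"
        using False d Suc.prems
        by (intro C Suc.IH T_cont) (auto simp: algebra_simps)
      then show ?thesis using T_add[of \<delta> "t - \<delta>" u x] False d Suc.prems by (simp add: mult.assoc)
    qed
  qed
  obtain n where n: "S / \<delta> < real n" using reals_Archimedean2 by blast
  then have "S < real (Suc n) * \<delta>" using d by (simp add: field_simps)
  then show ?thesis using that[of "C ^ Suc n"] * C1 by auto
qed

text \<open>Continuity from the left at \<open>t\<close> uses \<open>T t u - T s u = T s (T (t - s) u - u)\<close>, whose outer operator changes
  with \<open>s\<close>; this is the reason for the local bound.\<close>
lemma orbit_continuous:
  assumes u: "continuous_on K u" and "e > 0" "0 \<le> t"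
  obtains d where "d > 0" "\<And>s x. 0 \<le> s \<Longrightarrow> \<bar>s - t\<bar> < d \<Longrightarrow> x \<in> K \<Longrightarrow> \<bar>T s u x - T t u x\<bar> < e"
proof -
  obtain C where C: "C > 0" "\<And>r u k x. r \<in> {0..t} \<Longrightarrow> continuous_on K u \<Longrightarrow> (\<And>x. x \<in> K \<Longrightarrow> \<bar>u x\<bar> \<le> k) \<Longrightarrow> x \<in> K \<Longrightarrow> \<bar>T r u x\<bar> \<le> C * k"
    using locally_bounded by blast
  define e' where "e' = e / (2 * C)"
  have e': "e' > 0" using C assms by (simp add: e'_def)
  have "eventually (\<lambda>s. \<forall>x\<in>K. dist (T s u x) (u x) < e') (at_right 0)"
    using T_right_0[OF u] e' by (auto simp: uniform_limit_iff)
  then obtain b where b: "b > 0" "\<And>s. s > 0 \<Longrightarrow> s < b \<Longrightarrow> \<forall>x\<in>K. dist (T s u x) (u x) < e'"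
    by (auto simp: eventually_at_right_field)
  have small: "\<bar>T s u x - u x\<bar> \<le> e'" if "0 \<le> s" "s < b" "x \<in> K" for s x
    using b(2)[of s] that T_0[OF u that(3)] e' by (cases "s = 0") (auto simp: dist_real_def less_imp_le)
  have step: "\<bar>T (m + r) u x - T m u x\<bar> < e" if "m \<in> {0..t}" "0 \<le> r" "r < b" "x \<in> K" for m r x
  proof -
    have "\<bar>T m (\<lambda>y. T r u y - u y) x\<bar> \<le> C * e'"
      using that by (intro C small continuous_intros T_cont u) auto
    moreover have "C * e' < e" using C(1) \<open>e > 0\<close> by (simp add: e'_def)
    moreover have "T m (\<lambda>y. T r u y - u y) x = T (m + r) u x - T m u x"
      using that T_diff[OF _ T_cont[OF _ u] u] T_add[OF _ _ u] by auto
    ultimately show ?thesis by simp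
  qed
  show ?thesis
  proof (rule that[OF b(1)])
    fix s x assume s: "0 \<le> s" "\<bar>s - t\<bar> < b" "x \<in> K"
    show "\<bar>T s u x - T t u x\<bar> < e"
    proof (cases "s \<le> t")
      case True then show ?thesis using step[of s "t - s" x] s by (simp add: abs_minus_commute)
    next
      case False then show ?thesis using step[of t "s - t" x] s assms by simp
    qed
  qed
qed

lemma T_jointly_continuous:
  fixes I :: "real set"
  assumes \<Psi>: "continuous_on (K \<times> I) (\<lambda>(x, s). \<Psi> s x)" and I: "compact I"
    and r: "continuous_on I r" "\<And>s. s \<in> I \<Longrightarrow> 0 \<le> r s"
  shows "continuous_on (K \<times> I) (\<lambda>(x, s). T (r s) (\<Psi> s) x)"
proof -
  have slice: "continuous_on K (\<Psi> s)" if "s \<in> I" for s using continuous_slices(1)[OF \<Psi> that] .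
  have "bounded (r ` I)" using r I by (intro compact_imp_bounded compact_continuous_image)
  then obtain S where S: "\<forall>s\<in>I. \<bar>r s\<bar> \<le> S" by (auto simp: bounded_iff)
  obtain C where C: "C > 0" "\<And>r u k x. r \<in> {0..S} \<Longrightarrow> continuous_on K u \<Longrightarrow> (\<And>x. x \<in> K \<Longrightarrow> \<bar>u x\<bar> \<le> k) \<Longrightarrow> x \<in> K \<Longrightarrow> \<bar>T r u x\<bar> \<le> C * k"
    using locally_bounded by blast
  show ?thesis
    unfolding continuous_on_iff
  proof (intro ballI allI impI)
    fix p and e :: real assume "p \<in> K \<times> I" "0 < e"
    then obtain x0 s0 where p: "p = (x0, s0)" "x0 \<in> K" "s0 \<in> I" by auto
    have e3: "e / (3 * C) > 0" using \<open>e > 0\<close> C(1) by simp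
    obtain d1 where d1: "d1 > 0" "\<And>s x. s \<in> I \<Longrightarrow> \<bar>s - s0\<bar> < d1 \<Longrightarrow> x \<in> K \<Longrightarrow> \<bar>\<Psi> s x - \<Psi> s0 x\<bar> < e / (3 * C)"
      by (rule uniform_in_parameter[OF \<Psi> compact_K I e3]) (use p(3) in blast)
    obtain d2 where d2: "d2 > 0" "\<And>s x. 0 \<le> s \<Longrightarrow> \<bar>s - r s0\<bar> < d2 \<Longrightarrow> x \<in> K \<Longrightarrow> \<bar>T s (\<Psi> s0) x - T (r s0) (\<Psi> s0) x\<bar> < e/3"
      using orbit_continuous[OF slice[OF p(3)], of "e/3" "r s0"] r(2)[OF p(3)] \<open>e > 0\<close> by auto
    obtain d3 where d3: "d3 > 0" "\<forall>s\<in>I. dist s s0 < d3 \<longrightarrow> dist (r s) (r s0) < d2"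
      using r(1)[unfolded continuous_on_iff, rule_format, OF p(3) d2(1)] by blast
    have "continuous_on K (T (r s0) (\<Psi> s0))" by (intro T_cont r slice p)
    then obtain d4 where d4: "d4 > 0" "\<forall>x\<in>K. dist x x0 < d4 \<longrightarrow> dist (T (r s0) (\<Psi> s0) x) (T (r s0) (\<Psi> s0) x0) < e/3"
      using p(2) \<open>e > 0\<close> unfolding continuous_on_iff by (elim ballE[of _ _ x0] allE[of _ "e/3"]) auto
    show "\<exists>d>0. \<forall>q\<in>K \<times> I. dist q p < d \<longrightarrow> dist ((\<lambda>(x, s). T (r s) (\<Psi> s) x) q) ((\<lambda>(x, s). T (r s) (\<Psi> s) x) p) < e"
    proof (intro exI[of _ "Min {d1, d3, d4}"] conjI ballI impI)
      show "0 < Min {d1, d3, d4}" using d1 d3 d4 by simp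
      fix q assume "q \<in> K \<times> I" "dist q p < Min {d1, d3, d4}"
      then obtain x s where q: "q = (x, s)" "x \<in> K" "s \<in> I" "dist x x0 < d4" "dist s s0 < d1" "dist s s0 < d3"
        using p dist_fst_le[of q p] dist_snd_le[of q p] by (cases q) auto
      have rs: "0 \<le> r s" "r s \<in> {0..S}" using r(2) q S by auto
      have "\<bar>T (r s) (\<lambda>y. \<Psi> s y - \<Psi> s0 y) x\<bar> \<le> C * (e / (3 * C))"
        using d1(2)[OF q(3)] q rs p by (intro C continuous_intros slice) (auto simp: dist_real_def less_imp_le)
      then have "\<bar>T (r s) (\<Psi> s) x - T (r s) (\<Psi> s0) x\<bar> \<le> e/3"
        using T_diff[OF rs(1) slice[OF q(3)] slice[OF p(3)] q(2)] C(1) by simp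
      moreover have "\<bar>T (r s) (\<Psi> s0) x - T (r s0) (\<Psi> s0) x\<bar> < e/3"
        using d3(2) q rs by (intro d2) (auto simp: dist_real_def)
      moreover have "\<bar>T (r s0) (\<Psi> s0) x - T (r s0) (\<Psi> s0) x0\<bar> < e/3"
        using d4(2) q by (auto simp: dist_real_def)
      ultimately show "dist ((\<lambda>(x, s). T (r s) (\<Psi> s) x) q) ((\<lambda>(x, s). T (r s) (\<Psi> s) x) p) < e"
        unfolding p(1) q(1) prod.case dist_real_def by linarith
    qed
  qed
qed

lemma orbit_jointly_continuous:
  assumes "continuous_on K u"
  shows "continuous_on (K \<times> {0..S}) (\<lambda>(x, s). T s u x)"
proof -
  have "continuous_on (K \<times> {0..S}) (\<lambda>p. u (fst p))"
    by (rule continuous_on_compose2[OF assms continuous_on_fst[OF continuous_on_id]]) auto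
  then have "continuous_on (K \<times> {0..S}) (\<lambda>(x, s::real). u x)" by (simp add: case_prod_unfold)
  from T_jointly_continuous[OF this compact_Icc continuous_on_id] show ?thesis by simp
qed

lemma integral_curve_continuous:
  fixes a b :: real and \<Psi> :: "real \<Rightarrow> 'a \<Rightarrow> real"
  assumes "continuous_on (K \<times> {a..b}) (\<lambda>(x, s). \<Psi> s x)" "s \<in> {a..b}"
  shows "continuous_on K (\<lambda>x. integral {a..s} (\<lambda>\<sigma>. \<Psi> \<sigma> x))"
proof -
  have "continuous_on (K \<times> cbox a s) (\<lambda>(x, s). \<Psi> s x)"
    by (rule continuous_on_subset[OF assms(1)]) (use assms(2) in auto)
  then show ?thesis using integral_continuous_on_param[of K a s "\<lambda>x s. \<Psi> s x"] by simp
qed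

text \<open>The semigroup commutes with integrals of curves: \<open>s \<mapsto> T r (\<integral>\<^sub>a\<^sup>s \<Psi>)\<close> has derivative \<open>T r (\<Psi> s)\<close>, because the
  difference quotients of \<open>\<integral>\<^sub>a\<^sup>s \<Psi>\<close> converge uniformly.\<close>
lemma T_integral:
  fixes a b :: real
  assumes \<Psi>: "continuous_on (K \<times> {a..b}) (\<lambda>(x, s). \<Psi> s x)" and "a \<le> b" "0 \<le> r" "x \<in> K"
  shows "T r (\<lambda>y. integral {a..b} (\<lambda>s. \<Psi> s y)) x = integral {a..b} (\<lambda>s. T r (\<Psi> s) x)"
proof -
  define J where "J s y = integral {a..s} (\<lambda>\<sigma>. \<Psi> \<sigma> y)" for s y
  obtain C where C: "C > 0" "\<And>t u k x. t \<in> {0..r} \<Longrightarrow> continuous_on K u \<Longrightarrow> (\<And>x. x \<in> K \<Longrightarrow> \<bar>u x\<bar> \<le> k) \<Longrightarrow> x \<in> K \<Longrightarrow> \<bar>T t u x\<bar> \<le> C * k"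
    using locally_bounded by blast
  have J: "continuous_on K (J s)" if "s \<in> {a..b}" for s
    unfolding J_def using integral_curve_continuous[OF \<Psi> that] .
  have slice: "continuous_on K (\<Psi> s)" if "s \<in> {a..b}" for s using continuous_slices(1)[OF \<Psi> that] .
  have der: "((\<lambda>s. T r (J s) x) has_vector_derivative T r (\<Psi> s) x) (at s within {a..b})" if s: "s \<in> {a..b}" for s
    unfolding has_vector_derivative_def has_derivative_within_alt
  proof (intro conjI allI impI)
    show "bounded_linear (\<lambda>h::real. h *\<^sub>R T r (\<Psi> s) x)" by (rule bounded_linear_scaleR_left)
    fix e :: real assume "e > 0"
    have eC: "e / C > 0" using \<open>e > 0\<close> C(1) by simp
    obtain d where d: "d > 0" "\<And>s' y. s' \<in> {a..b} \<Longrightarrow> \<bar>s' - s\<bar> < d \<Longrightarrow> y \<in> K \<Longrightarrow> \<bar>\<Psi> s' y - \<Psi> s y\<bar> < e / C"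
      by (rule uniform_in_parameter[OF \<Psi> compact_K compact_Icc eC]) (use s in blast)
    show "\<exists>d>0. \<forall>s'\<in>{a..b}. norm (s' - s) < d \<longrightarrow> norm (T r (J s') x - T r (J s) x - (s' - s) *\<^sub>R T r (\<Psi> s) x) \<le> e * norm (s' - s)"
    proof (intro exI[of _ d] conjI d(1) ballI impI)
      fix s' assume s': "s' \<in> {a..b}" "norm (s' - s) < d"
      have est: "\<bar>(J s' y - J s y) - (s' - s) * \<Psi> s y\<bar> \<le> \<bar>s' - s\<bar> * (e / C)" if y: "y \<in> K" for y
      proof -
        have "\<exists>\<xi>\<in>{a..b}. \<bar>\<xi> - s\<bar> \<le> \<bar>s' - s\<bar> \<and> J s' y - J s y = (s' - s) * \<Psi> \<xi> y"
          by (rule mean_value_between[OF _ s s'(1)])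
            (auto simp: J_def intro!: integral_has_real_derivative continuous_slices(2)[OF \<Psi> y])
        then obtain \<xi> where \<xi>: "\<xi> \<in> {a..b}" "\<bar>\<xi> - s\<bar> \<le> \<bar>s' - s\<bar>" "J s' y - J s y = (s' - s) * \<Psi> \<xi> y" by blast
        then have "\<bar>(J s' y - J s y) - (s' - s) * \<Psi> s y\<bar> = \<bar>s' - s\<bar> * \<bar>\<Psi> \<xi> y - \<Psi> s y\<bar>"
          by (simp add: abs_mult flip: right_diff_distrib)
        also have "\<dots> \<le> \<bar>s' - s\<bar> * (e / C)"
          using d(2)[OF \<xi>(1) _ y] \<xi>(2) s'(2) by (intro mult_left_mono) (auto simp: less_imp_le)
        finally show ?thesis .
      qed
      have "\<bar>T r (\<lambda>y. (J s' y - J s y) - (s' - s) * \<Psi> s y) x\<bar> \<le> C * (\<bar>s' - s\<bar> * (e / C))"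
        using assms s s' by (intro C est continuous_intros J slice) auto
      moreover have "T r (\<lambda>y. (J s' y - J s y) - (s' - s) * \<Psi> s y) x = T r (J s') x - T r (J s) x - (s' - s) * T r (\<Psi> s) x"
        using T_diff[OF \<open>0 \<le> r\<close> continuous_on_diff[OF J[OF s'(1)] J[OF s]], of "\<lambda>y. (s' - s) * \<Psi> s y"] T_diff[OF \<open>0 \<le> r\<close> J[OF s'(1)] J[OF s]]
          T_scale[OF \<open>0 \<le> r\<close> slice[OF s]] \<open>x \<in> K\<close> slice[OF s] by (simp add: continuous_intros)
      ultimately show "norm (T r (J s') x - T r (J s) x - (s' - s) *\<^sub>R T r (\<Psi> s) x) \<le> e * norm (s' - s)"
        using C(1) by (simp add: mult.commute)
    qed
  qed
  have "((\<lambda>s. T r (\<Psi> s) x) has_integral T r (J b) x - T r (J a) x) {a..b}"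
    by (rule fundamental_theorem_of_calculus[OF \<open>a \<le> b\<close> der])
  moreover have "T r (J a) x = 0"
  proof -
    have "T r (J a) x = T r (\<lambda>y. 0 * J a y) x" using assms J by (intro T_cong continuous_intros) (auto simp: J_def)
    then show ?thesis using T_scale[of r "J a" x 0] assms J by simp
  qed
  ultimately show ?thesis by (simp add: J_def[abs_def] integral_unique)
qed

end

context semigroup_on_closure
begin

text \<open>For \<open>l = 0\<close> and small \<open>S\<close> these integrals, divided by \<open>S\<close>, approximate \<open>u\<close> within the domain of the generator. For
  \<open>l = 1\<close> and large \<open>S\<close> they approximate the resolvent of \<open>u\<close>, that is, they solve \<open>A V = V - u\<close> up to an
  exponentially small error, without any improper integral.\<close>
lemma generator_discounted_integral:
  fixes l S :: real
  assumes u: "continuous_on K u" and "0 \<le> S"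
  defines "V \<equiv> \<lambda>x. integral {0..S} (\<lambda>s. exp (- l * s) * T s u x)"
  shows "generator \<Omega> T V (\<lambda>x. l * V x + exp (- l * S) * T S u x - u x)"
proof -
  define E where "E s x = exp (- l * s) * T s u x" for s x
  define J where "J r x = integral {0..r} (\<lambda>s. E s x)" for r x
  have E: "continuous_on (K \<times> {0..R}) (\<lambda>(x, s). E s x)" for R
    unfolding E_def using orbit_jointly_continuous[OF u, of R]
    by (auto simp: case_prod_unfold intro!: continuous_intros)
  have Ex: "continuous_on {0..R} (\<lambda>s. E s x)" if "x \<in> K" for x R
    using continuous_slices(2)[OF E that] .
  have V: "continuous_on K V"
    using integral_curve_continuous[OF E, of S S] \<open>0 \<le> S\<close> by (simp add: V_def E_def)
  have TV: "T r V x = exp (l * r) * (J (S + r) x - J r x)" if "x \<in> K" "r \<in> {0..1}" for x r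
  proof -
    have r: "0 \<le> r" using that by simp
    have "T r V x = integral {0..S} (\<lambda>s. T r (E s) x)"
      using T_integral[OF E \<open>0 \<le> S\<close> r that(1)] by (simp add: V_def E_def[abs_def])
    also have "\<dots> = integral {0..S} (\<lambda>s. exp (l * r) * E (s + r) x)"
    proof (rule integral_cong)
      fix s assume s: "s \<in> {0..S}"
      then have s0: "0 \<le> s" by simp
      have "T r (E s) x = exp (- l * s) * T r (T s u) x"
        unfolding E_def[abs_def] by (rule T_scale[OF r T_cont[OF s0 u] that(1)])
      also have "\<dots> = exp (- l * s) * T (r + s) u x" by (simp only: T_add[OF r s0 u that(1)])
      also have "exp (- l * s) = exp (l * r) * exp (- l * (s + r))"
        by (simp add: distrib_left flip: exp_add)
      finally have "T r (E s) x = exp (l * r) * E (s + r) x"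
        by (simp only: E_def[of "r + s" x] mult.assoc add.commute)
      then show "T r (E s) x = exp (l * r) * E (s + r) x" .
    qed
    also have "\<dots> = exp (l * r) * integral {0..S} (\<lambda>s. E (s + r) x)" by simp
    also have "integral {0..S} (\<lambda>s. E (s + r) x) = integral {r..S + r} (\<lambda>s. E s x)"
    proof (rule integral_unique)
      have "(\<lambda>s. E s x) integrable_on {r..S + r}"
        by (rule integrable_on_subinterval[OF integrable_continuous_interval[OF Ex[OF that(1), of "S + r"]]])
          (use r in auto)
      then have "((\<lambda>s. E s x) has_integral integral {r..S + r} (\<lambda>s. E s x)) (cbox (0 + r) (S + r))"
        by (simp add: integrable_integral)
      then have "((\<lambda>s. E s x) \<circ> (+) r has_integral integral {r..S + r} (\<lambda>s. E s x)) (cbox 0 S)"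
        by (simp only: has_integral_shift_cbox_iff)
      then show "((\<lambda>s. E (s + r) x) has_integral integral {r..S + r} (\<lambda>s. E s x)) {0..S}"
        by (simp add: o_def add.commute)
    qed
    also have "\<dots> = J (S + r) x - J r x"
    proof -
      have "J r x + integral {r..S + r} (\<lambda>s. E s x) = J (S + r) x" unfolding J_def
        using r \<open>0 \<le> S\<close> by (intro Henstock_Kurzweil_Integration.integral_combine integrable_continuous_interval Ex that) auto
      then show ?thesis by simp
    qed
    finally show ?thesis .
  qed
  \<comment> \<open>The derivative of \<open>r \<mapsto> T r V x\<close>; its joint continuity gives uniformity in \<open>x\<close> of the limit at \<open>r = 0\<close>.\<close>
  define D where "D r x = l * T r V x + exp (l * r) * (E (S + r) x - E r x)" for r x
  have ES: "continuous_on (K \<times> {0..1}) (\<lambda>(x, r). E (S + r) x)"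
  proof -
    have "continuous_on (K \<times> {0..1}) (\<lambda>p. (fst p, S + snd p))" by (intro continuous_intros)
    moreover have "(\<lambda>p. (fst p, S + snd p)) ` (K \<times> {0..1}) \<subseteq> K \<times> {0..S + 1}" using \<open>0 \<le> S\<close> by auto
    ultimately have "continuous_on (K \<times> {0..1}) (\<lambda>p. case (fst p, S + snd p) of (x, s) \<Rightarrow> E s x)"
      by (rule continuous_on_compose2[OF E])
    then show ?thesis by (simp add: case_prod_unfold)
  qed
  have D: "continuous_on (K \<times> {0..1}) (\<lambda>(x, r). D r x)"
    unfolding D_def using ES E[of 1] orbit_jointly_continuous[OF V, of 1]
    by (auto simp: case_prod_unfold intro!: continuous_intros)
  have der: "((\<lambda>r. T r V x) has_real_derivative D r x) (at r within {0..1})"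
    if x: "x \<in> K" and r: "r \<in> {0..1}" for x r
  proof -
    have J1: "((\<lambda>r. J r x) has_real_derivative E r x) (at r within {0..1})"
      unfolding J_def by (rule integral_has_real_derivative[OF Ex[OF x] r])
    have "((\<lambda>r. J r x) has_real_derivative E (S + r) x) (at (S + r) within {0..S + 1})"
      unfolding J_def using r \<open>0 \<le> S\<close> by (intro integral_has_real_derivative[OF Ex[OF x]]) auto
    then have "((\<lambda>r. J r x) has_real_derivative E (S + r) x) (at (S + r) within (\<lambda>r. S + r) ` {0..1})"
      by (rule DERIV_subset) (use \<open>0 \<le> S\<close> in auto)
    moreover have "((\<lambda>r. S + r) has_real_derivative 1) (at r within {0..1})"
      by (auto intro!: derivative_eq_intros)
    ultimately have "((\<lambda>r. J r x) \<circ> (\<lambda>r. S + r) has_real_derivative E (S + r) x * 1) (at r within {0..1})"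
      by (rule DERIV_image_chain)
    then have J2: "((\<lambda>r. J (S + r) x) has_real_derivative E (S + r) x) (at r within {0..1})"
      by (simp only: o_def mult_1_right)
    have "((\<lambda>r. exp (l * r) * (J (S + r) x - J r x)) has_real_derivative
        l * (exp (l * r) * (J (S + r) x - J r x)) + exp (l * r) * (E (S + r) x - E r x)) (at r within {0..1})"
      by (rule derivative_eq_intros J1 J2 refl)+ (simp add: algebra_simps)
    then have "((\<lambda>r. exp (l * r) * (J (S + r) x - J r x)) has_real_derivative D r x) (at r within {0..1})"
      by (simp add: D_def TV[OF x r])
    then show ?thesis
      by (rule has_field_derivative_transform_within[OF _ zero_less_one r]) (simp add: TV[OF x])
  qed
  have D0: "D 0 x = l * V x + exp (- l * S) * T S u x - u x" if "x \<in> K" for x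
    using T_0[OF V that] T_0[OF u that] by (simp add: D_def E_def)
  have "uniform_limit K (\<lambda>t x. (T t V x - V x) / t) (D 0) (at_right 0)"
    unfolding uniform_limit_iff eventually_at_right_field
  proof (intro allI impI)
    fix e :: real assume "e > 0"
    obtain d where d: "d > 0" "\<And>s s' x. s \<in> {0..1} \<Longrightarrow> s' \<in> {0..1} \<Longrightarrow> \<bar>s' - s\<bar> < d \<Longrightarrow> x \<in> K \<Longrightarrow> \<bar>D s' x - D s x\<bar> < e"
      using uniform_in_parameter[OF D compact_K compact_Icc \<open>e > 0\<close>] by blast
    show "\<exists>b>0. \<forall>y>0. y < b \<longrightarrow> (\<forall>x\<in>K. dist ((T y V x - V x) / y) (D 0 x) < e)"
    proof (intro exI[of _ "min d 1"] conjI allI impI ballI)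
      show "0 < min d 1" using d by simp
      fix r x assume r: "0 < r" "r < min d 1" and x: "x \<in> K"
      have "\<exists>\<xi>\<in>{0..1}. \<bar>\<xi> - 0\<bar> \<le> \<bar>r - 0\<bar> \<and> T r V x - T 0 V x = (r - 0) * D \<xi> x"
        using r by (intro mean_value_between der x) auto
      then obtain \<xi> where "\<xi> \<in> {0..1}" "\<bar>\<xi>\<bar> \<le> r" "T r V x - V x = r * D \<xi> x"
        using r T_0[OF V x] by auto
      then show "dist ((T r V x - V x) / r) (D 0 x) < e"
        using d(2)[of 0 \<xi> x] r x by (simp add: dist_real_def)
    qed
  qed
  then have "uniform_limit K (\<lambda>t x. (T t V x - V x) / t) (\<lambda>x. l * V x + exp (- l * S) * T S u x - u x) (at_right 0)"
    by (rule uniform_limit_cong'[THEN iffD1, rotated 2]) (simp_all add: D0)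
  moreover have "continuous_on K (\<lambda>x. l * V x + exp (- l * S) * T S u x - u x)"
    by (intro continuous_intros V T_cont u \<open>0 \<le> S\<close>)
  ultimately show ?thesis unfolding generator_def using V by simp
qed

lemma generator_eventually:
  assumes "generator \<Omega> T u w" "e > 0"
  obtains b where "b > 0" "\<And>r x. 0 < r \<Longrightarrow> r < b \<Longrightarrow> x \<in> K \<Longrightarrow> \<bar>T r u x - u x - r * w x\<bar> \<le> e * r"
proof -
  have "eventually (\<lambda>r. \<forall>x\<in>K. dist ((T r u x - u x) / r) (w x) < e) (at_right 0)"
    using assms by (auto simp: generator_def uniform_limit_iff)
  then obtain b where b: "b > 0" "\<And>r. r > 0 \<Longrightarrow> r < b \<Longrightarrow> \<forall>x\<in>K. dist ((T r u x - u x) / r) (w x) < e"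
    by (auto simp: eventually_at_right_field)
  show ?thesis
  proof (rule that[OF b(1)])
    fix r x assume *: "0 < r" "r < b" "x \<in> K"
    have "T r u x - u x - r * w x = r * ((T r u x - u x) / r - w x)" using * by (simp add: field_simps)
    then have "\<bar>T r u x - u x - r * w x\<bar> = r * \<bar>(T r u x - u x) / r - w x\<bar>" using * by (simp add: abs_mult)
    also have "\<dots> \<le> r * e" using b(2)[of r] * by (intro mult_left_mono) (auto simp: dist_real_def less_imp_le)
    finally show "\<bar>T r u x - u x - r * w x\<bar> \<le> e * r" by (simp add: mult.commute)
  qed
qed

lemma generator_continuous:
  assumes "generator \<Omega> T u w"
  shows "continuous_on K u" "continuous_on K w"
  using assms by (auto simp: generator_def)

lemma generator_semigroup:
  assumes gen: "generator \<Omega> T u w" and "0 \<le> t"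
  shows "generator \<Omega> T (T t u) (T t w)"
proof -
  note cont = generator_continuous[OF gen]
  obtain C where C: "C > 0" "\<And>r u k x. r \<in> {0..t} \<Longrightarrow> continuous_on K u \<Longrightarrow> (\<And>x. x \<in> K \<Longrightarrow> \<bar>u x\<bar> \<le> k) \<Longrightarrow> x \<in> K \<Longrightarrow> \<bar>T r u x\<bar> \<le> C * k"
    using locally_bounded by blast
  have "uniform_limit K (\<lambda>r x. (T r (T t u) x - T t u x) / r) (T t w) (at_right 0)"
    unfolding uniform_limit_iff eventually_at_right_field
  proof (intro allI impI)
    fix e :: real assume "e > 0"
    then have "e / (2 * C) > 0" using C(1) by simp
    from generator_eventually[OF gen this] obtain b where b: "b > 0"
      "\<And>r x. 0 < r \<Longrightarrow> r < b \<Longrightarrow> x \<in> K \<Longrightarrow> \<bar>T r u x - u x - r * w x\<bar> \<le> e / (2 * C) * r" by blast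
    show "\<exists>b>0. \<forall>r>0. r < b \<longrightarrow> (\<forall>x\<in>K. dist ((T r (T t u) x - T t u x) / r) (T t w x) < e)"
    proof (intro exI[of _ b] conjI allI impI ballI b(1))
      fix r x assume r: "0 < r" "r < b" and x: "x \<in> K"
      have c1: "continuous_on K (T r u)" using r cont by (intro T_cont) auto
      have c2: "continuous_on K (\<lambda>y. r * w y)" by (intro continuous_intros cont)
      have "\<bar>T t (\<lambda>y. T r u y - u y - r * w y) x\<bar> \<le> C * (e / (2 * C) * r)"
        using assms by (intro C(2) b r x continuous_intros cont c1) auto
      also have "\<dots> = r * (e / 2)" using C(1) by simp
      finally have "\<bar>T t (\<lambda>y. T r u y - u y - r * w y) x\<bar> \<le> r * (e / 2)" .
      moreover have "T t (\<lambda>y. T r u y - u y - r * w y) x = T r (T t u) x - T t u x - r * T t w x"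
        using T_diff[OF \<open>0 \<le> t\<close> continuous_on_diff[OF c1 cont(1)] c2 x] T_diff[OF \<open>0 \<le> t\<close> c1 cont(1) x]
          T_scale[OF \<open>0 \<le> t\<close> cont(2) x, of r] T_add[of t r u x] T_add[of r t u x] r x \<open>0 \<le> t\<close> cont
        by (simp add: add.commute)
      moreover have "(T r (T t u) x - T t u x) / r - T t w x = (T r (T t u) x - T t u x - r * T t w x) / r"
        using r by (simp add: field_simps)
      ultimately have "\<bar>(T r (T t u) x - T t u x) / r - T t w x\<bar> \<le> e / 2"
        using r by (simp add: pos_divide_le_eq mult.commute)
      then show "dist ((T r (T t u) x - T t u x) / r) (T t w x) < e"
        using \<open>e > 0\<close> by (simp add: dist_real_def)
    qed
  qed
  then show ?thesis unfolding generator_def using cont \<open>0 \<le> t\<close> by (simp add: T_cont)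
qed

lemma orbit_left_derivative:
  assumes gen: "generator \<Omega> T u w" and "0 < t" "e > 0" "x \<in> K"
  obtains h where "0 < h" "h < t" "T t u x - T (t - h) u x - h * T t w x \<ge> - (e * h)"
proof -
  note cont = generator_continuous[OF gen]
  obtain C where C: "C > 0" "\<And>r u k x. r \<in> {0..t} \<Longrightarrow> continuous_on K u \<Longrightarrow> (\<And>x. x \<in> K \<Longrightarrow> \<bar>u x\<bar> \<le> k) \<Longrightarrow> x \<in> K \<Longrightarrow> \<bar>T r u x\<bar> \<le> C * k"
    using locally_bounded by blast
  have "e / (2 * C) > 0" using C(1) \<open>e > 0\<close> by simp
  from generator_eventually[OF gen this] obtain b where b: "b > 0"
    "\<And>r x. 0 < r \<Longrightarrow> r < b \<Longrightarrow> x \<in> K \<Longrightarrow> \<bar>T r u x - u x - r * w x\<bar> \<le> e / (2 * C) * r" by blast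
  have "e / 2 > 0" using \<open>e > 0\<close> by simp
  from orbit_continuous[OF cont(2) this, of t] \<open>0 < t\<close> obtain d where d: "d > 0"
    "\<And>s x. 0 \<le> s \<Longrightarrow> \<bar>s - t\<bar> < d \<Longrightarrow> x \<in> K \<Longrightarrow> \<bar>T s w x - T t w x\<bar> < e / 2" by auto
  define h where "h = min b (min d t) / 2"
  have h: "0 < h" "h < b" "h < d" "h < t" using b d \<open>0 < t\<close> by (auto simp: h_def)
  have th: "0 \<le> t - h" using h by simp
  have c1: "continuous_on K (T h u)" using h cont by (intro T_cont) auto
  have c2: "continuous_on K (\<lambda>y. h * w y)" by (intro continuous_intros cont)
  have "\<bar>T (t - h) (\<lambda>y. T h u y - u y - h * w y) x\<bar> \<le> C * (e / (2 * C) * h)"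
    using assms h by (intro C(2) b continuous_intros cont c1) auto
  also have "\<dots> = h * (e / 2)" using C(1) by simp
  finally have 1: "\<bar>T (t - h) (\<lambda>y. T h u y - u y - h * w y) x\<bar> \<le> h * (e / 2)" .
  have 2: "T (t - h) (\<lambda>y. T h u y - u y - h * w y) x = T t u x - T (t - h) u x - h * T (t - h) w x"
    using T_diff[OF th continuous_on_diff[OF c1 cont(1)] c2 \<open>x \<in> K\<close>] T_diff[OF th c1 cont(1) \<open>x \<in> K\<close>]
      T_scale[OF th cont(2) \<open>x \<in> K\<close>, of h] T_add[of "t - h" h u x] h \<open>x \<in> K\<close> th cont
    by simp
  have "\<bar>T (t - h) w x - T t w x\<bar> < e / 2" using h th \<open>x \<in> K\<close> by (intro d) auto
  then have "- (e / 2) \<le> T (t - h) w x - T t w x" by linarith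
  then have "h * (T (t - h) w x - T t w x) \<ge> h * (- (e / 2))" using h by (intro mult_left_mono) auto
  with 1 2 have "T t u x - T (t - h) u x - h * T t w x \<ge> - (e * h)" by (simp add: algebra_simps)
  with h show ?thesis using that by blast
qed

end

section \<open>Semigroups whose generator obeys a minimum principle\<close>

locale semigroup_with_minimum_principle = semigroup_on_closure +
  assumes minimum_principle: "generator \<Omega> T v w \<Longrightarrow> \<exists>p\<in>closure \<Omega>. (\<forall>x\<in>closure \<Omega>. v p \<le> v x) \<and> 0 \<le> w p"
begin

text \<open>Consider \<open>T t u x + \<epsilon> t\<close> at a minimum over space and time. At a positive time its left derivative in time is at
  most \<open>0\<close>, so the orbit decreases at rate at least \<open>\<epsilon>\<close> there; but the generator is nonnegative at a suitable
  minimizer in space.\<close>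
lemma lower_bound_preserved_domain:
  assumes gen: "generator \<Omega> T u w" and t1: "0 \<le> t1" and m: "\<And>x. x \<in> K \<Longrightarrow> m \<le> u x" and x1: "x1 \<in> K"
  shows "m \<le> T t1 u x1"
proof (rule ccontr)
  assume neg: "\<not> m \<le> T t1 u x1"
  note cont = generator_continuous[OF gen]
  have "t1 \<noteq> 0" using neg m[OF x1] T_0[OF cont(1) x1] by auto
  then have t1': "t1 > 0" using t1 by simp
  define \<epsilon> where "\<epsilon> = (m - T t1 u x1) / (2 * t1)"
  have \<epsilon>: "\<epsilon> > 0" using neg t1' by (simp add: \<epsilon>_def)
  have "continuous_on (K \<times> {0..t1}) (\<lambda>p. T (snd p) u (fst p) + \<epsilon> * snd p)"
    using orbit_jointly_continuous[OF cont(1), of t1]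
    by (auto simp: case_prod_unfold intro!: continuous_intros)
  moreover have "compact (K \<times> {0..t1})" using compact_K by (intro compact_Times) auto
  moreover have "K \<times> {0..t1} \<noteq> {}" using x1 t1 by auto
  ultimately obtain q where "q \<in> K \<times> {0..t1}"
    "\<forall>p\<in>K \<times> {0..t1}. T (snd q) u (fst q) + \<epsilon> * snd q \<le> T (snd p) u (fst p) + \<epsilon> * snd p"
    using continuous_attains_inf by blast
  then obtain p s where p: "p \<in> K" "s \<in> {0..t1}"
    and min: "\<And>x t. x \<in> K \<Longrightarrow> t \<in> {0..t1} \<Longrightarrow> T s u p + \<epsilon> * s \<le> T t u x + \<epsilon> * t"
    by (cases q) force
  have "T s u p + \<epsilon> * s \<le> T t1 u x1 + (m - T t1 u x1) / 2"
    using min[OF x1, of t1] t1' by (simp add: \<epsilon>_def)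
  then have "T s u p + \<epsilon> * s < m" using neg by (simp add: field_simps)
  then have "s \<noteq> 0" using m[OF p(1)] T_0[OF cont(1) p(1)] by auto
  then have s: "s > 0" "0 \<le> s" using p by auto
  obtain p' where p': "p' \<in> K" "\<forall>x\<in>K. T s u p' \<le> T s u x" "0 \<le> T s w p'"
    using minimum_principle[OF generator_semigroup[OF gen s(2)]] by blast
  obtain h where h: "0 < h" "h < s" "T s u p' - T (s - h) u p' - h * T s w p' \<ge> - (\<epsilon> / 2 * h)"
    using orbit_left_derivative[OF gen s(1) _ p'(1), of "\<epsilon> / 2"] \<epsilon> by auto
  have "T s u p' + \<epsilon> * s \<le> T (s - h) u p' + \<epsilon> * (s - h)"
    using p'(2) p min[OF p'(1), of "s - h"] h by force
  moreover have "h * T s w p' \<ge> 0" using h p' by simp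
  ultimately have "\<epsilon> * h \<le> \<epsilon> / 2 * h" using h(3) by (simp add: algebra_simps)
  moreover have "\<epsilon> * h > 0" using \<epsilon> h by simp
  ultimately show False by simp
qed

text \<open>The bound is carried from the domain of the generator to all continuous functions by the time averages of
  the orbit of \<open>u\<close>. Applied to constants, this lemma and the next show that the semigroup fixes them.\<close>
lemma T_lower:
  assumes u: "continuous_on K u" and t: "0 \<le> t" and m: "\<And>x. x \<in> K \<Longrightarrow> m \<le> u x" and x: "x \<in> K"
  shows "m \<le> T t u x"
proof (rule field_le_epsilon)
  fix e :: real assume "e > 0"
  obtain C where C: "C > 0" "\<And>r u k x. r \<in> {0..t} \<Longrightarrow> continuous_on K u \<Longrightarrow> (\<And>x. x \<in> K \<Longrightarrow> \<bar>u x\<bar> \<le> k) \<Longrightarrow> x \<in> K \<Longrightarrow> \<bar>T r u x\<bar> \<le> C * k"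
    using locally_bounded by blast
  define \<delta> where "\<delta> = e / (1 + C)"
  have "(1 + C) * \<delta> = e" using C(1) by (simp add: \<delta>_def)
  then have "\<delta> + C * \<delta> = e" by (simp only: distrib_right mult_1)
  moreover have "\<delta> > 0" using \<open>e > 0\<close> C(1) by (simp add: \<delta>_def)
  ultimately have \<delta>: "\<delta> > 0" "\<delta> + C * \<delta> = e" by blast+
  obtain d where d: "d > 0" "\<And>s x. 0 \<le> s \<Longrightarrow> \<bar>s - 0\<bar> < d \<Longrightarrow> x \<in> K \<Longrightarrow> \<bar>T s u x - T 0 u x\<bar> < \<delta>"
    using orbit_continuous[OF u \<delta>(1), of 0] by auto
  define S where "S = d / 2"
  have S: "S > 0" "0 \<le> S" "S < d" using d by (auto simp: S_def)
  define V where "V = (\<lambda>x. integral {0..S} (\<lambda>s. exp (- 0 * s) * T s u x))"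
  note gen = generator_discounted_integral[OF u S(2), of 0, folded V_def]
  note contV = generator_continuous(1)[OF gen]
  have close: "\<bar>V y - S * u y\<bar> \<le> S * \<delta>" if y: "y \<in> K" for y
  proof -
    have int: "(\<lambda>s. T s u y) integrable_on {0..S}"
      by (intro integrable_continuous_interval continuous_slices(2)[OF orbit_jointly_continuous[OF u] y])
    have "V y - S * u y = integral {0..S} (\<lambda>s. T s u y - u y)"
      using S by (subst Henstock_Kurzweil_Integration.integral_diff[OF int]) (auto simp: V_def)
    moreover have "norm (integral {0..S} (\<lambda>s. T s u y - u y)) \<le> integral {0..S} (\<lambda>s. \<delta>)"
    proof (rule integral_norm_bound_integral)
      show "(\<lambda>s. T s u y - u y) integrable_on {0..S}" using int by (intro integrable_diff) auto
      fix s assume "s \<in> {0..S}"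
      then show "norm (T s u y - u y) \<le> \<delta>" using d(2)[of s y] T_0[OF u y] S y by auto
    qed auto
    ultimately show ?thesis using S by simp
  qed
  have "S * (m - \<delta>) \<le> V y" if "y \<in> K" for y
  proof -
    have "S * m \<le> S * u y" using m[OF that] S by simp
    then show ?thesis using close[OF that] by (simp add: algebra_simps)
  qed
  from lower_bound_preserved_domain[OF gen t this x] have 1: "S * (m - \<delta>) \<le> T t V x" .
  have cu: "continuous_on K (\<lambda>y. S * u y)" by (intro continuous_intros u)
  have "\<bar>T t (\<lambda>y. V y - S * u y) x\<bar> \<le> C * (S * \<delta>)"
    using t x close by (intro C(2) continuous_intros contV u) auto
  moreover have "T t (\<lambda>y. V y - S * u y) x = T t V x - S * T t u x"
    using T_diff[OF t contV cu x] T_scale[OF t u x] by simp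
  ultimately have "S * m \<le> S * (T t u x + (\<delta> + C * \<delta>))" using 1 by (simp add: algebra_simps)
  then show "m \<le> T t u x + e" using S \<delta>(2) by simp
qed

lemma T_upper:
  assumes u: "continuous_on K u" and t: "0 \<le> t" and m: "\<And>x. x \<in> K \<Longrightarrow> u x \<le> m" and x: "x \<in> K"
  shows "T t u x \<le> m"
proof -
  have "- m \<le> T t (\<lambda>y. -1 * u y) x" using m by (intro T_lower t x continuous_intros u) auto
  then show ?thesis using T_scale[OF t u x, of "-1"] by simp
qed

lemma T_nonneg:
  "continuous_on K u \<Longrightarrow> 0 \<le> t \<Longrightarrow> (\<And>x. x \<in> K \<Longrightarrow> 0 \<le> u x) \<Longrightarrow> x \<in> K \<Longrightarrow> 0 \<le> T t u x"
  by (rule T_lower)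

end

section \<open>Outward balls and Gaussian barriers\<close>

lemma defining_function_gradient:
  assumes df: "defining_function \<Omega> p U \<rho>"
  obtains D where "continuous_on U D" "\<And>x. x \<in> U \<Longrightarrow> GDERIV \<rho> x :> D x" "\<And>x. x \<in> U \<Longrightarrow> D x \<noteq> 0"
proof -
  define D where "D x = (\<Sum>b\<in>Basis. partial_deriv b \<rho> x *\<^sub>R b)" for x
  have C1: "Ck_on (Suc 0) \<rho> U" using df by (simp add: defining_function_def smooth_on_def del: Ck_on.simps)
  then have diff: "\<And>x. x \<in> U \<Longrightarrow> \<rho> differentiable (at x)"
    and cont: "\<And>b. b \<in> Basis \<Longrightarrow> continuous_on U (partial_deriv b \<rho>)" by auto
  have 1: "continuous_on U D" unfolding D_def by (intro continuous_intros cont)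
  have 2: "GDERIV \<rho> x :> D x" if "x \<in> U" for x
  proof -
    let ?f = "frechet_derivative \<rho> (at x)"
    have hd: "(\<rho> has_derivative ?f) (at x)" using diff[OF that] by (simp add: frechet_derivative_works)
    then have lin: "linear ?f" by (rule has_derivative_linear)
    have "?f h = h \<bullet> D x" for h
    proof -
      have "?f h = ?f (\<Sum>b\<in>Basis. (h \<bullet> b) *\<^sub>R b)" by (simp add: euclidean_representation)
      also have "\<dots> = (\<Sum>b\<in>Basis. (h \<bullet> b) * ?f b)" by (simp add: linear_sum[OF lin] linear_cmul[OF lin])
      also have "\<dots> = h \<bullet> D x" by (simp add: D_def inner_sum_right partial_deriv_def mult.commute)
      finally show ?thesis .
    qed
    then have "?f = (\<lambda>h. h \<bullet> D x)" by blast
    with hd show ?thesis by (simp add: gderiv_def)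
  qed
  have "D x \<noteq> 0" if "x \<in> U" for x
    using 2[OF that] df that by (auto simp: defining_function_def)
  with 1 2 show ?thesis using that by blast
qed

lemma defining_function_zero_on_frontier:
  assumes df: "defining_function \<Omega> p U \<rho>" and "open \<Omega>" "x \<in> U" "x \<in> frontier \<Omega>"
  shows "\<rho> x = 0"
proof (rule antisym)
  obtain D where "\<And>x. x \<in> U \<Longrightarrow> GDERIV \<rho> x :> D x" using defining_function_gradient[OF df] by metis
  then have "(\<rho> has_derivative (\<lambda>h. h \<bullet> D x)) (at x)" using assms(3) by (simp only: gderiv_def)
  then have "isCont \<rho> x" by (rule has_derivative_continuous)
  have U: "open U" and eq: "\<Omega> \<inter> U = {x \<in> U. \<rho> x < 0}" using df by (auto simp: defining_function_def)
  have "x \<notin> \<Omega>" using assms by (simp add: frontier_def interior_open)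
  then show "0 \<le> \<rho> x" using eq assms by force
  show "\<rho> x \<le> 0"
  proof (rule ccontr)
    assume "\<not> \<rho> x \<le> 0"
    then have "eventually (\<lambda>y. \<rho> y > 0) (at x)"
      using \<open>isCont \<rho> x\<close> by (intro order_tendstoD(1)[where y = "\<rho> x"]) (auto simp: isCont_def)
    then obtain S where S: "open S" "x \<in> S" "\<forall>y\<in>S. y \<noteq> x \<longrightarrow> \<rho> y > 0"
      by (auto simp: eventually_at_topological)
    have "x \<in> closure \<Omega>" using assms by (simp add: frontier_def)
    then have "\<Omega> \<inter> (S \<inter> U) \<noteq> {}"
      using S(1,2) U assms(3) by (metis IntI closure_iff_nhds_not_empty open_Int order_refl)
    then obtain y where "y \<in> \<Omega>" "y \<in> S" "y \<in> U" by blast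
    moreover have "y \<noteq> x" using \<open>y \<in> \<Omega>\<close> \<open>x \<notin> \<Omega>\<close> by blast
    moreover have "\<rho> y < 0" using eq \<open>y \<in> \<Omega>\<close> \<open>y \<in> U\<close> by blast
    ultimately show False using S(3) by fastforce
  qed
qed

text \<open>The condition under which functions that decrease radially from \<open>c\<close> decrease in the outward direction at all
  boundary points inside the ball. The ball may stick out of the domain.\<close>
definition outward_ball :: "'a::euclidean_space set \<Rightarrow> 'a \<Rightarrow> real \<Rightarrow> bool" where
  "outward_ball \<Omega> c R \<longleftrightarrow>
     (\<forall>x\<in>frontier \<Omega> \<inter> ball c R. \<exists>U \<rho> D. defining_function \<Omega> x U \<rho> \<and> (GDERIV \<rho> x :> D) \<and> 0 < D \<bullet> (x - c))"

lemma outward_ball_interior: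
  assumes "open \<Omega>" "ball c R \<subseteq> \<Omega>"
  shows "outward_ball \<Omega> c R"
  using assms by (auto simp: outward_ball_def frontier_def interior_open)

text \<open>Move from \<open>p\<close> a small distance \<open>d\<close> inwards along the normal \<open>n\<close> to obtain \<open>c\<close>, and take the radius \<open>2 d\<close>. For boundary
  points \<open>x\<close> in the ball, \<open>D x \<bullet> (x - c) = D x \<bullet> (x - p) + d (D x \<bullet> n)\<close>. The first term is \<open>o(d)\<close> as \<open>\<rho>\<close> vanishes at
  \<open>x\<close> and \<open>p\<close> and is continuously differentiable, and the second is about \<open>d \<bar>D p\<bar>\<close>.\<close>
lemma outward_ball_at_frontier:
  assumes dom: "smooth_bounded_domain \<Omega>" and p: "p \<in> frontier \<Omega>"
  obtains c R where "c \<in> \<Omega>" "p \<in> ball c R" "outward_ball \<Omega> c R"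
proof -
  obtain U \<rho> where df: "defining_function \<Omega> p U \<rho>"
    using dom[unfolded smooth_bounded_domain_def] p by metis
  have op: "open \<Omega>" using dom by (simp add: smooth_bounded_domain_def)
  have U: "open U" "p \<in> U" and eq: "\<Omega> \<inter> U = {x \<in> U. \<rho> x < 0}" using df by (auto simp: defining_function_def)
  obtain D where D: "continuous_on U D" "\<And>x. x \<in> U \<Longrightarrow> GDERIV \<rho> x :> D x" "\<And>x. x \<in> U \<Longrightarrow> D x \<noteq> 0"
    using defining_function_gradient[OF df] by blast
  define N where "N = norm (D p)"
  have N: "N > 0" using D(3)[OF U(2)] by (simp add: N_def)
  \<comment> \<open>The error terms below add up to \<open>7 \<eta> d\<close>, less than the main term \<open>d N\<close>.\<close>
  define \<eta> where "\<eta> = N / 8"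
  have \<eta>: "\<eta> > 0" using N by (simp add: \<eta>_def)
  define n where "n = (1 / N) *\<^sub>R D p"
  have nn: "norm n = 1" "n \<bullet> D p = N" using N by (simp_all add: n_def N_def power2_norm_eq_inner[symmetric] power2_eq_square)
  obtain r0 where r0: "r0 > 0" "ball p r0 \<subseteq> U" using U openE by blast
  obtain r1 where r1: "r1 > 0" "\<And>x. x \<in> U \<Longrightarrow> dist x p < r1 \<Longrightarrow> dist (D x) (D p) < \<eta>"
    using D(1) U(2) \<eta> unfolding continuous_on_iff by blast
  have "(\<rho> has_derivative (\<lambda>h. h \<bullet> D p)) (at p)" using D(2)[OF U(2)] by (simp add: gderiv_def)
  then obtain r2 where r2: "r2 > 0" "\<And>x. norm (x - p) < r2 \<Longrightarrow> norm (\<rho> x - \<rho> p - (x - p) \<bullet> D p) \<le> \<eta> * norm (x - p)"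
    unfolding has_derivative_at_alt using \<eta> by blast
  have \<rho>p: "\<rho> p = 0" using defining_function_zero_on_frontier[OF df op U(2) p] .
  define d where "d = min r0 (min r1 r2) / 4"
  have d: "d > 0" "4 * d \<le> r0" "4 * d \<le> r1" "4 * d \<le> r2" using r0 r1 r2 by (auto simp: d_def)
  define c where "c = p - d *\<^sub>R n"
  have pc: "p - c = d *\<^sub>R n" by (simp add: c_def)
  have distpc: "dist p c = d" using d nn by (simp add: dist_norm pc)
  have "c \<in> \<Omega>"
  proof -
    have cp: "norm (c - p) = d" using distpc by (simp add: dist_norm norm_minus_commute)
    have "(c - p) \<bullet> D p = - (d * N)" using nn by (simp add: c_def)
    moreover have "norm (\<rho> c - \<rho> p - (c - p) \<bullet> D p) \<le> \<eta> * d" using r2(2)[of c] cp d by simp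
    ultimately have "\<rho> c \<le> \<eta> * d - d * N" using \<rho>p by (simp add: abs_le_iff)
    also have "\<dots> < 0" using d N by (simp add: \<eta>_def)
    finally have "\<rho> c < 0" .
    moreover have "c \<in> U" using r0(2) distpc d by (auto simp: subset_iff)
    ultimately show ?thesis using eq by blast
  qed
  moreover have "p \<in> ball c (2 * d)" using distpc d by (simp add: dist_commute)
  moreover have "outward_ball \<Omega> c (2 * d)"
    unfolding outward_ball_def
  proof (intro ballI exI conjI)
    fix x assume "x \<in> frontier \<Omega> \<inter> ball c (2 * d)"
    then have x: "x \<in> frontier \<Omega>" "dist c x < 2 * d" by auto
    have xp: "norm (x - p) < 3 * d" using x(2) distpc dist_triangle[of x p c] unfolding dist_norm[symmetric] by (simp add: dist_commute)
    then have xU: "x \<in> U" using r0(2) d by (auto simp: subset_iff dist_norm norm_minus_commute)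
    show "defining_function \<Omega> x U \<rho>" using df xU by (simp add: defining_function_def)
    show "GDERIV \<rho> x :> D x" using D(2)[OF xU] .
    have Dx: "norm (D x - D p) < \<eta>" using r1(2)[OF xU] xp d by (simp add: dist_norm)
    have "\<rho> x = 0" using defining_function_zero_on_frontier[OF df op xU x(1)] .
    then have "norm ((x - p) \<bullet> D p) \<le> \<eta> * norm (x - p)" using r2(2)[of x] xp d \<rho>p by simp
    also have "\<dots> \<le> \<eta> * (3 * d)" using xp \<eta> by (intro mult_left_mono) auto
    finally have 1: "- (\<eta> * (3 * d)) \<le> D p \<bullet> (x - p)" by (simp add: inner_commute abs_le_iff)
    have "\<bar>(D x - D p) \<bullet> (x - p)\<bar> \<le> norm (D x - D p) * norm (x - p)" by (rule Cauchy_Schwarz_ineq2)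
    also have "\<dots> \<le> \<eta> * (3 * d)" using Dx xp d \<eta> by (intro mult_mono) auto
    finally have 2: "- (\<eta> * (3 * d)) \<le> (D x - D p) \<bullet> (x - p)" by (simp add: abs_le_iff)
    have "\<bar>(D x - D p) \<bullet> n\<bar> \<le> norm (D x - D p) * norm n" by (rule Cauchy_Schwarz_ineq2)
    then have "- \<eta> \<le> (D x - D p) \<bullet> n" using Dx nn by (simp add: abs_le_iff)
    then have "d * (- \<eta>) \<le> d * ((D x - D p) \<bullet> n)" using d by (intro mult_left_mono) auto
    moreover have "D x \<bullet> (x - c) = D p \<bullet> (x - p) + (D x - D p) \<bullet> (x - p) + d * ((D x - D p) \<bullet> n) + d * N"
      using nn by (simp add: c_def inner_diff inner_commute algebra_simps)
    ultimately have "D x \<bullet> (x - c) \<ge> d * N - 7 * \<eta> * d" using 1 2 by (simp add: algebra_simps)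
    moreover have "d * N - 7 * \<eta> * d > 0" using d N by (simp add: \<eta>_def)
    ultimately show "0 < D x \<bullet> (x - c)" by linarith
  qed
  ultimately show ?thesis using that by blast
qed

lemma outward_ball_exists:
  assumes dom: "smooth_bounded_domain \<Omega>" and p: "p \<in> closure \<Omega>"
  obtains c R where "c \<in> \<Omega>" "p \<in> ball c R" "outward_ball \<Omega> c R"
proof (cases "p \<in> \<Omega>")
  case True
  have op: "open \<Omega>" using dom by (simp add: smooth_bounded_domain_def)
  then obtain R where "R > 0" "ball p R \<subseteq> \<Omega>" using True openE by blast
  then show ?thesis using that[of p R] True outward_ball_interior[OF op] by auto
next
  case False
  have "open \<Omega>" using dom by (simp add: smooth_bounded_domain_def)
  then have "p \<in> frontier \<Omega>" using p False by (simp add: frontier_def interior_open)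
  then show ?thesis using outward_ball_at_frontier[OF dom] that by blast
qed

lemma local_minimum_second_derivative_nonneg:
  fixes \<phi> :: "real \<Rightarrow> real"
  assumes "\<delta> > 0"
    and der: "\<And>s. \<bar>s\<bar> < \<delta> \<Longrightarrow> (\<phi> has_real_derivative \<phi>' s) (at s)"
    and der2: "(\<phi>' has_real_derivative D) (at 0)"
    and min: "\<And>s. \<bar>s\<bar> < \<delta> \<Longrightarrow> \<phi> 0 \<le> \<phi> s"
  shows "0 \<le> D"
proof (rule ccontr)
  assume "\<not> 0 \<le> D"
  have "\<phi>' 0 = 0"
    by (rule DERIV_local_min[OF der \<open>\<delta> > 0\<close>]) (use \<open>\<delta> > 0\<close> min in auto)
  moreover obtain d where d: "d > 0" "\<forall>h>0. h < d \<longrightarrow> \<phi>' (0 + h) < \<phi>' 0"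
    using DERIV_neg_dec_right[OF der2] \<open>\<not> 0 \<le> D\<close> by auto
  define s where "s = min d \<delta> / 2"
  have s: "0 < s" "s < d" "s < \<delta>" using d \<open>\<delta> > 0\<close> by (auto simp: s_def)
  obtain \<xi> where "0 < \<xi>" "\<xi> < s" "\<phi> s - \<phi> 0 = (s - 0) * \<phi>' \<xi>"
    using MVT2[OF s(1), of \<phi> \<phi>'] der s by fastforce
  moreover from this have "\<phi>' \<xi> < 0" using d(2) s \<open>\<phi>' 0 = 0\<close> by auto
  ultimately have "\<phi> s < \<phi> 0" using s(1) mult_pos_neg[of s "\<phi>' \<xi>"] by simp
  then show False using min[of s] s by simp
qed

text \<open>A Gaussian, shifted to vanish on the sphere with centre \<open>c\<close> and radius \<open>R\<close>. For large \<open>\<alpha>\<close> it is a strict subsolution of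
  \<open>\<Delta>b = b\<close> away from the centre.\<close>
definition hopf_barrier :: "'a::euclidean_space \<Rightarrow> real \<Rightarrow> real \<Rightarrow> 'a \<Rightarrow> real" where
  "hopf_barrier c R \<alpha> y = exp (- \<alpha> * (norm (y - c))\<^sup>2) - exp (- \<alpha> * R\<^sup>2)"

definition hopf_barrier_laplacian :: "'a::euclidean_space \<Rightarrow> real \<Rightarrow> 'a \<Rightarrow> real" where
  "hopf_barrier_laplacian c \<alpha> y = (4 * \<alpha>\<^sup>2 * (norm (y - c))\<^sup>2 - 2 * \<alpha> * DIM('a)) * exp (- \<alpha> * (norm (y - c))\<^sup>2)"

lemma continuous_on_hopf_barrier: "continuous_on S (hopf_barrier c R \<alpha>)"
  unfolding hopf_barrier_def by (intro continuous_intros)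

lemma continuous_on_hopf_barrier_laplacian: "continuous_on S (hopf_barrier_laplacian c \<alpha>)"
  unfolding hopf_barrier_laplacian_def by (intro continuous_intros)

lemma hopf_barrier_pos_iff:
  assumes "\<alpha> > 0" "R > 0"
  shows "0 < hopf_barrier c R \<alpha> y \<longleftrightarrow> y \<in> ball c R"
proof -
  have "0 < hopf_barrier c R \<alpha> y \<longleftrightarrow> (norm (y - c))\<^sup>2 < R\<^sup>2" using assms by (simp add: hopf_barrier_def)
  also have "\<dots> \<longleftrightarrow> norm (y - c) < R" using assms
    by (metis abs_norm_cancel abs_of_pos power2_less_imp_less norm_ge_zero power_strict_mono zero_less_numeral less_imp_le)
  finally show ?thesis by (simp add: dist_norm norm_minus_commute)
qed

lemma hopf_barrier_less_1: "\<alpha> \<ge> 0 \<Longrightarrow> hopf_barrier c R \<alpha> y < 1"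
proof -
  assume "\<alpha> \<ge> 0"
  then have "exp (- \<alpha> * (norm (y - c))\<^sup>2) \<le> 1" by simp
  then show ?thesis using exp_gt_zero[of "- \<alpha> * R\<^sup>2"] unfolding hopf_barrier_def by linarith
qed

text \<open>The second derivative test along each coordinate direction, summed over the directions.\<close>
lemma minimum_of_difference_interior:
  assumes NL: "neumann_laplacian \<Omega> v w" and op: "open \<Omega>" and x: "x \<in> \<Omega>"
    and min: "\<And>z. z \<in> \<Omega> \<Longrightarrow> v x - \<epsilon> * hopf_barrier c R \<alpha> x \<le> v z - \<epsilon> * hopf_barrier c R \<alpha> z"
  shows "\<epsilon> * hopf_barrier_laplacian c \<alpha> x \<le> w x"
proof -
  have C2: "Ck_on 2 v \<Omega>" and lap: "laplacian v x = w x" using NL x by (auto simp: neumann_laplacian_def)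
  have d1: "\<And>y. y \<in> \<Omega> \<Longrightarrow> v differentiable (at y)"
    and d2: "\<And>e y. e \<in> Basis \<Longrightarrow> y \<in> \<Omega> \<Longrightarrow> partial_deriv e v differentiable (at y)"
    using C2 by (auto simp: numeral_2_eq_2)
  obtain \<delta> where \<delta>: "\<delta> > 0" "ball x \<delta> \<subseteq> \<Omega>" using op x openE by blast
  have line: "x + s *\<^sub>R e \<in> \<Omega>" if "e \<in> Basis" "\<bar>s\<bar> < \<delta>" for s e
    using \<delta>(2) that by (auto simp: subset_iff dist_norm)
  define q where "q = (norm (x - c))\<^sup>2"
  define E where "E = exp (- \<alpha> * q)"
  have key: "\<epsilon> * (E * (4 * \<alpha>\<^sup>2 * ((x - c) \<bullet> e)\<^sup>2 - 2 * \<alpha>)) \<le> partial_deriv e (partial_deriv e v) x"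
    if e: "e \<in> Basis" for e
  proof -
    define p where "p = (x - c) \<bullet> e"
    have nrm: "(norm (x + s *\<^sub>R e - c))\<^sup>2 = q + 2 * p * s + s\<^sup>2" for s
    proof -
      have eq: "x + s *\<^sub>R e - c = (x - c) + s *\<^sub>R e" by simp
      have "(norm ((x - c) + s *\<^sub>R e))\<^sup>2 = (norm (x - c))\<^sup>2 + 2 * (s * p) + s\<^sup>2"
        unfolding power2_norm_eq_inner p_def inner_add_left inner_add_right
        using e by (simp add: inner_Basis inner_commute power2_eq_square)
      then show ?thesis unfolding eq q_def by simp
    qed
    define \<phi> where "\<phi> s = v (x + s *\<^sub>R e) - \<epsilon> * (exp (- \<alpha> * (q + 2 * p * s + s\<^sup>2)) - exp (- \<alpha> * R\<^sup>2))" for s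
    define \<phi>' where "\<phi>' s = partial_deriv e v (x + s *\<^sub>R e) + \<epsilon> * (\<alpha> * (2 * p + 2 * s) * exp (- \<alpha> * (q + 2 * p * s + s\<^sup>2)))" for s
    have along: "((\<lambda>s. u (x + s *\<^sub>R e)) has_real_derivative partial_deriv e u (x + s *\<^sub>R e)) (at s)"
      if "u differentiable (at (x + s *\<^sub>R e))" for u :: "'a \<Rightarrow> real" and s
    proof -
      let ?f = "frechet_derivative u (at (x + s *\<^sub>R e))"
      have hd: "(u has_derivative ?f) (at (x + s *\<^sub>R e))" using that by (simp add: frechet_derivative_works)
      have "((\<lambda>s. x + s *\<^sub>R e) has_derivative (\<lambda>h. h *\<^sub>R e)) (at s)" by (auto intro!: derivative_eq_intros)
      from has_derivative_compose[OF this hd]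
      have "((\<lambda>s. u (x + s *\<^sub>R e)) has_derivative (\<lambda>h. ?f (h *\<^sub>R e))) (at s)" .
      then show ?thesis
        by (simp add: has_field_derivative_def partial_deriv_def linear_cmul[OF has_derivative_linear[OF hd]] mult_commute_abs)
    qed
    have "0 \<le> partial_deriv e (partial_deriv e v) x + \<epsilon> * (\<alpha> * 2 * E + \<alpha> * (2 * p) * (- \<alpha> * (2 * p) * E))"
    proof (rule local_minimum_second_derivative_nonneg[OF \<delta>(1), of \<phi> \<phi>'])
      fix s assume s: "\<bar>s\<bar> < \<delta>"
      show "(\<phi> has_real_derivative \<phi>' s) (at s)" unfolding \<phi>_def \<phi>'_def
        by (rule derivative_eq_intros along[OF d1[OF line[OF e s]]] refl)+ (simp add: algebra_simps)
      have "\<phi> s = v (x + s *\<^sub>R e) - \<epsilon> * hopf_barrier c R \<alpha> (x + s *\<^sub>R e)" for s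
        by (simp add: \<phi>_def hopf_barrier_def nrm)
      from this[of s] this[of 0] show "\<phi> 0 \<le> \<phi> s" using min[OF line[OF e s]] by simp
    next
      have "partial_deriv e v differentiable (at (x + 0 *\<^sub>R e))" using d2[OF e x] by simp
      from along[OF this]
      show "(\<phi>' has_real_derivative partial_deriv e (partial_deriv e v) x + \<epsilon> * (\<alpha> * 2 * E + \<alpha> * (2 * p) * (- \<alpha> * (2 * p) * E))) (at 0)"
        unfolding \<phi>'_def E_def
        by (auto intro!: derivative_eq_intros simp: algebra_simps)
    qed
    then show ?thesis by (simp add: p_def algebra_simps power2_eq_square)
  qed
  have "\<epsilon> * hopf_barrier_laplacian c \<alpha> x = (\<Sum>e\<in>Basis. \<epsilon> * (E * (4 * \<alpha>\<^sup>2 * ((x - c) \<bullet> e)\<^sup>2 - 2 * \<alpha>)))"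
  proof -
    have "(norm (x - c))\<^sup>2 = (\<Sum>e\<in>Basis. ((x - c) \<bullet> e)\<^sup>2)"
      unfolding power2_norm_eq_inner by (subst euclidean_inner) (simp add: power2_eq_square)
    then show ?thesis
      by (simp add: hopf_barrier_laplacian_def E_def q_def sum_subtractf flip: sum_distrib_left)
  qed
  also have "\<dots> \<le> (\<Sum>e\<in>Basis. partial_deriv e (partial_deriv e v) x)" by (intro sum_mono key)
  also have "\<dots> = w x" using lap by (simp add: laplacian_def)
  finally show ?thesis .
qed

text \<open>Along the inward ray \<open>x - s D\<close> the derivative of \<open>v\<close> tends to \<open>- (G x \<bullet> D) = 0\<close> at the boundary, by the Neumann
  condition, whereas the barrier increases at a positive rate. The difference therefore decreases at first.\<close>
lemma no_minimum_of_difference_on_frontier: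
  assumes NL: "neumann_laplacian \<Omega> v w" and op: "open \<Omega>" and x: "x \<in> frontier \<Omega>"
    and df: "defining_function \<Omega> x U \<rho>" and D: "GDERIV \<rho> x :> D" and out: "0 < D \<bullet> (x - c)"
    and pos: "\<epsilon> > 0" "\<alpha> > 0"
  shows "\<exists>z\<in>\<Omega>. v z - \<epsilon> * hopf_barrier c R \<alpha> z < v x - \<epsilon> * hopf_barrier c R \<alpha> x"
proof -
  obtain G where vc: "continuous_on (closure \<Omega>) v"
    and G: "continuous_on (closure \<Omega>) G" "\<And>y. y \<in> \<Omega> \<Longrightarrow> GDERIV v y :> G y"
    and Gn: "\<And>\<nu>. outward_normal \<Omega> x \<nu> \<Longrightarrow> G x \<bullet> \<nu> = 0"
    using NL x by (auto simp: neumann_laplacian_def)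
  have D0: "D \<noteq> 0" using out by auto
  have "outward_normal \<Omega> x (sgn D)" using df D unfolding outward_normal_def by blast
  then have "G x \<bullet> sgn D = 0" by (rule Gn)
  then have GD: "G x \<bullet> D = 0" using D0 by (simp add: sgn_div_norm)
  have xcl: "x \<in> closure \<Omega>" using x by (simp add: frontier_def)
  have xU: "x \<in> U" and U: "open U" and eq: "\<Omega> \<inter> U = {x \<in> U. \<rho> x < 0}"
    using df by (auto simp: defining_function_def)
  define \<gamma> where "\<gamma> s = x - s *\<^sub>R D" for s :: real
  have \<gamma>0: "\<gamma> 0 = x" by (simp add: \<gamma>_def)
  have \<gamma>c: "continuous_on S \<gamma>" for S unfolding \<gamma>_def by (intro continuous_intros)
  have \<gamma>d: "(\<gamma> has_derivative (\<lambda>h. - (h *\<^sub>R D))) (at s within S)" for s S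
    unfolding \<gamma>_def by (auto intro!: derivative_eq_intros)
  obtain s0 where s0: "s0 > 0" "\<And>s. 0 < s \<Longrightarrow> s < s0 \<Longrightarrow> \<gamma> s \<in> \<Omega>"
  proof -
    have "(\<rho> has_derivative (\<lambda>h. h \<bullet> D)) (at (\<gamma> 0))" using D by (simp add: gderiv_def \<gamma>0)
    from has_derivative_compose[OF \<gamma>d this, of UNIV]
    have "((\<lambda>s. \<rho> (\<gamma> s)) has_derivative (\<lambda>h. - (D \<bullet> D) * h)) (at 0)" by (simp add: mult.commute)
    then have "((\<lambda>s. \<rho> (\<gamma> s)) has_real_derivative - (D \<bullet> D)) (at 0)"
      by (simp only: has_field_derivative_def)
    moreover have "- (D \<bullet> D) < 0" using D0 by simp
    ultimately obtain d where d: "d > 0" "\<forall>h>0. h < d \<longrightarrow> \<rho> (\<gamma> (0 + h)) < \<rho> (\<gamma> 0)"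
      using DERIV_neg_dec_right by blast
    have "\<rho> x = 0" using defining_function_zero_on_frontier[OF df op xU x] .
    have "open (\<gamma> -` U)" using U \<gamma>c[of UNIV] open_vimage[of U \<gamma>] by simp
    moreover have "0 \<in> \<gamma> -` U" using xU by (simp add: \<gamma>0)
    ultimately obtain d' where d': "d' > 0" "ball 0 d' \<subseteq> \<gamma> -` U" using openE by blast
    show ?thesis
    proof (rule that[of "min d d'"])
      show "min d d' > 0" using d d' by simp
      fix s :: real assume "0 < s" "s < min d d'"
      then have "\<rho> (\<gamma> s) < 0" "\<gamma> s \<in> U" using d(2) d'(2) \<open>\<rho> x = 0\<close> \<gamma>0 by (auto simp: subset_iff dist_real_def)
      then show "\<gamma> s \<in> \<Omega>" using eq by blast
    qed
  qed
  have \<gamma>cl: "\<gamma> s \<in> closure \<Omega>" if "0 \<le> s" "s < s0" for s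
  proof (cases "s = 0")
    case False then show ?thesis using s0(2)[of s] that closure_subset by auto
  qed (simp add: \<gamma>0 xcl)
  define \<phi> where "\<phi> s = v (\<gamma> s) - \<epsilon> * hopf_barrier c R \<alpha> (\<gamma> s)" for s
  \<comment> \<open>\<open>\<psi>\<close> is the derivative of \<open>\<phi>\<close> for \<open>s > 0\<close>. At \<open>s = 0\<close> only its continuity is available, since \<open>v\<close> is
    differentiable in the open domain only.\<close>
  define \<psi> where "\<psi> s = - (D \<bullet> G (\<gamma> s)) - 2 * \<epsilon> * \<alpha> * exp (- \<alpha> * ((\<gamma> s - c) \<bullet> (\<gamma> s - c))) * (D \<bullet> (\<gamma> s - c))" for s
  define s2 where "s2 = s0 / 2"
  have s2: "0 < s2" "s2 < s0" using s0 by (auto simp: s2_def)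
  have img: "\<gamma> ` {0..s2} \<subseteq> closure \<Omega>" using \<gamma>cl s2 by auto
  have \<psi>c: "continuous_on {0..s2} \<psi>"
    unfolding \<psi>_def by (intro continuous_intros \<gamma>c continuous_on_compose2[OF G(1) \<gamma>c img])
  have \<phi>c: "continuous_on {0..s2} \<phi>"
    unfolding \<phi>_def
    by (intro continuous_intros continuous_on_compose2[OF vc \<gamma>c img] continuous_on_compose2[OF continuous_on_hopf_barrier \<gamma>c order_refl])
  have "\<psi> 0 < 0" using pos out GD by (simp add: \<psi>_def \<gamma>0 inner_commute)
  then obtain d where d: "d > 0" "\<And>s. s \<in> {0..s2} \<Longrightarrow> \<bar>s\<bar> < d \<Longrightarrow> \<bar>\<psi> s - \<psi> 0\<bar> < - \<psi> 0"
    using \<psi>c[unfolded continuous_on_iff, rule_format, of 0 "- \<psi> 0"] s2 by (auto simp: dist_real_def)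
  define s1 where "s1 = min s2 d / 2"
  have s1: "0 < s1" "s1 < s2" "s1 < d" using s2 d by (auto simp: s1_def)
  have der: "(\<phi> has_derivative (\<lambda>h. \<psi> s * h)) (at s)" if "0 < s" "s < s1" for s
  proof -
    have "\<gamma> s \<in> \<Omega>" using s0(2)[of s] that s1 s2 by simp
    then have "(v has_derivative (\<lambda>h. h \<bullet> G (\<gamma> s))) (at (\<gamma> s))" using G(2) by (simp add: gderiv_def)
    from has_derivative_compose[OF \<gamma>d this]
    have 1: "((\<lambda>s. v (\<gamma> s)) has_derivative (\<lambda>h. - (h *\<^sub>R D) \<bullet> G (\<gamma> s))) (at s)" .
    have hb: "hopf_barrier c R \<alpha> y = exp (- \<alpha> * ((y - c) \<bullet> (y - c))) - exp (- \<alpha> * R\<^sup>2)" for y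
      by (simp add: hopf_barrier_def power2_norm_eq_inner)
    show ?thesis unfolding \<phi>_def hb
      by (rule derivative_eq_intros 1 \<gamma>d refl)+ (auto simp: \<psi>_def fun_eq_iff algebra_simps inner_commute)
  qed
  obtain \<xi> where \<xi>: "0 < \<xi>" "\<xi> < s1" "\<phi> s1 - \<phi> 0 = \<psi> \<xi> * (s1 - 0)"
    using mvt[OF s1(1) continuous_on_subset[OF \<phi>c] der] s1 by auto
  have "\<psi> \<xi> < 0" using d(2)[of \<xi>] \<xi> s1 by (simp add: abs_if split: if_splits)
  then have "\<phi> s1 < \<phi> 0" using \<xi>(3) s1 mult_neg_pos[of "\<psi> \<xi>" s1] by simp
  moreover have "\<gamma> s1 \<in> \<Omega>" using s0(2) s1 s2 by simp
  ultimately show ?thesis unfolding \<phi>_def \<gamma>0 by blast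
qed

lemma minimum_of_difference:
  assumes NL: "neumann_laplacian \<Omega> v w" and op: "open \<Omega>" and ball: "outward_ball \<Omega> c R"
    and x: "x \<in> closure \<Omega>" "x \<in> ball c R" and pos: "\<epsilon> > 0" "\<alpha> > 0"
    and min: "\<And>z. z \<in> closure \<Omega> \<Longrightarrow> v x - \<epsilon> * hopf_barrier c R \<alpha> x \<le> v z - \<epsilon> * hopf_barrier c R \<alpha> z"
  shows "\<epsilon> * hopf_barrier_laplacian c \<alpha> x \<le> w x"
proof (cases "x \<in> \<Omega>")
  case True
  then show ?thesis using minimum_of_difference_interior[OF NL op True] min closure_subset by blast
next
  case False
  then have fr: "x \<in> frontier \<Omega>" using x op by (simp add: frontier_def interior_open)
  then obtain U \<rho> D where "defining_function \<Omega> x U \<rho>" "GDERIV \<rho> x :> D" "0 < D \<bullet> (x - c)"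
    using ball[unfolded outward_ball_def, rule_format, of x] x(2) by blast
  from no_minimum_of_difference_on_frontier[OF NL op fr this pos, of R] min closure_subset
  show ?thesis by (meson not_le subsetD)
qed

section \<open>The minimum principle for the closure of the Neumann Laplacian\<close>

lemma uniform_limit_along_sequence:
  fixes v :: "'a::metric_space \<Rightarrow> 'b::metric_space"
  assumes ul: "uniform_limit K un v sequentially" and v: "continuous_on K v"
    and x: "\<And>n. x n \<in> K" "x \<longlonglongrightarrow> a" "a \<in> K"
  shows "(\<lambda>n. un n (x n)) \<longlonglongrightarrow> v a"
proof (rule tendstoI)
  fix e :: real assume "e > 0"
  then have e2: "e / 2 > 0" by simp
  have "(\<lambda>n. v (x n)) \<longlonglongrightarrow> v a"
    using continuous_on_tendsto_compose[OF v x(2,3)] x(1) by simp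
  then have "eventually (\<lambda>n. dist (v (x n)) (v a) < e / 2) sequentially" using e2 by (rule tendstoD)
  moreover have "eventually (\<lambda>n. \<forall>z\<in>K. dist (un n z) (v z) < e / 2) sequentially"
    using ul e2 unfolding uniform_limit_iff by blast
  ultimately show "eventually (\<lambda>n. dist (un n (x n)) (v a) < e) sequentially"
  proof eventually_elim
    case (elim n)
    then have "dist (un n (x n)) (v (x n)) < e / 2" using x(1) by blast
    with elim(1) show ?case using dist_triangle[of "un n (x n)" "v a" "v (x n)"] by linarith
  qed
qed

text \<open>The condition on \<open>y\<close> forces the minimizers of the approximating differences into the set where the barrier is
  positive, that is, into the ball in which the boundary is under control. A limit point of these minimizers
  inherits both properties.\<close>
lemma minimum_of_difference_closure:
  fixes \<Omega> :: "'a::euclidean_space set"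
  assumes NL: "neumann_laplacian_closure \<Omega> v w" and op: "open \<Omega>" and bd: "bounded \<Omega>"
    and ball: "outward_ball \<Omega> c R" and pos: "R > 0" "\<epsilon> > 0" "\<alpha> > 0"
    and m: "\<And>z. z \<in> closure \<Omega> \<Longrightarrow> m \<le> v z"
    and y: "y \<in> closure \<Omega>" "v y - \<epsilon> * hopf_barrier c R \<alpha> y < m"
  obtains x where "x \<in> closure \<Omega>"
    "\<And>z. z \<in> closure \<Omega> \<Longrightarrow> v x - \<epsilon> * hopf_barrier c R \<alpha> x \<le> v z - \<epsilon> * hopf_barrier c R \<alpha> z"
    "\<epsilon> * hopf_barrier_laplacian c \<alpha> x \<le> w x"
proof -
  define K where "K = closure \<Omega>"
  have K: "compact K" using bd by (simp add: K_def)
  let ?b = "hopf_barrier c R \<alpha>"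
  obtain un wn where uw: "\<And>n. neumann_laplacian \<Omega> (un n) (wn n)"
    and ul: "uniform_limit K un v sequentially" "uniform_limit K wn w sequentially"
    using NL unfolding neumann_laplacian_closure_def K_def by blast
  have unc: "continuous_on K (un n)" and wnc: "continuous_on K (wn n)" for n
    using uw[of n] by (auto simp: neumann_laplacian_def K_def)
  have vc: "continuous_on K v" by (rule uniform_limit_theorem[OF _ ul(1)]) (simp_all add: unc)
  have wc: "continuous_on K w" by (rule uniform_limit_theorem[OF _ ul(2)]) (simp_all add: wnc)
  have yK: "y \<in> K" using y by (simp add: K_def)
  have bc: "continuous_on K (\<lambda>z. \<epsilon> * ?b z)" by (intro continuous_intros continuous_on_hopf_barrier)
  have "\<exists>x\<in>K. \<forall>z\<in>K. un n x - \<epsilon> * ?b x \<le> un n z - \<epsilon> * ?b z" for n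
    using continuous_attains_inf[OF K _ continuous_on_diff[OF unc[of n] bc]] yK by blast
  then obtain X where X: "\<And>n. X n \<in> K"
    "\<And>n z. z \<in> K \<Longrightarrow> un n (X n) - \<epsilon> * ?b (X n) \<le> un n z - \<epsilon> * ?b z" by metis
  define \<delta> where "\<delta> = (m - (v y - \<epsilon> * ?b y)) / 3"
  have \<delta>: "\<delta> > 0" using y by (simp add: \<delta>_def)
  have "eventually (\<lambda>n. \<forall>z\<in>K. dist (un n z) (v z) < \<delta>) sequentially"
    using ul(1) \<delta> by (simp add: uniform_limit_iff)
  then have low: "eventually (\<lambda>n. \<epsilon> * hopf_barrier_laplacian c \<alpha> (X n) \<le> wn n (X n)) sequentially"
  proof eventually_elim
    case (elim n)
    have "\<bar>un n y - v y\<bar> < \<delta>" "\<bar>un n (X n) - v (X n)\<bar> < \<delta>"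
      using elim yK X(1) by (auto simp: dist_real_def)
    moreover have "m \<le> v (X n)" using m X(1)[of n] by (simp add: K_def)
    moreover have "3 * \<delta> = m - (v y - \<epsilon> * ?b y)" by (simp add: \<delta>_def)
    ultimately have "\<epsilon> * ?b (X n) > 0" using X(2)[OF yK, of n] \<delta> by linarith
    then have "X n \<in> ball c R" using pos(2) hopf_barrier_pos_iff[OF pos(3,1), of c "X n"]
      by (simp add: zero_less_mult_iff)
    then show ?case
      using X by (intro minimum_of_difference[OF uw op ball _ _ pos(2,3)]) (auto simp: K_def)
  qed
  obtain x r where x: "x \<in> K" and r: "strict_mono r" "(X \<circ> r) \<longlonglongrightarrow> x"
    using K[unfolded compact_def, rule_format, of X] X(1) by blast
  have Xr: "(\<lambda>n. X (r n)) \<longlonglongrightarrow> x" using r(2) by (simp add: o_def)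
  have sub: "filterlim r sequentially sequentially" using filterlim_subseq[OF r(1)] .
  have lu: "(\<lambda>n. un (r n) (X (r n))) \<longlonglongrightarrow> v x"
    by (rule uniform_limit_along_sequence[OF filterlim_compose[OF ul(1) sub] vc X(1) Xr x])
  have lw: "(\<lambda>n. wn (r n) (X (r n))) \<longlonglongrightarrow> w x"
    by (rule uniform_limit_along_sequence[OF filterlim_compose[OF ul(2) sub] wc X(1) Xr x])
  have lb: "(\<lambda>n. \<epsilon> * ?b (X (r n))) \<longlonglongrightarrow> \<epsilon> * ?b x"
    by (rule continuous_on_tendsto_compose[OF bc Xr x]) (simp add: X)
  have ll: "(\<lambda>n. \<epsilon> * hopf_barrier_laplacian c \<alpha> (X (r n))) \<longlonglongrightarrow> \<epsilon> * hopf_barrier_laplacian c \<alpha> x"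
    by (intro tendsto_mult_left continuous_on_tendsto_compose[OF continuous_on_hopf_barrier_laplacian[of UNIV] Xr]) auto
  show ?thesis
  proof (rule that[of x])
    show "x \<in> closure \<Omega>" using x by (simp add: K_def)
    fix z assume "z \<in> closure \<Omega>"
    then have z: "z \<in> K" by (simp add: K_def)
    have "(\<lambda>n. un (r n) z) \<longlonglongrightarrow> v z"
      using tendsto_uniform_limitI[OF filterlim_compose[OF ul(1) sub] z] .
    then have "(\<lambda>n. un (r n) z - \<epsilon> * ?b z) \<longlonglongrightarrow> v z - \<epsilon> * ?b z" by (intro tendsto_diff tendsto_const)
    then show "v x - \<epsilon> * ?b x \<le> v z - \<epsilon> * ?b z"
      by (rule LIMSEQ_le[OF tendsto_diff[OF lu lb]]) (use X(2)[OF z] in blast)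
  next
    have "eventually (\<lambda>n. \<epsilon> * hopf_barrier_laplacian c \<alpha> (X (r n)) \<le> wn (r n) (X (r n))) sequentially"
      using sub low by (rule eventually_compose_filterlim[rotated])
    then show "\<epsilon> * hopf_barrier_laplacian c \<alpha> x \<le> w x"
      by (rule tendsto_le[OF sequentially_bot lw ll])
  qed
qed

text \<open>A minimizer \<open>p\<close> may lie on the boundary. Subtracting from \<open>v\<close> the multiple \<open>1 / Suc n\<close> of a barrier that is positive at
  \<open>p\<close> yields points where \<open>v\<close> is almost minimal and \<open>w\<close> is almost nonnegative; a limit point is a minimizer of
  \<open>v\<close> with \<open>w \<ge> 0\<close>, not necessarily \<open>p\<close> itself.\<close>
lemma neumann_laplacian_closure_minimum:
  fixes \<Omega> :: "'a::euclidean_space set"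
  assumes dom: "smooth_bounded_domain \<Omega>" and NL: "neumann_laplacian_closure \<Omega> v w"
    and vw: "continuous_on (closure \<Omega>) v" "continuous_on (closure \<Omega>) w"
  shows "\<exists>p\<in>closure \<Omega>. (\<forall>x\<in>closure \<Omega>. v p \<le> v x) \<and> 0 \<le> w p"
proof -
  define K where "K = closure \<Omega>"
  have op: "open \<Omega>" and bd: "bounded \<Omega>" and ne: "\<Omega> \<noteq> {}" using dom by (auto simp: smooth_bounded_domain_def)
  have K: "compact K" "K \<noteq> {}" using bd ne by (auto simp: K_def)
  obtain p where p: "p \<in> K" "\<And>x. x \<in> K \<Longrightarrow> v p \<le> v x"
    using continuous_attains_inf[OF K, of v] vw(1) unfolding K_def by metis
  obtain c R where cR: "p \<in> ball c R" "outward_ball \<Omega> c R"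
    using outward_ball_exists[OF dom] p(1) unfolding K_def by metis
  have R: "R > 0" using cR(1) le_less_trans[OF zero_le_dist] by auto
  let ?b = "hopf_barrier c R 1"
  define \<epsilon> where "\<epsilon> n = 1 / real (Suc n)" for n
  have \<epsilon>: "\<epsilon> n > 0" for n by (simp add: \<epsilon>_def)
  have \<epsilon>0: "\<epsilon> \<longlonglongrightarrow> 0" unfolding \<epsilon>_def using LIMSEQ_Suc[OF lim_inverse_n'] .
  have bp: "?b p > 0" using cR R by (simp add: hopf_barrier_pos_iff)
  have "\<exists>x\<in>K. v x \<le> v p + \<epsilon> n \<and> - (2 * real DIM('a)) * \<epsilon> n \<le> w x" for n
  proof -
    have "v p - \<epsilon> n * ?b p < v p" using bp \<epsilon> by simp
    then obtain x where x: "x \<in> K" "v x - \<epsilon> n * ?b x \<le> v p - \<epsilon> n * ?b p"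
      "\<epsilon> n * hopf_barrier_laplacian c 1 x \<le> w x"
      using minimum_of_difference_closure[OF NL op bd cR(2) R \<epsilon>[of n] zero_less_one, of "v p" p] p
      unfolding K_def by metis
    have "\<epsilon> n * ?b x \<le> \<epsilon> n * 1" using hopf_barrier_less_1[of 1 c R x] \<epsilon>[of n] by (intro mult_left_mono) auto
    then have 1: "v x \<le> v p + \<epsilon> n" using x(2) bp mult_pos_pos[OF \<epsilon>[of n] bp] by linarith
    have "- (2 * real DIM('a)) \<le> hopf_barrier_laplacian c 1 x"
    proof -
      let ?E = "exp (- ((norm (x - c))\<^sup>2))"
      have "2 * real DIM('a) * ?E \<le> 2 * real DIM('a) * 1" by (intro mult_left_mono) auto
      moreover have "0 \<le> 4 * (norm (x - c))\<^sup>2 * ?E" by simp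
      ultimately have "- (2 * real DIM('a)) \<le> 4 * (norm (x - c))\<^sup>2 * ?E - 2 * real DIM('a) * ?E" by linarith
      then show ?thesis by (simp add: hopf_barrier_laplacian_def left_diff_distrib)
    qed
    then have "\<epsilon> n * - (2 * real DIM('a)) \<le> \<epsilon> n * hopf_barrier_laplacian c 1 x"
      using \<epsilon>[of n] by (intro mult_left_mono) auto
    then have "- (2 * real DIM('a)) * \<epsilon> n \<le> w x" using x(3) by (simp add: mult.commute)
    with x(1) 1 show ?thesis by blast
  qed
  then obtain X where X: "\<And>n. X n \<in> K" "\<And>n. v (X n) \<le> v p + \<epsilon> n" "\<And>n. - (2 * real DIM('a)) * \<epsilon> n \<le> w (X n)" by metis
  obtain x r where x: "x \<in> K" and r: "strict_mono r" "(X \<circ> r) \<longlonglongrightarrow> x"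
    using K(1)[unfolded compact_def, rule_format, of X] X(1) by blast
  have Xr: "(\<lambda>n. X (r n)) \<longlonglongrightarrow> x" using r(2) by (simp add: o_def)
  have \<epsilon>r: "(\<lambda>n. \<epsilon> (r n)) \<longlonglongrightarrow> 0" using LIMSEQ_subseq_LIMSEQ[OF \<epsilon>0 r(1)] by (simp add: o_def)
  have lv: "(\<lambda>n. v (X (r n))) \<longlonglongrightarrow> v x"
    using continuous_on_tendsto_compose[OF vw(1) Xr] x X(1) by (simp add: K_def)
  have lw: "(\<lambda>n. w (X (r n))) \<longlonglongrightarrow> w x"
    using continuous_on_tendsto_compose[OF vw(2) Xr] x X(1) by (simp add: K_def)
  have "v x \<le> v p + 0"
    by (rule LIMSEQ_le[OF lv tendsto_add[OF tendsto_const \<epsilon>r]]) (use X(2) in blast)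
  moreover have "- (2 * real DIM('a)) * 0 \<le> w x"
    by (rule LIMSEQ_le[OF tendsto_mult[OF tendsto_const \<epsilon>r] lw]) (use X(3) in blast)
  ultimately show ?thesis using x p(2) unfolding K_def by (intro bexI[of _ x]) force+
qed

lemma integral_continuous_pos:
  fixes f :: "real \<Rightarrow> real"
  assumes "continuous_on {a..b} f" "a < b" "\<And>s. s \<in> {a..b} \<Longrightarrow> 0 \<le> f s" "t \<in> {a..b}" "0 < f t"
  shows "0 < integral {a..b} f"
proof -
  have int: "f integrable_on {a..b}" by (rule integrable_continuous_interval[OF assms(1)])
  have "0 \<le> integral {a..b} f" using integral_nonneg[OF int] assms(3) by simp
  moreover have "integral {a..b} f \<noteq> 0"
  proof
    assume "integral {a..b} f = 0"
    then have "(f has_integral 0) (cbox a b)" using integrable_integral[OF int] by simp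
    then have "f t = 0" using assms by (intro has_integral_0_cbox_imp_0[of a b f]) auto
    then show False using assms by simp
  qed
  ultimately show ?thesis by simp
qed

section \<open>Strict positivity of the Neumann semigroup\<close>

locale neumann_domain =
  fixes \<Omega> :: "'a::euclidean_space set" and T :: "real \<Rightarrow> ('a \<Rightarrow> real) \<Rightarrow> 'a \<Rightarrow> real"
  assumes domain: "smooth_bounded_domain \<Omega>" and semigroup: "neumann_semigroup \<Omega> T"

sublocale neumann_domain \<subseteq> semigroup_with_minimum_principle \<Omega> T
proof unfold_locales
  show "\<Omega> \<noteq> {}" "bounded \<Omega>" using domain by (auto simp: smooth_bounded_domain_def)
  show "C0_semigroup \<Omega> T" using semigroup by (simp add: neumann_semigroup_def)
  fix v w assume gen: "generator \<Omega> T v w"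
  then have "neumann_laplacian_closure \<Omega> v w" using semigroup by (simp add: neumann_semigroup_def)
  then show "\<exists>p\<in>closure \<Omega>. (\<forall>x\<in>closure \<Omega>. v p \<le> v x) \<and> 0 \<le> w p"
    using gen by (intro neumann_laplacian_closure_minimum[OF domain]) (auto simp: generator_def)
qed

context neumann_domain
begin

lemma open_domain: "open \<Omega>" using domain by (simp add: smooth_bounded_domain_def)

text \<open>Suppose that the orbit vanishes at \<open>z\<close> for all times. The truncated resolvent \<open>W S\<close> of \<open>u0\<close> then vanishes at
  \<open>z\<close>, while it is at least \<open>\<epsilon>\<close> on a small ball around the centre. Subtract \<open>\<epsilon>\<close> times a barrier: some minimizer of
  the difference lies outside the small ball and inside the large one, and there the generator of \<open>W S\<close> is at
  least \<open>\<epsilon>\<close> times the Laplacian of the barrier. On the other hand it is at most \<open>W S\<close>, hence at most \<open>\<epsilon>\<close> times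
  the barrier, up to an error of order \<open>exp (- S)\<close>. For large \<open>\<alpha>\<close> and \<open>S\<close> this is impossible.\<close>
lemma positivity_spreads_in_ball:
  assumes u0: "continuous_on K u0" "\<And>x. x \<in> K \<Longrightarrow> 0 \<le> u0 x"
    and ball: "outward_ball \<Omega> c R" and c: "c \<in> \<Omega>" "0 \<le> t1" "0 < T t1 u0 c"
    and z: "z \<in> K" "z \<in> ball c R"
  shows "\<exists>t\<ge>0. 0 < T t u0 z"
proof (rule ccontr)
  assume "\<not> ?thesis"
  then have Tz: "T t u0 z = 0" if "0 \<le> t" for t
    using T_nonneg[OF u0(1) that u0(2) z(1)] that by force
  have R: "R > 0" using z(2) le_less_trans[OF zero_le_dist] by auto
  define W where "W S x = integral {0..S} (\<lambda>s. exp (- 1 * s) * T s u0 x)" for S x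
  have slice: "continuous_on {0..S} (\<lambda>s. exp (- 1 * s) * T s u0 x)" if "x \<in> K" for x S
    by (intro continuous_intros continuous_slices(2)[OF orbit_jointly_continuous[OF u0(1)] that])
  have nn: "0 \<le> exp (- 1 * s) * T s u0 x" if "x \<in> K" "0 \<le> s" for x s
    using T_nonneg[OF u0(1) that(2) u0(2) that(1)] by simp
  have W0: "0 \<le> W S x" if "x \<in> K" for S x
    unfolding W_def by (intro integral_nonneg integrable_continuous_interval slice that nn) auto
  have Wmono: "W S x \<le> W S' x" if "x \<in> K" "S \<le> S'" for S S' x
    unfolding W_def using that nn
    by (intro integral_subset_le integrable_continuous_interval slice) auto
  have gen: "generator \<Omega> T (W S) (\<lambda>x. 1 * W S x + exp (- 1 * S) * T S u0 x - u0 x)" if "0 \<le> S" for S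
    using generator_discounted_integral[OF u0(1) that, of 1] by (simp only: W_def[abs_def])
  have "continuous_on \<Omega> (T t1 u0)" using T_cont[OF c(2) u0(1)] closure_subset continuous_on_subset by blast
  then obtain r1 where r1: "r1 > 0" "\<And>x. x \<in> \<Omega> \<Longrightarrow> dist x c < r1 \<Longrightarrow> dist (T t1 u0 x) (T t1 u0 c) < T t1 u0 c"
    unfolding continuous_on_iff using c(1,3) by metis
  obtain r2 where r2: "r2 > 0" "ball c r2 \<subseteq> \<Omega>" using open_domain c(1) openE by blast
  define r0 where "r0 = min r1 r2 / 2"
  have r0: "r0 > 0" "r0 < r1" "r0 < r2" using r1 r2 by (auto simp: r0_def)
  have cb\<Omega>: "cball c r0 \<subseteq> \<Omega>" using r0 r2(2) by (auto simp: subset_iff)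
  then have cbK: "cball c r0 \<subseteq> K" using closure_subset by blast
  have pos: "0 < T t1 u0 x" if "x \<in> cball c r0" for x
    using r1(2)[of x] that cb\<Omega> r0 by (auto simp: dist_commute dist_real_def)
  define S0 where "S0 = t1 + 1"
  have WS0: "0 < W S0 x" if "x \<in> cball c r0" for x
    unfolding W_def
    by (rule integral_continuous_pos[where t = t1]) (use that cbK slice nn pos c(2) in \<open>auto simp: S0_def\<close>)
  have "0 \<le> S0" using c(2) by (simp add: S0_def)
  then have "continuous_on (cball c r0) (W S0)"
    using continuous_on_subset[OF generator_continuous(1)[OF gen] cbK] by simp
  then obtain x0 where x0: "x0 \<in> cball c r0" "\<forall>x\<in>cball c r0. W S0 x0 \<le> W S0 x"
    using continuous_attains_inf[of "cball c r0" "W S0"] r0(1) by fastforce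
  define \<epsilon> where "\<epsilon> = W S0 x0"
  have \<epsilon>: "\<epsilon> > 0" using WS0[OF x0(1)] by (simp add: \<epsilon>_def)
  define N where "N = real DIM('a)"
  \<comment> \<open>Makes the factor \<open>4 \<alpha>\<^sup>2 r\<^sup>2 - 2 \<alpha> N\<close> in the Laplacian of the barrier at least \<open>2\<close> for \<open>r \<ge> r0\<close>, so that the
    Laplacian exceeds the barrier by at least \<open>exp (- \<alpha> R\<^sup>2)\<close>.\<close>
  define \<alpha> where "\<alpha> = max 1 ((N + 1) / (2 * r0\<^sup>2))"
  have \<alpha>: "\<alpha> \<ge> 1" "\<alpha> > 0" by (auto simp: \<alpha>_def)
  have \<alpha>r: "N + 1 \<le> 2 * \<alpha> * r0\<^sup>2"
  proof -
    have "(N + 1) / (2 * r0\<^sup>2) \<le> \<alpha>" by (simp add: \<alpha>_def)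
    then show ?thesis using r0(1) by (simp add: pos_divide_le_eq mult_ac)
  qed
  obtain k where k: "k \<ge> 0" "\<And>x. x \<in> K \<Longrightarrow> \<bar>u0 x\<bar> \<le> k" using bounded_on_K[OF u0(1)] by blast
  \<comment> \<open>\<open>S\<close> is so large that the truncation error is smaller than this excess.\<close>
  define e' where "e' = \<epsilon> * exp (- \<alpha> * R\<^sup>2) / (k + 1)"
  have e': "e' > 0" using \<epsilon> k by (simp add: e'_def)
  define S where "S = max S0 (- ln e')"
  have S: "S0 \<le> S" "0 \<le> S" using c(2) by (auto simp: S_def S0_def)
  have "exp (- S) \<le> e'"
  proof -
    have "- S \<le> ln e'" by (simp add: S_def)
    then have "exp (- S) \<le> exp (ln e')" by simp
    then show ?thesis using e' by simp
  qed
  then have "exp (- S) * (k + 1) \<le> \<epsilon> * exp (- \<alpha> * R\<^sup>2)" using k by (simp add: e'_def pos_le_divide_eq)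
  moreover have "exp (- S) * k < exp (- S) * (k + 1)" by simp
  ultimately have small: "exp (- S) * k < \<epsilon> * exp (- \<alpha> * R\<^sup>2)" by linarith
  have NLc: "neumann_laplacian_closure \<Omega> (W S) (\<lambda>x. 1 * W S x + exp (- 1 * S) * T S u0 x - u0 x)"
    using gen[OF S(2)] semigroup by (simp add: neumann_semigroup_def)
  have Wz: "W S z = 0" unfolding W_def using Tz
    by (intro integral_unique has_integral_is_0) auto
  let ?b = "hopf_barrier c R \<alpha>"
  have bz: "?b z > 0" using z(2) hopf_barrier_pos_iff[OF \<alpha>(2) R] by blast
  have neg: "W S z - \<epsilon> * ?b z < 0" using Wz \<epsilon> bz by simp
  obtain x where x: "x \<in> K" "W S x - \<epsilon> * ?b x \<le> W S z - \<epsilon> * ?b z"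
    "\<epsilon> * hopf_barrier_laplacian c \<alpha> x \<le> 1 * W S x + exp (- 1 * S) * T S u0 x - u0 x"
    using minimum_of_difference_closure[OF NLc open_domain bounded ball R \<epsilon> \<alpha>(2) W0 z(1) neg] z(1) by metis
  have Wx: "W S x < \<epsilon> * ?b x" using x(2) neg by simp
  have "x \<notin> cball c r0"
  proof
    assume "x \<in> cball c r0"
    then have "\<epsilon> \<le> W S x" using x0(2) Wmono[OF x(1) S(1)] by (force simp: \<epsilon>_def)
    moreover have "\<epsilon> * ?b x < \<epsilon> * 1" using hopf_barrier_less_1[of \<alpha> c R x] \<alpha> \<epsilon> by (intro mult_strict_left_mono) auto
    ultimately show False using Wx by simp
  qed
  then have "r0 < norm (x - c)" by (simp add: dist_norm norm_minus_commute)
  then have r0x: "r0\<^sup>2 \<le> (norm (x - c))\<^sup>2" using r0(1) by (intro power_mono) auto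
  let ?E = "exp (- \<alpha> * (norm (x - c))\<^sup>2)"
  have "2 \<le> 4 * \<alpha>\<^sup>2 * (norm (x - c))\<^sup>2 - 2 * \<alpha> * DIM('a)"
  proof -
    have "2 * \<alpha> * (2 * \<alpha> * r0\<^sup>2) \<le> 2 * \<alpha> * (2 * \<alpha> * (norm (x - c))\<^sup>2)"
      using r0x \<alpha> by (intro mult_left_mono) auto
    moreover have "2 * \<alpha> * (N + 1) \<le> 2 * \<alpha> * (2 * \<alpha> * r0\<^sup>2)" using \<alpha>r \<alpha> by (intro mult_left_mono) auto
    moreover have "4 * \<alpha>\<^sup>2 * (norm (x - c))\<^sup>2 - 2 * \<alpha> * DIM('a) = 2 * \<alpha> * (2 * \<alpha> * (norm (x - c))\<^sup>2) - 2 * \<alpha> * N"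
      by (simp add: N_def power2_eq_square)
    moreover have "2 * \<alpha> * (N + 1) = 2 * \<alpha> * N + 2 * \<alpha>" by (simp add: distrib_left)
    ultimately show ?thesis using \<alpha>(1) by linarith
  qed
  then have "2 * ?E \<le> hopf_barrier_laplacian c \<alpha> x"
    unfolding hopf_barrier_laplacian_def by (intro mult_right_mono) auto
  then have "\<epsilon> * (2 * ?E) \<le> \<epsilon> * hopf_barrier_laplacian c \<alpha> x" using \<epsilon> by simp
  moreover have "W S x < \<epsilon> * ?E - \<epsilon> * exp (- \<alpha> * R\<^sup>2)" using Wx by (simp add: hopf_barrier_def algebra_simps)
  moreover have "exp (- 1 * S) * T S u0 x \<le> exp (- S) * k"
    using T_upper[OF u0(1) S(2), of k x] k x(1) by (auto simp: abs_le_iff)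
  moreover have "0 \<le> u0 x" using u0(2) x(1) .
  moreover have "0 \<le> \<epsilon> * ?E" using \<epsilon> by simp
  ultimately show False using x(3) small by linarith
qed

text \<open>The set of interior points reached by positivity is open, and spreading in interior balls shows that its
  complement in \<open>\<Omega>\<close> is open too; connectedness makes it all of \<open>\<Omega>\<close>. A boundary point lies in an outward ball with
  centre in \<open>\<Omega>\<close>.\<close>
theorem semigroup_strictly_positive:
  assumes u0: "continuous_on K u0" "\<And>x. x \<in> K \<Longrightarrow> 0 \<le> u0 x" and x0: "x0 \<in> K" "0 < u0 x0" and z: "z \<in> K"
  shows "\<exists>t\<ge>0. 0 < T t u0 z"
proof -
  define P where "P = {x \<in> \<Omega>. \<exists>t\<ge>0. 0 < T t u0 x}"
  define Q where "Q = \<Omega> - P"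
  have "open P"
    unfolding open_contains_ball
  proof
    fix x assume "x \<in> P"
    then obtain t where t: "x \<in> \<Omega>" "0 \<le> t" "0 < T t u0 x" by (auto simp: P_def)
    have "continuous_on \<Omega> (T t u0)" using T_cont[OF t(2) u0(1)] closure_subset continuous_on_subset by blast
    then obtain d where d: "d > 0" "\<And>y. y \<in> \<Omega> \<Longrightarrow> dist y x < d \<Longrightarrow> dist (T t u0 y) (T t u0 x) < T t u0 x"
      unfolding continuous_on_iff using t(1,3) by metis
    obtain r where r: "r > 0" "ball x r \<subseteq> \<Omega>" using open_domain t(1) openE by blast
    have "y \<in> P" if "y \<in> ball x (min d r)" for y
    proof -
      have "y \<in> \<Omega>" "dist y x < d" using that r by (auto simp: dist_commute)
      then have "0 < T t u0 y" using d(2)[of y] by (auto simp: dist_real_def)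
      then show ?thesis using \<open>y \<in> \<Omega>\<close> t(2) by (auto simp: P_def)
    qed
    then show "\<exists>e>0. ball x e \<subseteq> P" using d(1) r(1) by (intro exI[of _ "min d r"]) auto
  qed
  have "open Q"
    unfolding open_contains_ball
  proof
    fix x assume x: "x \<in> Q"
    then obtain r where r: "r > 0" "ball x r \<subseteq> \<Omega>" using open_domain openE by (auto simp: Q_def)
    have "c \<in> Q" if c: "c \<in> ball x (r / 2)" for c
    proof (rule ccontr)
      assume "c \<notin> Q"
      moreover have "c \<in> \<Omega>" using c r by (auto simp: subset_iff)
      ultimately obtain t where t: "0 \<le> t" "0 < T t u0 c" by (auto simp: P_def Q_def)
      have "ball c (r / 2) \<subseteq> ball x r"
      proof
        fix y assume "y \<in> ball c (r / 2)"
        then show "y \<in> ball x r" using c dist_triangle[of x y c] by simp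
      qed
      then have "outward_ball \<Omega> c (r / 2)" using r(2) by (intro outward_ball_interior open_domain) auto
      moreover have "x \<in> ball c (r / 2)" using c by (simp add: dist_commute)
      moreover have "x \<in> K" using x closure_subset by (auto simp: Q_def)
      ultimately have "\<exists>t\<ge>0. 0 < T t u0 x" using positivity_spreads_in_ball[OF u0 _ \<open>c \<in> \<Omega>\<close> t] by blast
      then show False using x by (auto simp: Q_def P_def)
    qed
    then show "\<exists>e>0. ball x e \<subseteq> Q" using r(1) by (intro exI[of _ "r / 2"]) auto
  qed
  have "P \<noteq> {}"
  proof -
    obtain d where d: "d > 0" "\<And>y. y \<in> K \<Longrightarrow> dist y x0 < d \<Longrightarrow> dist (u0 y) (u0 x0) < u0 x0"
      using u0(1)[unfolded continuous_on_iff, rule_format, OF x0] by blast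
    obtain y where y: "y \<in> \<Omega>" "dist y x0 < d" using x0(1) d(1) closure_approachable by blast
    then have yK: "y \<in> K" using closure_subset by blast
    then have "0 < u0 y" using d(2)[OF yK y(2)] by (auto simp: dist_real_def)
    then have "0 < T 0 u0 y" using T_0[OF u0(1) yK] by simp
    then show ?thesis using y(1) by (auto simp: P_def)
  qed
  moreover have "connected \<Omega>" using domain by (simp add: smooth_bounded_domain_def)
  moreover have "P \<inter> Q \<inter> \<Omega> = {}" "\<Omega> \<subseteq> P \<union> Q" by (auto simp: Q_def)
  moreover have "P \<inter> \<Omega> = P" "Q \<inter> \<Omega> = Q" by (auto simp: P_def Q_def)
  ultimately have "Q = {}" using connectedD[of \<Omega> P Q] \<open>open P\<close> \<open>open Q\<close> by auto
  then have all: "\<Omega> \<subseteq> P" by (auto simp: Q_def)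
  obtain c R where cR: "c \<in> \<Omega>" "z \<in> ball c R" "outward_ball \<Omega> c R"
    using outward_ball_exists[OF domain z] by metis
  then obtain t where "0 \<le> t" "0 < T t u0 c" using all by (auto simp: P_def)
  then show ?thesis using positivity_spreads_in_ball[OF u0 cR(3,1) _ _ z cR(2)] by blast
qed

end

section \<open>Averages against the delay kernel\<close>

lemma integral_pos_of_positive:
  fixes h :: "real \<Rightarrow> real"
  assumes h: "h absolutely_integrable_on {a..b}" and "a < b" and pos: "\<And>x. x \<in> {a..b} \<Longrightarrow> 0 < h x"
  shows "0 < integral {a..b} h"
proof -
  have "h integrable_on {a..b}" using h by (rule set_lebesgue_integral_eq_integral(1))
  then have "0 \<le> integral {a..b} h" using pos by (intro integral_nonneg) (auto simp: less_imp_le)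
  moreover have "integral {a..b} h \<noteq> 0"
  proof
    assume 0: "integral {a..b} h = 0"
    have int: "integrable lebesgue (\<lambda>x. indicat_real {a..b} x *\<^sub>R h x)" using h by (simp add: set_integrable_def)
    have "integral\<^sup>L lebesgue (\<lambda>x. indicat_real {a..b} x *\<^sub>R h x) = 0"
      using set_lebesgue_integral_eq_integral(2)[OF h] 0 by (simp add: set_lebesgue_integral_def)
    then have "AE x in lebesgue. indicat_real {a..b} x *\<^sub>R h x = 0"
      by (subst (asm) integral_nonneg_eq_0_iff_AE[OF int]) (auto simp: indicator_def less_imp_le pos)
    then have "AE x in lebesgue. x \<notin> {a..b}"
      by (rule AE_mp) (rule AE_I2, use pos in \<open>force simp: indicator_def\<close>)
    then have "emeasure lebesgue {a..b} = 0"
      by (subst (asm) AE_iff_measurable[of "{a..b}"]) auto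
    then show False using \<open>a < b\<close> by simp
  qed
  ultimately show ?thesis by simp
qed

locale delay_kernel =
  fixes \<tau> :: real and h :: "real \<Rightarrow> real"
  assumes tau: "\<tau> > 0" and h_pos: "\<And>a. a \<in> {0..\<tau>} \<Longrightarrow> 0 < h a"
    and h_int: "h absolutely_integrable_on {0..\<tau>}" and h_total: "integral {0..\<tau>} h = 1"
begin

lemma weighted_integrable:
  assumes c: "continuous_on {0..\<tau>} c"
  shows "(\<lambda>a. h a * c a) absolutely_integrable_on {0..\<tau>}"
proof -
  have "(\<lambda>a. c a * h a) absolutely_integrable_on {0..\<tau>}"
    using c by (intro absolutely_integrable_bounded_measurable_product_real h_int
        continuous_imp_measurable_on_sets_lebesgue compact_imp_bounded compact_continuous_image) auto
  then show ?thesis by (simp add: mult.commute)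
qed

lemma weighted_integrable_on:
  "continuous_on {0..\<tau>} c \<Longrightarrow> (\<lambda>a. h a * c a) integrable_on {0..\<tau>}"
  using weighted_integrable by (rule set_lebesgue_integral_eq_integral(1))

lemma average_mono:
  assumes "continuous_on {0..\<tau>} c" "continuous_on {0..\<tau>} d" "\<And>a. a \<in> {0..\<tau>} \<Longrightarrow> c a \<le> d a"
  shows "integral {0..\<tau>} (\<lambda>a. h a * c a) \<le> integral {0..\<tau>} (\<lambda>a. h a * d a)"
  using assms h_pos by (intro integral_le weighted_integrable_on mult_left_mono) (auto simp: less_imp_le)

lemma average_const: "integral {0..\<tau>} (\<lambda>a. h a * m) = m"
  using h_total by simp

lemma average_upper:
  assumes "continuous_on {0..\<tau>} c" "\<And>a. a \<in> {0..\<tau>} \<Longrightarrow> c a \<le> m"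
  shows "integral {0..\<tau>} (\<lambda>a. h a * c a) \<le> m"
  using average_mono[OF assms(1) continuous_on_const assms(2)] by (simp only: average_const)

lemma average_lower:
  assumes "continuous_on {0..\<tau>} c" "\<And>a. a \<in> {0..\<tau>} \<Longrightarrow> m \<le> c a"
  shows "m \<le> integral {0..\<tau>} (\<lambda>a. h a * c a)"
  using average_mono[OF continuous_on_const assms(1) assms(2)] by (simp only: average_const)

lemma average_greater:
  assumes c: "continuous_on {0..\<tau>} c" and m: "\<And>a. a \<in> {0..\<tau>} \<Longrightarrow> m \<le> c a"
    and a0: "a0 \<in> {0..\<tau>}" "m < c a0"
  shows "m < integral {0..\<tau>} (\<lambda>a. h a * c a)"
proof -
  define e where "e = (c a0 - m) / 2"
  have e: "e > 0" using a0 by (simp add: e_def)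
  obtain d where d: "d > 0" "\<And>a. a \<in> {0..\<tau>} \<Longrightarrow> dist a a0 < d \<Longrightarrow> dist (c a) (c a0) < e"
    using c[unfolded continuous_on_iff, rule_format, OF a0(1) e] by blast
  \<comment> \<open>A nondegenerate interval around \<open>a0\<close>, also when \<open>a0\<close> is an end point.\<close>
  define p q where "p = max 0 (a0 - d / 2)" and "q = min \<tau> (a0 + d / 2)"
  have pq: "p < q" "{p..q} \<subseteq> {0..\<tau>}" using d(1) a0(1) tau by (auto simp: p_def q_def)
  have big: "m + e \<le> c a" if "a \<in> {p..q}" for a
  proof -
    have "dist (c a) (c a0) < e" using that pq(2) d by (intro d(2)) (auto simp: p_def q_def dist_real_def abs_if)
    moreover have "c a0 = m + 2 * e" unfolding e_def by (simp add: field_simps)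
    ultimately show ?thesis by (simp add: dist_real_def abs_if split: if_splits)
  qed
  have hpq: "h absolutely_integrable_on {p..q}" using absolutely_integrable_on_subinterval[OF h_int pq(2)] .
  have "0 < integral {p..q} h" using hpq pq h_pos by (intro integral_pos_of_positive) auto
  moreover have "e * integral {p..q} h \<le> integral {p..q} (\<lambda>a. h a * (c a - m))"
  proof -
    have "integral {p..q} (\<lambda>a. h a * e) \<le> integral {p..q} (\<lambda>a. h a * (c a - m))"
    proof (rule integral_le)
      show "(\<lambda>a. h a * e) integrable_on {p..q}"
        using set_lebesgue_integral_eq_integral(1)[OF hpq] by (rule integrable_on_mult_left)
      show "(\<lambda>a. h a * (c a - m)) integrable_on {p..q}"
        using pq(2) by (intro integrable_on_subinterval[OF weighted_integrable_on] continuous_intros c)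
      fix a assume "a \<in> {p..q}"
      then show "h a * e \<le> h a * (c a - m)" using big[of a] h_pos[of a] pq(2) by (intro mult_left_mono) auto
    qed
    then show ?thesis by (simp add: mult.commute)
  qed
  moreover have "integral {p..q} (\<lambda>a. h a * (c a - m)) \<le> integral {0..\<tau>} (\<lambda>a. h a * (c a - m))"
    using pq(2) h_pos m
    by (intro integral_subset_le integrable_on_subinterval[OF weighted_integrable_on pq(2)] weighted_integrable_on continuous_intros c)
      (auto simp: less_imp_le)
  moreover have "integral {0..\<tau>} (\<lambda>a. h a * (c a - m)) = integral {0..\<tau>} (\<lambda>a. h a * c a) - m"
  proof -
    have "integral {0..\<tau>} (\<lambda>a. h a * (c a - m)) = integral {0..\<tau>} (\<lambda>a. h a * c a - h a * m)"
      by (simp add: right_diff_distrib)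
    also have "\<dots> = integral {0..\<tau>} (\<lambda>a. h a * c a) - integral {0..\<tau>} (\<lambda>a. h a * m)"
      by (intro Henstock_Kurzweil_Integration.integral_diff weighted_integrable_on c continuous_on_const)
    finally show ?thesis by (simp only: average_const)
  qed
  ultimately show ?thesis using e mult_pos_pos[of e "integral {p..q} h"] by linarith
qed

end

section \<open>Mild solutions and relaxation bounds\<close>

locale delayed_reaction_diffusion = neumann_domain \<Omega> T + delay_kernel \<tau> h
  for \<Omega> :: "'a::euclidean_space set" and T \<tau> h +
  fixes f g :: "real \<Rightarrow> real" and L :: real
  assumes f_lip: "L-lipschitz_on UNIV f" and g_cont: "continuous_on UNIV g"

locale delayed_solution = delayed_reaction_diffusion \<Omega> T \<tau> h f g L
  for \<Omega> :: "'a::euclidean_space set" and T \<tau> h f g L +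
  fixes \<phi> u :: "'a \<Rightarrow> real \<Rightarrow> real"
  assumes mild: "mild_solution \<Omega> T \<tau> h f g \<phi> u"
begin

definition F :: "real \<Rightarrow> 'a \<Rightarrow> real" where
  "F s x = reaction \<tau> h f g (history u s) x"

lemma F_eq: "F s x = - f (u x s) + integral {0..\<tau>} (\<lambda>a. h a * g (u x (s - a)))"
  by (simp add: F_def reaction_def history_def)

lemma u_cont: "continuous_on (K \<times> {-\<tau>..}) (\<lambda>(x, t). u x t)"
  and u_nonneg: "x \<in> K \<Longrightarrow> - \<tau> \<le> t \<Longrightarrow> 0 \<le> u x t"
  and u_init: "x \<in> K \<Longrightarrow> t \<in> {-\<tau>..0} \<Longrightarrow> u x t = \<phi> x t"
  and u_mild: "0 \<le> t \<Longrightarrow> x \<in> K \<Longrightarrow>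
     u x t = T t (\<lambda>y. \<phi> y 0) x + integral {0..t} (\<lambda>s. T (t - s) (F s) x)"
  using mild by (auto simp: mild_solution_def F_def[abs_def])

lemma u_cont_space: "- \<tau> \<le> t \<Longrightarrow> continuous_on K (\<lambda>x. u x t)"
  using continuous_slices(1)[OF u_cont] by simp

lemma u_cont_time: "x \<in> K \<Longrightarrow> continuous_on {-\<tau>..} (u x)"
  using continuous_slices(2)[OF u_cont] by simp

lemma g_cont_on: "continuous_on S g" using g_cont continuous_on_subset by blast

lemma f_cont_on: "continuous_on S f"
  using lipschitz_on_continuous_on[OF f_lip] continuous_on_subset by blast

lemma delayed_cont: "x \<in> K \<Longrightarrow> 0 \<le> s \<Longrightarrow> continuous_on {0..\<tau>} (\<lambda>a. g (u x (s - a)))"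
  by (rule continuous_on_compose2[OF g_cont_on[of UNIV] continuous_on_compose2[OF u_cont_time]])
    (auto intro!: continuous_intros)

lemma F_cont: "continuous_on (K \<times> {0..S}) (\<lambda>(x, s). F s x)"
proof -
  have u1: "continuous_on (K \<times> {-\<tau>..S}) (\<lambda>(x, t). u x t)"
    by (rule continuous_on_subset[OF u_cont]) auto
  have gu: "continuous_on (K \<times> {-\<tau>..S}) (\<lambda>p. g ((\<lambda>(x, t). u x t) p))"
    by (rule continuous_on_compose2[OF g_cont_on[of UNIV] u1]) auto
  then have uc: "uniformly_continuous_on (K \<times> {-\<tau>..S}) (\<lambda>p. g ((\<lambda>(x, t). u x t) p))"
    using compact_K by (intro compact_uniformly_continuous compact_Times) auto
  have u2: "continuous_on (K \<times> {0..S}) (\<lambda>(x, t). u x t)"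
    by (rule continuous_on_subset[OF u_cont]) (use tau in auto)
  have 1: "continuous_on (K \<times> {0..S}) (\<lambda>p. f ((\<lambda>(x, t). u x t) p))"
    by (rule continuous_on_compose2[OF f_cont_on[of UNIV] u2]) auto
  have 2: "continuous_on (K \<times> {0..S}) (\<lambda>p. integral {0..\<tau>} (\<lambda>a. h a * g (u (fst p) (snd p - a))))"
    unfolding continuous_on_iff
  proof (intro ballI allI impI)
    fix p and e :: real assume p: "p \<in> K \<times> {0..S}" and "e > 0"
    then have "e / 2 > 0" by simp
    then obtain d where d: "d > 0" "\<And>p q. p \<in> K \<times> {-\<tau>..S} \<Longrightarrow> q \<in> K \<times> {-\<tau>..S} \<Longrightarrow> dist q p < d \<Longrightarrow>
        dist (g ((\<lambda>(x, t). u x t) q)) (g ((\<lambda>(x, t). u x t) p)) < e / 2"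
      using uc unfolding uniformly_continuous_on_def by metis
    show "\<exists>d>0. \<forall>q\<in>K \<times> {0..S}. dist q p < d \<longrightarrow>
        dist (integral {0..\<tau>} (\<lambda>a. h a * g (u (fst q) (snd q - a)))) (integral {0..\<tau>} (\<lambda>a. h a * g (u (fst p) (snd p - a)))) < e"
    proof (intro exI[of _ d] conjI d(1) ballI impI)
      fix q assume q: "q \<in> K \<times> {0..S}" "dist q p < d"
      obtain x s y t where eq: "p = (x, s)" "q = (y, t)" by fastforce
      have xs: "x \<in> K" "0 \<le> s" "s \<le> S" and yt: "y \<in> K" "0 \<le> t" "t \<le> S" using p q eq by auto
      have close: "\<bar>g (u y (t - a)) - g (u x (s - a))\<bar> \<le> e / 2" if "a \<in> {0..\<tau>}" for a
      proof -
        have "dist (y, t - a) (x, s - a) < d" using q(2) by (simp add: eq dist_Pair_Pair dist_real_def)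
        then show ?thesis using d(2)[of "(x, s - a)" "(y, t - a)"] xs yt that by (auto simp: dist_real_def)
      qed
      have "integral {0..\<tau>} (\<lambda>a. h a * g (u y (t - a))) \<le> integral {0..\<tau>} (\<lambda>a. h a * (g (u x (s - a)) + e / 2))"
        by (intro average_mono delayed_cont continuous_intros xs yt) (use close[THEN abs_le_D1] close[THEN abs_le_D2] in \<open>force simp: algebra_simps\<close>)
      moreover have "integral {0..\<tau>} (\<lambda>a. h a * g (u x (s - a))) \<le> integral {0..\<tau>} (\<lambda>a. h a * (g (u y (t - a)) + e / 2))"
        by (intro average_mono delayed_cont continuous_intros xs yt) (use close[THEN abs_le_D1] close[THEN abs_le_D2] in \<open>force simp: algebra_simps\<close>)
      moreover have "integral {0..\<tau>} (\<lambda>a. h a * (c a + e / 2)) = integral {0..\<tau>} (\<lambda>a. h a * c a) + e / 2"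
        if "continuous_on {0..\<tau>} c" for c
      proof -
        have "integral {0..\<tau>} (\<lambda>a. h a * (c a + e / 2)) = integral {0..\<tau>} (\<lambda>a. h a * c a + h a * (e / 2))"
          by (simp add: distrib_left)
        also have "\<dots> = integral {0..\<tau>} (\<lambda>a. h a * c a) + integral {0..\<tau>} (\<lambda>a. h a * (e / 2))"
          by (intro Henstock_Kurzweil_Integration.integral_add weighted_integrable_on that continuous_on_const)
        finally show ?thesis by (simp only: average_const)
      qed
      ultimately show "dist (integral {0..\<tau>} (\<lambda>a. h a * g (u (fst q) (snd q - a)))) (integral {0..\<tau>} (\<lambda>a. h a * g (u (fst p) (snd p - a)))) < e"
        using \<open>e > 0\<close> delayed_cont[OF xs(1,2)] delayed_cont[OF yt(1,2)] by (simp add: eq dist_real_def abs_less_iff)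
    qed
  qed
  have "continuous_on (K \<times> {0..S}) (\<lambda>p. - f ((\<lambda>(x, t). u x t) p) + integral {0..\<tau>} (\<lambda>a. h a * g (u (fst p) (snd p - a))))"
    by (intro continuous_intros 1 2)
  then show ?thesis by (simp add: F_eq case_prod_unfold)
qed

lemma F_cont_space: "0 \<le> s \<Longrightarrow> continuous_on K (F s)"
  using continuous_slices(1)[OF F_cont[of s]] by simp

text \<open>Applying \<open>T (t - s)\<close> to the mild formula at time \<open>s\<close> gives an expression that is differentiable in \<open>s\<close>, although
  \<open>u\<close> itself need not be differentiable in time.\<close>
lemma propagated_solution:
  assumes s: "0 \<le> s" "s \<le> t" and x: "x \<in> K"
  shows "T (t - s) (\<lambda>z. u z s) x = T t (\<lambda>y. \<phi> y 0) x + integral {0..s} (\<lambda>r. T (t - r) (F r) x)"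
proof -
  have ts: "0 \<le> t - s" using s by simp
  have u0: "continuous_on K (\<lambda>y. u y 0)" using tau by (intro u_cont_space) simp
  have \<phi>0: "continuous_on K (\<lambda>y. \<phi> y 0)"
    using u0 by (rule continuous_on_eq) (use u_init tau in auto)
  have J: "continuous_on (K \<times> {0..s}) (\<lambda>(z, r). T (s - r) (F r) z)"
    by (rule T_jointly_continuous[OF F_cont]) (auto intro!: continuous_intros)
  have Ic: "continuous_on K (\<lambda>z. integral {0..s} (\<lambda>r. T (s - r) (F r) z))"
    using integral_curve_continuous[OF J] s by simp
  have "T (t - s) (\<lambda>z. u z s) x = T (t - s) (\<lambda>z. T s (\<lambda>y. \<phi> y 0) z + integral {0..s} (\<lambda>r. T (s - r) (F r) z)) x"
    using s tau by (intro T_cong ts u_cont_space x continuous_on_add T_cont \<phi>0 Ic u_mild) auto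
  also have "\<dots> = T (t - s) (T s (\<lambda>y. \<phi> y 0)) x + T (t - s) (\<lambda>z. integral {0..s} (\<lambda>r. T (s - r) (F r) z)) x"
    by (rule T_plus[OF ts T_cont[OF s(1) \<phi>0] Ic x])
  also have "T (t - s) (T s (\<lambda>y. \<phi> y 0)) x = T t (\<lambda>y. \<phi> y 0) x"
    using T_add[OF ts s(1) \<phi>0 x] by simp
  also have "T (t - s) (\<lambda>z. integral {0..s} (\<lambda>r. T (s - r) (F r) z)) x = integral {0..s} (\<lambda>r. T (t - s) (T (s - r) (F r)) x)"
    by (rule T_integral[OF J s(1) ts x])
  also have "\<dots> = integral {0..s} (\<lambda>r. T (t - r) (F r) x)"
  proof (rule integral_cong)
    fix r assume "r \<in> {0..s}"
    then have "0 \<le> s - r" "0 \<le> r" by auto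
    from T_add[OF ts this(1) F_cont_space[OF this(2)] x]
    show "T (t - s) (T (s - r) (F r)) x = T (t - r) (F r) x" by simp
  qed
  finally show ?thesis .
qed

lemma shifted_source_cont:
  "continuous_on (K \<times> {0..t}) (\<lambda>(z, s). F s z + k * u z s)"
proof -
  have "continuous_on (K \<times> {0..t}) (\<lambda>(z, s). u z s)"
    by (rule continuous_on_subset[OF u_cont]) (use tau in auto)
  then have "continuous_on (K \<times> {0..t}) (\<lambda>p. (\<lambda>(z, s). F s z) p + k * (\<lambda>(z, s). u z s) p)"
    by (intro continuous_intros F_cont)
  then show ?thesis by (simp add: case_prod_unfold)
qed

lemma shifted_integrand_cont:
  assumes "x \<in> K"
  shows "continuous_on {0..t} (\<lambda>s. exp (k * s) * T (t - s) (\<lambda>z. F s z + k * u z s) x)"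
proof -
  have "continuous_on (K \<times> {0..t}) (\<lambda>(x, s). T (t - s) (\<lambda>z. F s z + k * u z s) x)"
    by (rule T_jointly_continuous[OF shifted_source_cont]) (auto intro!: continuous_intros)
  from continuous_slices(2)[OF this assms] show ?thesis by (intro continuous_intros)
qed

text \<open>The variation of constants formula with an extra damping term and an arbitrary initial time: multiply
  \<open>T (t - s) (u s) x\<close> by the integrating factor \<open>exp (k s)\<close> and integrate its derivative from \<open>t0\<close> to \<open>t\<close>.\<close>
lemma shifted_variation_of_constants:
  assumes t: "0 \<le> t0" "t0 \<le> t" and x: "x \<in> K"
  shows "exp (k * t) * u x t - exp (k * t0) * T (t - t0) (\<lambda>z. u z t0) x =
    integral {t0..t} (\<lambda>s. exp (k * s) * T (t - s) (\<lambda>z. F s z + k * u z s) x)"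
proof -
  define y where "y s = T (t - s) (\<lambda>z. u z s) x" for s
  have J: "continuous_on (K \<times> {0..t}) (\<lambda>(z, r). T (t - r) (F r) z)"
    by (rule T_jointly_continuous[OF F_cont]) (auto intro!: continuous_intros)
  have der: "(y has_real_derivative T (t - s) (F s) x) (at s within {0..t})" if s: "s \<in> {0..t}" for s
  proof (rule has_field_derivative_transform_within[OF _ zero_less_one s])
    show "((\<lambda>s. T t (\<lambda>y. \<phi> y 0) x + integral {0..s} (\<lambda>r. T (t - r) (F r) x)) has_real_derivative T (t - s) (F s) x) (at s within {0..t})"
      using integral_has_real_derivative[OF continuous_slices(2)[OF J x] s]
      by (auto intro!: derivative_eq_intros)
    show "T t (\<lambda>y. \<phi> y 0) x + integral {0..s'} (\<lambda>r. T (t - r) (F r) x) = y s'" if "s' \<in> {0..t}" for s'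
      unfolding y_def using propagated_solution[OF _ _ x] that by simp
  qed
  have src: "T (t - s) (\<lambda>z. F s z + k * u z s) x = T (t - s) (F s) x + k * y s" if s: "s \<in> {0..t}" for s
  proof -
    have "0 \<le> t - s" "0 \<le> s" "- \<tau> \<le> s" using s tau by auto
    then show ?thesis
      using T_lin[of "t - s" "F s" "\<lambda>z. u z s" x 1 k] F_cont_space u_cont_space x by (simp add: y_def)
  qed
  have "((\<lambda>s. exp (k * s) * T (t - s) (\<lambda>z. F s z + k * u z s) x) has_integral exp (k * t) * y t - exp (k * t0) * y t0) {t0..t}"
  proof (rule fundamental_theorem_of_calculus[OF t(2)])
    fix s assume s: "s \<in> {t0..t}"
    then have s': "s \<in> {0..t}" using t by simp
    have "((\<lambda>s. exp (k * s) * y s) has_real_derivative exp (k * s) * T (t - s) (\<lambda>z. F s z + k * u z s) x) (at s within {0..t})"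
      unfolding src[OF s'] by (rule derivative_eq_intros der[OF s'] refl)+ (simp add: algebra_simps)
    then have "((\<lambda>s. exp (k * s) * y s) has_real_derivative exp (k * s) * T (t - s) (\<lambda>z. F s z + k * u z s) x) (at s within {t0..t})"
      by (rule DERIV_subset) (use t in auto)
    then show "((\<lambda>s. exp (k * s) * y s) has_vector_derivative exp (k * s) * T (t - s) (\<lambda>z. F s z + k * u z s) x) (at s within {t0..t})"
      by (simp add: has_real_derivative_iff_has_vector_derivative)
  qed
  moreover have "y t = u x t"
    unfolding y_def using T_0[OF u_cont_space x, of t] t tau by simp
  ultimately show ?thesis by (simp add: integral_unique y_def)
qed

lemma integral_exp:
  fixes k t0 t :: real
  assumes "k \<noteq> 0" "t0 \<le> t"
  shows "((\<lambda>s. exp (k * s)) has_integral (exp (k * t) - exp (k * t0)) / k) {t0..t}"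
proof -
  have "((\<lambda>s. exp (k * s)) has_integral (exp (k * t) / k - exp (k * t0) / k)) {t0..t}"
    using assms(1) by (intro fundamental_theorem_of_calculus[OF assms(2)])
      (auto intro!: derivative_eq_intros simp flip: has_real_derivative_iff_has_vector_derivative)
  then show ?thesis by (simp add: diff_divide_distrib)
qed

lemma relaxation_identity:
  "exp (k * t0) * b + (exp (k * t) - exp (k * t0)) / k * A =
     exp (k * t) * (exp (- (k * (t - t0))) * b + (1 - exp (- (k * (t - t0)))) * (A / k))"
  for k t0 t b A :: real
proof -
  define E where "E = exp (- (k * (t - t0)))"
  have "exp (k * t0) = exp (k * t) * E" by (simp add: E_def right_diff_distrib flip: exp_add)
  then show ?thesis unfolding E_def[symmetric] by (simp add: algebra_simps diff_divide_distrib)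
qed

text \<open>The bound is the solution of the spatially constant problem \<open>y' = A - k y\<close>, \<open>y t0 = b\<close> at time \<open>t\<close>.\<close>
lemma relaxation_upper:
  assumes t: "0 \<le> t0" "t0 \<le> t" and x: "x \<in> K" and k: "k > 0"
    and b: "\<And>z. z \<in> K \<Longrightarrow> u z t0 \<le> b"
    and A: "\<And>z s. z \<in> K \<Longrightarrow> s \<in> {t0..t} \<Longrightarrow> F s z + k * u z s \<le> A"
  shows "u x t \<le> exp (- (k * (t - t0))) * b + (1 - exp (- (k * (t - t0)))) * (A / k)"
proof -
  have int: "(\<lambda>s. exp (k * s) * T (t - s) (\<lambda>z. F s z + k * u z s) x) integrable_on {t0..t}"
    by (rule integrable_continuous_interval[OF continuous_on_subset[OF shifted_integrand_cont[OF x]]]) (use t in auto)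
  have "((\<lambda>s. exp (k * s) * A) has_integral (exp (k * t) - exp (k * t0)) / k * A) {t0..t}"
    using integral_exp[of k t0 t] k t by (intro has_integral_mult_left) auto
  moreover have "T (t - s) (\<lambda>z. F s z + k * u z s) x \<le> A" if "s \<in> {t0..t}" for s
    using that t A x by (intro T_upper continuous_slices(1)[OF shifted_source_cont[of t]]) auto
  ultimately have "integral {t0..t} (\<lambda>s. exp (k * s) * T (t - s) (\<lambda>z. F s z + k * u z s) x) \<le> (exp (k * t) - exp (k * t0)) / k * A"
    by (intro has_integral_le[OF integrable_integral[OF int]]) (auto intro!: mult_left_mono)
  moreover have "T (t - t0) (\<lambda>z. u z t0) x \<le> b"
    using t tau b x by (intro T_upper u_cont_space) auto
  then have "exp (k * t0) * T (t - t0) (\<lambda>z. u z t0) x \<le> exp (k * t0) * b" by simp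
  ultimately have "exp (k * t) * u x t \<le> exp (k * t0) * b + (exp (k * t) - exp (k * t0)) / k * A"
    using shifted_variation_of_constants[OF t x, of k] by linarith
  also have "exp (k * t0) * b + (exp (k * t) - exp (k * t0)) / k * A =
      exp (k * t) * (exp (- (k * (t - t0))) * b + (1 - exp (- (k * (t - t0)))) * (A / k))"
    by (rule relaxation_identity)
  finally show ?thesis by simp
qed

lemma relaxation_lower:
  assumes t: "0 \<le> t0" "t0 \<le> t" and x: "x \<in> K" and k: "k > 0"
    and b: "\<And>z. z \<in> K \<Longrightarrow> b \<le> u z t0"
    and A: "\<And>z s. z \<in> K \<Longrightarrow> s \<in> {t0..t} \<Longrightarrow> A \<le> F s z + k * u z s"
  shows "exp (- (k * (t - t0))) * b + (1 - exp (- (k * (t - t0)))) * (A / k) \<le> u x t"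
proof -
  have int: "(\<lambda>s. exp (k * s) * T (t - s) (\<lambda>z. F s z + k * u z s) x) integrable_on {t0..t}"
    by (rule integrable_continuous_interval[OF continuous_on_subset[OF shifted_integrand_cont[OF x]]]) (use t in auto)
  have "((\<lambda>s. exp (k * s) * A) has_integral (exp (k * t) - exp (k * t0)) / k * A) {t0..t}"
    using integral_exp[of k t0 t] k t by (intro has_integral_mult_left) auto
  moreover have "A \<le> T (t - s) (\<lambda>z. F s z + k * u z s) x" if "s \<in> {t0..t}" for s
    using that t A x by (intro T_lower continuous_slices(1)[OF shifted_source_cont[of t]]) auto
  ultimately have "(exp (k * t) - exp (k * t0)) / k * A \<le> integral {t0..t} (\<lambda>s. exp (k * s) * T (t - s) (\<lambda>z. F s z + k * u z s) x)"
    by (intro has_integral_le[OF _ integrable_integral[OF int]]) (auto intro!: mult_left_mono)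
  moreover have "b \<le> T (t - t0) (\<lambda>z. u z t0) x"
    using t tau b x by (intro T_lower u_cont_space) auto
  then have "exp (k * t0) * b \<le> exp (k * t0) * T (t - t0) (\<lambda>z. u z t0) x" by simp
  ultimately have le: "exp (k * t0) * b + (exp (k * t) - exp (k * t0)) / k * A \<le> exp (k * t) * u x t"
    using shifted_variation_of_constants[OF t x, of k] by linarith
  have "exp (k * t0) * b + (exp (k * t) - exp (k * t0)) / k * A =
      exp (k * t) * (exp (- (k * (t - t0))) * b + (1 - exp (- (k * (t - t0)))) * (A / k))"
    by (rule relaxation_identity)
  with le show ?thesis by simp
qed

text \<open>Any rate above the Lipschitz constant makes \<open>s \<mapsto> \<kappa> s - f s\<close> nondecreasing; adding \<open>1\<close> also makes it positive.\<close>
definition \<kappa> where "\<kappa> = L + 1"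

lemma kappa_pos: "\<kappa> > 0" using lipschitz_on_nonneg[OF f_lip] by (simp add: \<kappa>_def)

lemma shifted_f_mono: "a \<le> b \<Longrightarrow> \<kappa> * a - f a \<le> \<kappa> * b - f b"
proof -
  assume "a \<le> b"
  then have "\<bar>f b - f a\<bar> \<le> L * (b - a)"
    using lipschitz_onD[OF f_lip, of b a] by (simp add: dist_real_def)
  then show ?thesis using \<open>a \<le> b\<close> by (simp add: \<kappa>_def algebra_simps abs_le_iff)
qed

text \<open>The bounds on \<open>u\<close> and on \<open>g u\<close> live on different intervals: \<open>f\<close> sees the present, but the average of \<open>g u\<close>
  reaches back to \<open>t0 - \<tau>\<close>.\<close>
lemma solution_upper:
  assumes t: "0 \<le> t0" "t0 \<le> t" and x: "x \<in> K"
    and b: "\<And>z. z \<in> K \<Longrightarrow> u z t0 \<le> b"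
    and m: "\<And>z s. z \<in> K \<Longrightarrow> s \<in> {t0..t} \<Longrightarrow> u z s \<le> m"
    and G: "\<And>z s. z \<in> K \<Longrightarrow> s \<in> {t0 - \<tau>..t} \<Longrightarrow> g (u z s) \<le> G"
  shows "u x t \<le> exp (- (\<kappa> * (t - t0))) * b + (1 - exp (- (\<kappa> * (t - t0)))) * (m + (G - f m) / \<kappa>)"
proof -
  have "F s z + \<kappa> * u z s \<le> \<kappa> * m + (G - f m)" if "z \<in> K" "s \<in> {t0..t}" for z s
  proof -
    have "integral {0..\<tau>} (\<lambda>a. h a * g (u z (s - a))) \<le> G"
      using that t by (intro average_upper delayed_cont G) auto
    then show ?thesis using shifted_f_mono[OF m[OF that]] by (simp add: F_eq)
  qed
  from relaxation_upper[OF t x kappa_pos b this] show ?thesis using kappa_pos by (simp add: add_divide_distrib)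
qed

lemma solution_lower:
  assumes t: "0 \<le> t0" "t0 \<le> t" and x: "x \<in> K"
    and b: "\<And>z. z \<in> K \<Longrightarrow> b \<le> u z t0"
    and m: "\<And>z s. z \<in> K \<Longrightarrow> s \<in> {t0..t} \<Longrightarrow> m \<le> u z s"
    and G: "\<And>z s. z \<in> K \<Longrightarrow> s \<in> {t0 - \<tau>..t} \<Longrightarrow> G \<le> g (u z s)"
  shows "exp (- (\<kappa> * (t - t0))) * b + (1 - exp (- (\<kappa> * (t - t0)))) * (m + (G - f m) / \<kappa>) \<le> u x t"
proof -
  have "\<kappa> * m + (G - f m) \<le> F s z + \<kappa> * u z s" if "z \<in> K" "s \<in> {t0..t}" for z s
  proof -
    have "G \<le> integral {0..\<tau>} (\<lambda>a. h a * g (u z (s - a)))"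
      using that t by (intro average_lower delayed_cont G) auto
    then show ?thesis using shifted_f_mono[OF m[OF that]] by (simp add: F_eq)
  qed
  from relaxation_lower[OF t x kappa_pos b this] show ?thesis using kappa_pos by (simp add: add_divide_distrib)
qed

end

section \<open>Positivity of solutions\<close>

locale positive_feedback_solution = delayed_solution \<Omega> T \<tau> h f g L \<phi> u
  for \<Omega> :: "'a::euclidean_space set" and T \<tau> h f g L \<phi> u +
  assumes fg0: "f 0 = g 0" and g_gt: "\<And>s. s > 0 \<Longrightarrow> g s > g 0"
begin

lemma g_ge: "0 \<le> s \<Longrightarrow> g 0 \<le> g s"
  using g_gt[of s] by (cases "s = 0") auto

lemma shifted_source_ge:
  assumes "z \<in> K" "0 \<le> s"
  shows "integral {0..\<tau>} (\<lambda>a. h a * g (u z (s - a))) - g 0 \<le> F s z + \<kappa> * u z s"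
  using shifted_f_mono[OF u_nonneg[OF assms(1), of s]] assms(2) tau fg0 by (simp add: F_eq)

lemma shifted_source_nonneg:
  assumes "z \<in> K" "0 \<le> s"
  shows "0 \<le> F s z + \<kappa> * u z s"
proof -
  have "g 0 \<le> integral {0..\<tau>} (\<lambda>a. h a * g (u z (s - a)))"
    using assms by (intro average_lower delayed_cont g_ge u_nonneg) auto
  then show ?thesis using shifted_source_ge[OF assms] by simp
qed

lemma integrand_nonneg:
  assumes "x \<in> K" "0 \<le> s" "s \<le> t"
  shows "0 \<le> exp (\<kappa> * s) * T (t - s) (\<lambda>z. F s z + \<kappa> * u z s) x"
  using assms by (intro mult_nonneg_nonneg T_nonneg shifted_source_nonneg
      continuous_slices(1)[OF shifted_source_cont[of t]]) auto

lemma solution_ge_semigroup: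
  assumes "0 \<le> t0" "t0 \<le> t" "x \<in> K"
  shows "exp (\<kappa> * t0) * T (t - t0) (\<lambda>z. u z t0) x \<le> exp (\<kappa> * t) * u x t"
proof -
  have "0 \<le> integral {t0..t} (\<lambda>s. exp (\<kappa> * s) * T (t - s) (\<lambda>z. F s z + \<kappa> * u z s) x)"
    using assms by (intro integral_nonneg integrable_continuous_interval integrand_nonneg
        continuous_on_subset[OF shifted_integrand_cont[of x t]]) auto
  then show ?thesis using shifted_variation_of_constants[OF assms, of \<kappa>] by simp
qed

text \<open>The source at \<open>x\<close> is positive at time \<open>t\<close>, since the average of \<open>g u\<close> over the last \<open>\<tau>\<close> time units includes time \<open>s0\<close>.
  Times close to \<open>t\<close> thus contribute a positive amount to the integral formula, and all other contributions are
  nonnegative.\<close>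
lemma positivity_within_delay:
  assumes x: "x \<in> K" and s0: "- \<tau> \<le> s0" "0 < u x s0" and t: "s0 \<le> t" "t \<le> s0 + \<tau>" "0 < t"
  shows "0 < u x t"
proof -
  have t0: "0 \<le> t" using t by simp
  define q where "q s = exp (\<kappa> * s) * T (t - s) (\<lambda>z. F s z + \<kappa> * u z s) x" for s
  have "g 0 < integral {0..\<tau>} (\<lambda>a. h a * g (u x (t - a)))"
    using s0 t x by (intro average_greater[of _ _ "t - s0"] delayed_cont g_ge g_gt u_nonneg) auto
  then have "0 < F t x + \<kappa> * u x t" using shifted_source_ge[OF x t0] by simp
  moreover have "T (t - t) (\<lambda>z. F t z + \<kappa> * u z t) x = F t x + \<kappa> * u x t"
    using T_0[OF continuous_slices(1)[OF shifted_source_cont[of t \<kappa>]] x] t0 by simp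
  ultimately have "0 < q t" by (simp add: q_def)
  then have "0 < integral {0..t} q"
    using t x integrand_nonneg[OF x] shifted_integrand_cont[OF x, of t \<kappa>]
    by (intro integral_continuous_pos[where t = t]) (auto simp: q_def[abs_def])
  moreover have "exp (\<kappa> * t) * u x t = exp (\<kappa> * 0) * T (t - 0) (\<lambda>z. u z 0) x + integral {0..t} q"
    using shifted_variation_of_constants[of 0 t x \<kappa>] t0 x by (simp add: q_def[abs_def])
  moreover have "0 \<le> T (t - 0) (\<lambda>z. u z 0) x"
    using t0 tau x by (intro T_nonneg u_cont_space u_nonneg) auto
  ultimately have "0 < exp (\<kappa> * t) * u x t" by simp
  then show ?thesis by (simp add: zero_less_mult_iff)
qed

text \<open>The strict inequality \<open>- \<tau> < s0\<close> lets the first step reach a positive time.\<close>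
lemma positivity_persists:
  assumes x: "x \<in> K" and s0: "- \<tau> < s0" "0 < u x s0" and t: "s0 \<le> t" "0 < t"
  shows "0 < u x t"
proof -
  obtain n where "(t - s0) / \<tau> < real n" using reals_Archimedean2 by blast
  then have "t \<le> s0 + real (Suc n) * \<tau>" using tau by (simp add: field_simps)
  then show ?thesis using s0 t(1)
  proof (induction n arbitrary: s0)
    case 0
    then show ?case using positivity_within_delay[OF x, of s0 t] t(2) by simp
  next
    case (Suc n)
    show ?case
    proof (cases "t \<le> s0 + \<tau>")
      case True
      then show ?thesis using positivity_within_delay[OF x, of s0 t] Suc.prems t(2) by simp
    next
      case False
      have "0 < u x (s0 + \<tau>)" using positivity_within_delay[OF x, of s0 "s0 + \<tau>"] Suc.prems tau by simp
      then show ?thesis using Suc.prems(1,2) False tau by (intro Suc.IH[of "s0 + \<tau>"]) (auto simp: algebra_simps)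
    qed
  qed
qed

text \<open>The solution dominates the damped semigroup, so every point of the compact closure becomes positive at some
  time and stays so. The sets of points that are positive at time \<open>Suc n\<close> are open and increasing.\<close>
lemma eventually_positive:
  assumes nz: "x0 \<in> K" "t0 \<in> {-\<tau>..0}" "\<phi> x0 t0 \<noteq> 0"
  obtains t1 where "0 \<le> t1" "\<And>x t. x \<in> K \<Longrightarrow> t1 \<le> t \<Longrightarrow> 0 < u x t"
proof -
  have pos: "0 < u x0 t0" using u_init[OF nz(1,2)] u_nonneg[OF nz(1), of t0] nz by auto
  obtain s0 where s0: "- \<tau> < s0" "s0 \<le> 0" "0 < u x0 s0"
  proof (cases "t0 = - \<tau>")
    case True
    have "continuous_on {-\<tau>..} (u x0)" using u_cont_time[OF nz(1)] .
    moreover have "t0 \<in> {-\<tau>..}" using nz by simp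
    ultimately obtain d where d: "d > 0" "\<And>s. s \<in> {-\<tau>..} \<Longrightarrow> dist s t0 < d \<Longrightarrow> dist (u x0 s) (u x0 t0) < u x0 t0"
      unfolding continuous_on_iff using pos by metis
    define s where "s = - \<tau> + min d \<tau> / 2"
    have "- \<tau> < s" "s \<le> 0" "dist s t0 < d" using d(1) tau True by (auto simp: s_def dist_real_def min_def)
    moreover from this have "0 < u x0 s" using d(2)[of s] by (auto simp: dist_real_def)
    ultimately show ?thesis using that by blast
  next
    case False
    then show ?thesis using that[of t0] nz pos by simp
  qed
  then have u1: "0 < u x0 1" using nz by (intro positivity_persists[OF nz(1) s0(1,3)]) auto
  have uc: "continuous_on K (\<lambda>z. u z 1)" using tau by (intro u_cont_space) simp
  have ex: "\<exists>t>0. 0 < u z t" if z: "z \<in> K" for z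
  proof -
    have u1_nonneg: "0 \<le> u y 1" if "y \<in> K" for y using u_nonneg[OF that, of 1] tau by simp
    obtain t where t: "0 \<le> t" "0 < T t (\<lambda>z. u z 1) z"
      using semigroup_strictly_positive[OF uc u1_nonneg nz(1) u1 z] by blast
    have "exp (\<kappa> * 1) * T (1 + t - 1) (\<lambda>z. u z 1) z \<le> exp (\<kappa> * (1 + t)) * u z (1 + t)"
      using t z by (intro solution_ge_semigroup) auto
    moreover have "0 < exp (\<kappa> * 1) * T (1 + t - 1) (\<lambda>z. u z 1) z" using t by simp
    ultimately have "0 < exp (\<kappa> * (1 + t)) * u z (1 + t)" by linarith
    then have "0 < u z (1 + t)" by (simp add: zero_less_mult_iff)
    then show ?thesis using t(1) by (intro exI[of _ "1 + t"]) auto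
  qed
  define U where "U n = {z \<in> K. 0 < u z (real (Suc n))}" for n
  have op: "openin (top_of_set K) (U n)" for n
  proof -
    have "continuous_on K (\<lambda>z. u z (real (Suc n)))" using tau by (intro u_cont_space) simp
    then have "openin (top_of_set K) (K \<inter> (\<lambda>z. u z (real (Suc n))) -` {0<..})"
      by (intro continuous_openin_preimage_gen) auto
    moreover have "K \<inter> (\<lambda>z. u z (real (Suc n))) -` {0<..} = U n" by (auto simp: U_def)
    ultimately show ?thesis by simp
  qed
  have cover: "K \<subseteq> (\<Union>n. U n)"
  proof
    fix z assume z: "z \<in> K"
    obtain t where t: "0 < t" "0 < u z t" using ex[OF z] by blast
    obtain n where "t < real n" using reals_Archimedean2 by blast
    then have "0 < u z (real (Suc n))" using t tau by (intro positivity_persists[OF z _ t(2)]) auto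
    then show "z \<in> (\<Union>n. U n)" using z by (auto simp: U_def)
  qed
  have "\<forall>n. \<exists>W. open W \<and> U n = K \<inter> W" using op by (auto simp: openin_open)
  then obtain W where W: "\<And>n. open (W n)" "\<And>n. U n = K \<inter> W n" by metis
  have "K \<subseteq> (\<Union>n\<in>UNIV. W n)" using cover W(2) by blast
  then obtain N where N: "finite N" "K \<subseteq> (\<Union>n\<in>N. W n)"
    using compactE_image[OF compact_K, of UNIV W] W(1) by metis
  define n where "n = Max (insert 0 N)"
  show ?thesis
  proof (rule that[of "real (Suc n)"])
    fix x t assume x: "x \<in> K" and t: "real (Suc n) \<le> t"
    obtain i where i: "i \<in> N" "x \<in> W i" using N(2) x by blast
    then have "i \<le> n" using N(1) by (simp add: n_def)
    have "0 < u x (real (Suc i))" using W(2)[of i] x i by (auto simp: U_def)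
    then show "0 < u x t" using t \<open>i \<le> n\<close> tau
      by (intro positivity_persists[OF x _ \<open>0 < u x (real (Suc i))\<close>]) auto
  qed simp
qed

end

section \<open>Convergence of solutions\<close>

text \<open>The two conditions are asymmetric: to the left of \<open>ustar\<close> nothing is known about \<open>g\<close> beyond \<open>ustar\<close>, where it may
  fall again. Upper bounds for the solution therefore have to be established before lower ones.\<close>
locale crossing_feedback_solution = positive_feedback_solution \<Omega> T \<tau> h f g L \<phi> u
  for \<Omega> :: "'a::euclidean_space set" and T \<tau> h f g L \<phi> u +
  fixes ustar :: real
  assumes ustar_pos: "0 < ustar"
    and above: "\<And>s v. ustar < s \<Longrightarrow> 0 \<le> v \<Longrightarrow> v \<le> s \<Longrightarrow> g v < f s"
    and below: "\<And>s v. 0 < s \<Longrightarrow> s < ustar \<Longrightarrow> s \<le> v \<Longrightarrow> v \<le> ustar \<Longrightarrow> f s < g v"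
begin

lemma max_attained:
  assumes "a \<le> b" "- \<tau> \<le> a"
  obtains p s where "p \<in> K" "s \<in> {a..b}" "\<And>x t. x \<in> K \<Longrightarrow> t \<in> {a..b} \<Longrightarrow> u x t \<le> u p s"
proof -
  have "continuous_on (K \<times> {a..b}) (\<lambda>(x, t). u x t)"
    by (rule continuous_on_subset[OF u_cont]) (use assms in auto)
  moreover have "compact (K \<times> {a..b})" "K \<times> {a..b} \<noteq> {}" using compact_K K_nonempty assms by (auto intro: compact_Times)
  ultimately obtain q where "q \<in> K \<times> {a..b}" "\<forall>r\<in>K \<times> {a..b}. (\<lambda>(x, t). u x t) r \<le> (\<lambda>(x, t). u x t) q"
    using continuous_attains_sup by metis
  then show ?thesis using that[of "fst q" "snd q"] by (cases q) fastforce
qed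

lemma min_attained:
  assumes "a \<le> b" "- \<tau> \<le> a"
  obtains p s where "p \<in> K" "s \<in> {a..b}" "\<And>x t. x \<in> K \<Longrightarrow> t \<in> {a..b} \<Longrightarrow> u p s \<le> u x t"
proof -
  have "continuous_on (K \<times> {a..b}) (\<lambda>(x, t). u x t)"
    by (rule continuous_on_subset[OF u_cont]) (use assms in auto)
  moreover have "compact (K \<times> {a..b})" "K \<times> {a..b} \<noteq> {}" using compact_K K_nonempty assms by (auto intro: compact_Times)
  ultimately obtain q where "q \<in> K \<times> {a..b}" "\<forall>r\<in>K \<times> {a..b}. (\<lambda>(x, t). u x t) q \<le> (\<lambda>(x, t). u x t) r"
    using continuous_attains_inf by metis
  then show ?thesis using that[of "fst q" "snd q"] by (cases q) fastforce
qed

lemma decay_factor: "0 < s \<Longrightarrow> exp (- (\<kappa> * s)) < 1" using kappa_pos by simp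

text \<open>If the maximum \<open>Q\<close> over an initial time interval exceeded both \<open>ustar\<close> and all initial values, it would be attained at a
  positive time; but the relaxation bound at that time is strictly smaller than \<open>Q\<close>.\<close>
lemma solution_bounded:
  obtains m where "ustar < m" "\<And>x t. x \<in> K \<Longrightarrow> - \<tau> \<le> t \<Longrightarrow> u x t \<le> m"
proof -
  have "- \<tau> \<le> 0" using tau by simp
  from max_attained[OF this order_refl]
  obtain p0 s0 where Q0: "\<And>x t. x \<in> K \<Longrightarrow> t \<in> {-\<tau>..0} \<Longrightarrow> u x t \<le> u p0 s0" by metis
  define m where "m = max (u p0 s0) (ustar + 1)"
  have "u x1 t1 \<le> m" if x1: "x1 \<in> K" and t1: "- \<tau> \<le> t1" for x1 t1
  proof (rule ccontr)
    assume neg: "\<not> u x1 t1 \<le> m"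
    obtain p s where p: "p \<in> K" "s \<in> {-\<tau>..t1}" "\<And>x t. x \<in> K \<Longrightarrow> t \<in> {-\<tau>..t1} \<Longrightarrow> u x t \<le> u p s"
      by (rule max_attained[OF t1 order_refl]) blast
    define Q where "Q = u p s"
    have Qm: "m < Q" using p(3)[OF x1, of t1] t1 neg by (simp add: Q_def)
    then have Qu: "ustar < Q" by (simp add: m_def)
    have "\<not> s \<le> 0" using Q0[OF p(1), of s] p(2) Qm by (auto simp: Q_def m_def)
    then have s: "0 < s" by simp
    obtain v where v: "v \<in> {0..Q}" "\<And>v'. v' \<in> {0..Q} \<Longrightarrow> g v' \<le> g v"
      using continuous_attains_sup[of "{0..Q}" g] g_cont_on Qu ustar_pos by fastforce
    have gf: "g v < f Q" using above[OF Qu] v(1) by auto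
    have le: "u z r \<le> Q" if "z \<in> K" "r \<in> {-\<tau>..s}" for z r
      using p(2) p(3)[OF that(1), of r] that by (auto simp: Q_def)
    have "u p s \<le> exp (- (\<kappa> * (s - 0))) * Q + (1 - exp (- (\<kappa> * (s - 0)))) * (Q + (g v - f Q) / \<kappa>)"
      using s tau by (intro solution_upper p(1) v(2) le) (auto intro!: u_nonneg le)
    also have "\<dots> = Q + (1 - exp (- (\<kappa> * s))) * ((g v - f Q) / \<kappa>)" by (simp add: algebra_simps)
    also have "\<dots> < Q" using decay_factor[OF s] gf kappa_pos by (simp add: mult_pos_neg divide_neg_pos)
    finally show False by (simp add: Q_def)
  qed
  moreover have "ustar < m" by (simp add: m_def)
  ultimately show ?thesis using that by blast
qed

text \<open>\<open>S\<close> is the infimum of the eventual upper bounds of \<open>u\<close> in \<open>[ustar,\<infinity>)\<close>. If \<open>S > ustar\<close>, then for \<open>m\<close> slightly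
  larger than \<open>S\<close> the gap between \<open>f m\<close> and \<open>g\<close> on \<open>[0,m]\<close> is bounded below, and relaxation improves the bound
  \<open>m\<close> by an amount that does not depend on how close \<open>m\<close> is to \<open>S\<close>.\<close>
lemma eventually_below:
  assumes "\<epsilon> > 0"
  obtains t1 where "\<And>x t. x \<in> K \<Longrightarrow> t1 \<le> t \<Longrightarrow> u x t \<le> ustar + \<epsilon>"
proof -
  define A where "A = {m. ustar \<le> m \<and> (\<exists>t1. \<forall>x\<in>K. \<forall>t\<ge>t1. u x t \<le> m)}"
  have A_ne: "A \<noteq> {}" and A_bdd: "bdd_below A"
  proof -
    obtain m where "ustar < m" "\<And>x t. x \<in> K \<Longrightarrow> - \<tau> \<le> t \<Longrightarrow> u x t \<le> m" using solution_bounded by blast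
    then have "m \<in> A" by (auto simp: A_def intro!: exI[of _ "- \<tau>"])
    then show "A \<noteq> {}" by blast
    show "bdd_below A" by (auto simp: A_def intro!: bdd_belowI[of _ ustar])
  qed
  define S where "S = Inf A"
  have S: "ustar \<le> S" unfolding S_def by (rule cInf_greatest[OF A_ne]) (simp add: A_def)
  have "S = ustar"
  proof (rule ccontr)
    assume "S \<noteq> ustar"
    then have Su: "ustar < S" using S by simp
    obtain v0 where v0: "v0 \<in> {0..S}" "\<And>v. v \<in> {0..S} \<Longrightarrow> g v \<le> g v0"
      using continuous_attains_sup[of "{0..S}" g] g_cont_on Su ustar_pos by fastforce
    define \<delta> where "\<delta> = (f S - g v0) / 3"
    have \<delta>: "\<delta> > 0" "f S = g v0 + 3 * \<delta>" using above[OF Su] v0(1) by (auto simp: \<delta>_def field_simps)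
    obtain df where df: "df > 0" "\<And>s. dist s S < df \<Longrightarrow> dist (f s) (f S) < \<delta>"
      using f_cont_on[of UNIV] \<delta>(1) unfolding continuous_on_iff by (metis UNIV_I)
    obtain dg where dg: "dg > 0" "\<And>s. dist s S < dg \<Longrightarrow> dist (g s) (g S) < \<delta>"
      using g_cont_on[of UNIV] \<delta>(1) unfolding continuous_on_iff by (metis UNIV_I)
    define gain where "gain = \<delta> / (2 * \<kappa>)"
    have gain: "gain > 0" using \<delta> kappa_pos by (simp add: gain_def)
    have "S < S + min (gain / 2) (min df dg)" using gain df dg by simp
    then obtain m where m: "m \<in> A" "m < S + min (gain / 2) (min df dg)"
      using cInf_less_iff[OF A_ne A_bdd] unfolding S_def by blast
    have Sm: "S \<le> m" using cInf_lower[OF m(1) A_bdd] by (simp add: S_def)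
    obtain t1 where t1: "\<And>x t. x \<in> K \<Longrightarrow> t1 \<le> t \<Longrightarrow> u x t \<le> m" using m(1) by (auto simp: A_def)
    define t0 where "t0 = max 0 t1 + \<tau>"
    have t0: "0 \<le> t0" "t1 \<le> t0 - \<tau>" "0 \<le> t0 - \<tau>" using tau by (auto simp: t0_def)
    have gm: "g v \<le> g v0 + \<delta>" if "v \<in> {0..m}" for v
    proof (cases "v \<le> S")
      case True then show ?thesis using v0(2)[of v] that \<delta> by auto
    next
      case False
      then have "dist (g v) (g S) < \<delta>" using that m(2) by (intro dg(2)) (auto simp: dist_real_def)
      moreover have "g S \<le> g v0" using v0(2)[of S] Su ustar_pos by auto
      ultimately show ?thesis by (auto simp: dist_real_def)
    qed
    have "dist (f m) (f S) < \<delta>" using m(2) Sm by (intro df(2)) (auto simp: dist_real_def)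
    then have fm: "g v0 + 2 * \<delta> \<le> f m" using \<delta>(2) by (auto simp: dist_real_def)
    have improve: "u x t \<le> m - (1 - exp (- (\<kappa> * (t - t0)))) * (\<delta> / \<kappa>)" if "x \<in> K" "t0 \<le> t" for x t
    proof -
      have "u x t \<le> exp (- (\<kappa> * (t - t0))) * m + (1 - exp (- (\<kappa> * (t - t0)))) * (m + (g v0 + \<delta> - f m) / \<kappa>)"
        using that t0 tau by (intro solution_upper gm) (auto intro!: t1 u_nonneg)
      also have "\<dots> = m + (1 - exp (- (\<kappa> * (t - t0)))) * ((g v0 + \<delta> - f m) / \<kappa>)" by (simp add: algebra_simps)
      also have "\<dots> \<le> m + (1 - exp (- (\<kappa> * (t - t0)))) * ((- \<delta>) / \<kappa>)"
        using fm kappa_pos that by (intro add_left_mono mult_left_mono divide_right_mono) auto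
      finally show ?thesis by simp
    qed
    \<comment> \<open>After this time the exponential factor is at most one half.\<close>
    define t2 where "t2 = t0 + ln 2 / \<kappa>"
    have "u x t \<le> max ustar (m - gain)" if "x \<in> K" "t2 \<le> t" for x t
    proof -
      have "ln 2 \<le> \<kappa> * (t - t0)" using that kappa_pos by (simp add: t2_def field_simps)
      then have "exp (- (\<kappa> * (t - t0))) \<le> exp (- ln 2)" by simp
      also have "exp (- ln 2) = (1 / 2 :: real)" by (simp add: exp_minus)
      finally have "(1 / 2) * (\<delta> / \<kappa>) \<le> (1 - exp (- (\<kappa> * (t - t0)))) * (\<delta> / \<kappa>)"
        using \<delta> kappa_pos by (intro mult_right_mono) auto
      moreover have "t0 \<le> t" using that kappa_pos by (simp add: t2_def) (smt (verit) divide_nonneg_pos ln_ge_zero)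
      ultimately show ?thesis using improve[OF that(1)] by (simp add: gain_def) (smt (verit))
    qed
    then have "max ustar (m - gain) \<in> A" by (auto simp: A_def)
    then have "S \<le> max ustar (m - gain)" using cInf_lower[OF _ A_bdd] by (simp add: S_def)
    then show False using Su m(2) gain by auto
  qed
  then have "Inf A < ustar + \<epsilon>" using assms by (simp add: S_def)
  then obtain m where "m \<in> A" "m < ustar + \<epsilon>" using cInf_less_iff[OF A_ne A_bdd] by blast
  then obtain t1 where "\<forall>x\<in>K. \<forall>t\<ge>t1. u x t \<le> m" by (auto simp: A_def)
  then show ?thesis using that \<open>m < ustar + \<epsilon>\<close> by (meson less_imp_le order_trans)
qed

text \<open>Wait until \<open>u\<close> is positive and at most \<open>ustar + \<epsilon>\<close>, with \<open>\<epsilon>\<close> so small that \<open>f q < g v\<close> for all small \<open>q > 0\<close> and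
  all \<open>v\<close> in \<open>[q, ustar + \<epsilon>]\<close>. Up to \<open>ustar\<close> this is the crossing condition; beyond \<open>ustar\<close> it holds because
  \<open>f q\<close> is close to \<open>f 0 = g 0 < g ustar\<close>. A minimum below the threshold \<open>c\<close> would be attained after a full
  delay interval, where the lower relaxation bound is strictly larger.\<close>
lemma persistence:
  assumes nz: "x0 \<in> K" "t0 \<in> {-\<tau>..0}" "\<phi> x0 t0 \<noteq> 0"
  obtains c t1 where "0 < c" "c < ustar" "\<And>x t. x \<in> K \<Longrightarrow> t1 \<le> t \<Longrightarrow> c \<le> u x t"
proof -
  define \<gamma> where "\<gamma> = (g ustar - g 0) / 2"
  have \<gamma>: "\<gamma> > 0" "g ustar = g 0 + 2 * \<gamma>" using g_gt[OF ustar_pos] by (auto simp: \<gamma>_def field_simps)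
  obtain dg where dg: "dg > 0" "\<And>s. dist s ustar < dg \<Longrightarrow> dist (g s) (g ustar) < \<gamma>"
    using g_cont_on[of UNIV] \<gamma>(1) unfolding continuous_on_iff by (metis UNIV_I)
  obtain df where df: "df > 0" "\<And>s. dist s 0 < df \<Longrightarrow> dist (f s) (f 0) < \<gamma>"
    using f_cont_on[of UNIV] \<gamma>(1) unfolding continuous_on_iff by (metis UNIV_I)
  define \<epsilon> where "\<epsilon> = dg / 2"
  have \<epsilon>: "\<epsilon> > 0" using dg by (simp add: \<epsilon>_def)
  have gf: "f q < g v" if "0 < q" "q < df" "q < ustar" "q \<le> v" "v \<le> ustar + \<epsilon>" for q v
  proof (cases "v \<le> ustar")
    case True then show ?thesis using below that by blast
  next
    case False
    then have "dist (g v) (g ustar) < \<gamma>" using that dg(1) by (intro dg(2)) (auto simp: dist_real_def \<epsilon>_def)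
    moreover have "dist (f q) (f 0) < \<gamma>" using that by (intro df(2)) (auto simp: dist_real_def)
    ultimately show ?thesis using \<gamma>(2) fg0 by (auto simp: dist_real_def)
  qed
  obtain t1 where t1: "0 \<le> t1" "\<And>x t. x \<in> K \<Longrightarrow> t1 \<le> t \<Longrightarrow> 0 < u x t" using eventually_positive[OF nz] by blast
  obtain t2 where t2: "\<And>x t. x \<in> K \<Longrightarrow> t2 \<le> t \<Longrightarrow> u x t \<le> ustar + \<epsilon>" using eventually_below[OF \<epsilon>] by blast
  define a where "a = max t1 t2"
  have a: "0 \<le> a" "t1 \<le> a" "t2 \<le> a" using t1 by (auto simp: a_def)
  obtain p0 s0 where m0: "p0 \<in> K" "s0 \<in> {a..a + \<tau>}" "\<And>x t. x \<in> K \<Longrightarrow> t \<in> {a..a + \<tau>} \<Longrightarrow> u p0 s0 \<le> u x t"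
    using min_attained[of a "a + \<tau>"] a(1) tau by auto
  have m0pos: "0 < u p0 s0" using t1(2) m0 a by auto
  define c where "c = min (u p0 s0) (min df ustar / 2)"
  have c: "0 < c" "c < df" "c < ustar" "c \<le> u p0 s0" using m0pos df(1) ustar_pos by (auto simp: c_def)
  have "c \<le> u x1 b" if x1: "x1 \<in> K" and b: "a \<le> b" for x1 b
  proof (rule ccontr)
    assume neg: "\<not> c \<le> u x1 b"
    have ge_a: "- \<tau> \<le> a" using a(1) tau by simp
    obtain p s where p: "p \<in> K" "s \<in> {a..b}" "\<And>x t. x \<in> K \<Longrightarrow> t \<in> {a..b} \<Longrightarrow> u p s \<le> u x t"
      by (rule min_attained[OF b ge_a]) blast
    define q where "q = u p s"
    have qc: "q < c" using p(3)[OF x1, of b] b neg by (simp add: q_def)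
    have q: "0 < q" using t1(2)[OF p(1)] p(2) a by (simp add: q_def)
    have "\<not> s \<le> a + \<tau>" using m0(3)[OF p(1), of s] p(2) qc c(4) by (auto simp: q_def)
    then have s: "a + \<tau> < s" by simp
    have "q \<le> ustar + \<epsilon>" using qc c \<epsilon> by simp
    then obtain v where v: "v \<in> {q..ustar + \<epsilon>}" "\<And>v'. v' \<in> {q..ustar + \<epsilon>} \<Longrightarrow> g v \<le> g v'"
      using continuous_attains_inf[of "{q..ustar + \<epsilon>}" g] g_cont_on by fastforce
    have fg: "f q < g v" using gf[of q v] q qc c v(1) by auto
    have ge: "q \<le> u z r" if "z \<in> K" "r \<in> {a..s}" for z r using p(2) p(3)[OF that(1), of r] that by (auto simp: q_def)
    have "exp (- (\<kappa> * (s - (a + \<tau>)))) * q + (1 - exp (- (\<kappa> * (s - (a + \<tau>))))) * (q + (g v - f q) / \<kappa>) \<le> u p s"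
      using s tau a by (intro solution_lower p(1) v(2) ge) (auto intro!: t2 ge)
    moreover have "exp (- (\<kappa> * (s - (a + \<tau>)))) * q + (1 - exp (- (\<kappa> * (s - (a + \<tau>))))) * (q + (g v - f q) / \<kappa>)
        = q + (1 - exp (- (\<kappa> * (s - (a + \<tau>))))) * ((g v - f q) / \<kappa>)" by (simp add: algebra_simps)
    moreover have "0 < (1 - exp (- (\<kappa> * (s - (a + \<tau>))))) * ((g v - f q) / \<kappa>)"
      using decay_factor[of "s - (a + \<tau>)"] s fg kappa_pos by (intro mult_pos_pos divide_pos_pos) auto
    ultimately show False by (simp add: q_def)
  qed
  then show ?thesis using that[of c a] c by blast
qed

text \<open>The mirror image of \<open>eventually_below\<close>. Persistence keeps the supremum \<open>S\<close> of the eventual lower bounds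
  positive, and \<open>eventually_below\<close> confines the arguments of \<open>g\<close> to \<open>[m, ustar + du / 2]\<close>, on which \<open>g\<close> is almost as
  large as on \<open>[S, ustar]\<close>.\<close>
lemma eventually_above:
  assumes nz: "x0 \<in> K" "t0 \<in> {-\<tau>..0}" "\<phi> x0 t0 \<noteq> 0" and "\<epsilon> > 0"
  obtains t1 where "\<And>x t. x \<in> K \<Longrightarrow> t1 \<le> t \<Longrightarrow> ustar - \<epsilon> \<le> u x t"
proof -
  obtain c tc where c: "0 < c" "c < ustar" "\<And>x t. x \<in> K \<Longrightarrow> tc \<le> t \<Longrightarrow> c \<le> u x t" using persistence[OF nz] by blast
  define A where "A = {m. m \<le> ustar \<and> (\<exists>t1. \<forall>x\<in>K. \<forall>t\<ge>t1. m \<le> u x t)}"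
  have cA: "c \<in> A" using c by (auto simp: A_def)
  then have A_ne: "A \<noteq> {}" by blast
  have A_bdd: "bdd_above A" by (auto simp: A_def intro!: bdd_aboveI[of _ ustar])
  define S where "S = Sup A"
  have S: "S \<le> ustar" unfolding S_def by (rule cSup_least[OF A_ne]) (simp add: A_def)
  have Sc: "c \<le> S" unfolding S_def by (rule cSup_upper[OF cA A_bdd])
  have "S = ustar"
  proof (rule ccontr)
    assume "S \<noteq> ustar"
    then have Su: "S < ustar" "0 < S" using S Sc c by auto
    obtain v0 where v0: "v0 \<in> {S..ustar}" "\<And>v. v \<in> {S..ustar} \<Longrightarrow> g v0 \<le> g v"
      using continuous_attains_inf[of "{S..ustar}" g] g_cont_on Su by fastforce
    define \<delta> where "\<delta> = (g v0 - f S) / 3"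
    have \<delta>: "\<delta> > 0" "g v0 = f S + 3 * \<delta>" using below[OF Su(2,1)] v0(1) by (auto simp: \<delta>_def field_simps)
    obtain df where df: "df > 0" "\<And>s. dist s S < df \<Longrightarrow> dist (f s) (f S) < \<delta>"
      using f_cont_on[of UNIV] \<delta>(1) unfolding continuous_on_iff by (metis UNIV_I)
    obtain dg where dg: "dg > 0" "\<And>s. dist s S < dg \<Longrightarrow> dist (g s) (g S) < \<delta>"
      using g_cont_on[of UNIV] \<delta>(1) unfolding continuous_on_iff by (metis UNIV_I)
    obtain du where du: "du > 0" "\<And>s. dist s ustar < du \<Longrightarrow> dist (g s) (g ustar) < \<delta>"
      using g_cont_on[of UNIV] \<delta>(1) unfolding continuous_on_iff by (metis UNIV_I)
    define gain where "gain = \<delta> / (2 * \<kappa>)"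
    have gain: "gain > 0" using \<delta> kappa_pos by (simp add: gain_def)
    have "S - min (gain / 2) (min df dg) < S" using gain df dg by simp
    then obtain m where m: "m \<in> A" "S - min (gain / 2) (min df dg) < m"
      using less_cSup_iff[OF A_ne A_bdd] unfolding S_def by blast
    have Sm: "m \<le> S" using cSup_upper[OF m(1) A_bdd] by (simp add: S_def)
    obtain t1 where t1: "\<And>x t. x \<in> K \<Longrightarrow> t1 \<le> t \<Longrightarrow> m \<le> u x t" using m(1) by (auto simp: A_def)
    have "du / 2 > 0" using du by simp
    then obtain t2 where t2: "\<And>x t. x \<in> K \<Longrightarrow> t2 \<le> t \<Longrightarrow> u x t \<le> ustar + du / 2" using eventually_below by blast
    define t0 where "t0 = max 0 (max t1 t2) + \<tau>"
    have t0: "0 \<le> t0" "t1 \<le> t0 - \<tau>" "t2 \<le> t0 - \<tau>" using tau by (auto simp: t0_def)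
    have gm: "g v0 - \<delta> \<le> g v" if "v \<in> {m..ustar + du / 2}" for v
    proof -
      consider "v < S" | "S \<le> v" "v \<le> ustar" | "ustar < v" by linarith
      then show ?thesis
      proof cases
        case 1
        then have "dist (g v) (g S) < \<delta>" using that m(2) by (intro dg(2)) (auto simp: dist_real_def)
        moreover have "g v0 \<le> g S" using v0(2)[of S] Su by auto
        ultimately show ?thesis by (auto simp: dist_real_def)
      next
        case 2 then show ?thesis using v0(2)[of v] \<delta> by auto
      next
        case 3
        then have "dist (g v) (g ustar) < \<delta>" using that du(1) by (intro du(2)) (auto simp: dist_real_def)
        moreover have "g v0 \<le> g ustar" using v0(2)[of ustar] Su by auto
        ultimately show ?thesis by (auto simp: dist_real_def)
      qed
    qed
    have "dist (f m) (f S) < \<delta>" using m(2) Sm by (intro df(2)) (auto simp: dist_real_def)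
    then have fm: "f m \<le> g v0 - 2 * \<delta>" using \<delta>(2) by (auto simp: dist_real_def)
    have improve: "m + (1 - exp (- (\<kappa> * (t - t0)))) * (\<delta> / \<kappa>) \<le> u x t" if "x \<in> K" "t0 \<le> t" for x t
    proof -
      have "m + (1 - exp (- (\<kappa> * (t - t0)))) * (\<delta> / \<kappa>) \<le> m + (1 - exp (- (\<kappa> * (t - t0)))) * ((g v0 - \<delta> - f m) / \<kappa>)"
        using fm kappa_pos that by (intro add_left_mono mult_left_mono divide_right_mono) auto
      also have "\<dots> = exp (- (\<kappa> * (t - t0))) * m + (1 - exp (- (\<kappa> * (t - t0)))) * (m + (g v0 - \<delta> - f m) / \<kappa>)"
        by (simp add: algebra_simps)
      also have "\<dots> \<le> u x t"
        using that t0 tau by (intro solution_lower gm) (auto intro!: t1 t2)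
      finally show ?thesis .
    qed
    \<comment> \<open>After this time the exponential factor is at most one half.\<close>
    define t3 where "t3 = t0 + ln 2 / \<kappa>"
    have "min ustar (m + gain) \<le> u x t" if "x \<in> K" "t3 \<le> t" for x t
    proof -
      have "ln 2 \<le> \<kappa> * (t - t0)" using that kappa_pos by (simp add: t3_def field_simps)
      then have "exp (- (\<kappa> * (t - t0))) \<le> exp (- ln 2)" by simp
      also have "exp (- ln 2) = (1 / 2 :: real)" by (simp add: exp_minus)
      finally have "(1 / 2) * (\<delta> / \<kappa>) \<le> (1 - exp (- (\<kappa> * (t - t0)))) * (\<delta> / \<kappa>)"
        using \<delta> kappa_pos by (intro mult_right_mono) auto
      moreover have "t0 \<le> t" using that kappa_pos by (simp add: t3_def) (smt (verit) divide_nonneg_pos ln_ge_zero)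
      ultimately show ?thesis using improve[OF that(1)] by (simp add: gain_def) (smt (verit))
    qed
    then have "min ustar (m + gain) \<in> A" by (auto simp: A_def)
    then have "min ustar (m + gain) \<le> S" using cSup_upper[OF _ A_bdd] by (simp add: S_def)
    then show False using Su m(2) gain by auto
  qed
  then have "ustar - \<epsilon> < Sup A" using assms by (simp add: S_def)
  then obtain m where "m \<in> A" "ustar - \<epsilon> < m" using less_cSup_iff[OF A_ne A_bdd] by blast
  then obtain t1 where "\<forall>x\<in>K. \<forall>t\<ge>t1. m \<le> u x t" by (auto simp: A_def)
  then show ?thesis using that \<open>ustar - \<epsilon> < m\<close> by (meson less_imp_le order_trans)
qed

theorem converges_to_ustar:
  assumes nz: "x0 \<in> K" "t0 \<in> {-\<tau>..0}" "\<phi> x0 t0 \<noteq> 0"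
  shows "uniform_limit K (\<lambda>t x. u x t) (\<lambda>_. ustar) at_top"
  unfolding uniform_limit_iff
proof (intro allI impI)
  fix e :: real assume "e > 0"
  then have e: "e / 2 > 0" by simp
  obtain t1 where t1: "\<And>x t. x \<in> K \<Longrightarrow> t1 \<le> t \<Longrightarrow> u x t \<le> ustar + e / 2" using eventually_below[OF e] by blast
  obtain t2 where t2: "\<And>x t. x \<in> K \<Longrightarrow> t2 \<le> t \<Longrightarrow> ustar - e / 2 \<le> u x t" using eventually_above[OF nz e] by blast
  have "dist (u x t) ustar < e" if "max t1 t2 \<le> t" "x \<in> K" for t x
    using t1[OF that(2), of t] t2[OF that(2), of t] that(1) e by (simp add: dist_real_def abs_less_iff)
  then show "eventually (\<lambda>t. \<forall>x\<in>K. dist (u x t) ustar < e) at_top"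
    unfolding eventually_at_top_linorder by blast
qed

end

section \<open>The steady state and its attractivity\<close>

lemma (in delayed_reaction_diffusion) equilibrium_is_steady_state:
  assumes "f c = g c" "0 \<le> c"
  shows "steady_state \<Omega> T \<tau> h f g (\<lambda>_. c)"
proof -
  have const: "T t (\<lambda>_. d) x = d" if "0 \<le> t" "x \<in> K" for t x d
    using T_lower[of "\<lambda>_. d" t d x] T_upper[of "\<lambda>_. d" t d x] that by simp
  have "reaction \<tau> h f g (history (\<lambda>(x::'a) _. c) s) = (\<lambda>_. 0)" for s
    using assms average_const[of "g c"] by (simp add: reaction_def history_def fun_eq_iff)
  then have "integral {0..t} (\<lambda>s. T (t - s) (reaction \<tau> h f g (history (\<lambda>x _. c) s)) x) = 0"
    if "x \<in> K" for t x
    using const that by (intro integral_unique has_integral_is_0) auto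
  then show ?thesis using assms const
    by (simp add: steady_state_def mild_solution_def case_prod_unfold)
qed

lemma crossing_point_eq:
  fixes f g :: "real \<Rightarrow> real"
  assumes cont: "continuous_on UNIV f" "continuous_on UNIV g" and "a < c"
    and left: "\<And>s. a < s \<Longrightarrow> s < c \<Longrightarrow> f s < g s" and right: "\<And>s. c < s \<Longrightarrow> g s < f s"
  shows "f c = g c"
proof -
  have lim: "((\<lambda>s. g s - f s) \<longlongrightarrow> g c - f c) (at c within S)" for S
    using cont by (intro tendsto_diff) (auto simp: continuous_on_def intro: tendsto_within_subset)
  have "0 \<le> g c - f c"
  proof (rule tendsto_lowerbound[OF lim[of "{..<c}"]])
    show "\<forall>\<^sub>F s in at_left c. 0 \<le> g s - f s"
      unfolding eventually_at_left_field using \<open>a < c\<close> left by (auto simp: less_imp_le)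
  qed simp
  moreover have "g c - f c \<le> 0"
  proof (rule tendsto_upperbound[OF lim[of "{c<..}"]])
    show "\<forall>\<^sub>F s in at_right c. g s - f s \<le> 0"
      unfolding eventually_at_right_field using right by (auto simp: less_imp_le intro!: exI[of _ "c + 1"])
  qed simp
  ultimately show ?thesis by simp
qed

theorem corollary4p1:
  fixes \<Omega> :: "'a::euclidean_space set"
    and T :: "real \<Rightarrow> ('a \<Rightarrow> real) \<Rightarrow> 'a \<Rightarrow> real"
    and f g h :: "real \<Rightarrow> real"
    and \<tau> B M ustar :: real
  assumes tau: "\<tau> > 0"
    and domain: "smooth_bounded_domain \<Omega>"
    and semigroup: "neumann_semigroup \<Omega> T"
    and h_pos: "\<forall>a\<in>{0..\<tau>}. h a > 0"
    and h_int: "h absolutely_integrable_on {0..\<tau>}"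
    and h_total: "integral {0..\<tau>} h = 1"
    and f_lip: "\<exists>L. L-lipschitz_on UNIV f"
    and g_lip: "\<exists>L. L-lipschitz_on UNIV g"
    and fg0: "f 0 = g 0"
    and g_gt: "\<forall>s>0. g s > g 0"
    and B_pos: "B > 0"
    and T2: "\<forall>s>B. (SUP v\<in>{0..s}. g v) < f s"
    and ustar_pos: "ustar > 0"
    and below: "\<forall>s. 0 < s \<and> s < ustar \<longrightarrow> (INF \<sigma>\<in>{s..ustar}. g \<sigma>) > f s"
    and above: "\<forall>s. ustar < s \<and> s \<le> B \<longrightarrow> (SUP \<sigma>\<in>{ustar..s}. g \<sigma>) < f s"
    and f_diff: "f differentiable (at 0)"
    and g_diff: "g differentiable (at 0)"
    and derivs: "deriv g 0 > deriv f 0" "deriv f 0 > 0"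
    and f_gt: "\<forall>s>0. f s > f 0"
    and M_pos: "M > 0"
    and M_max: "is_arg_max g (\<lambda>s. 0 \<le> s) M"
    and M_unique: "\<forall>M'>0. is_arg_max g (\<lambda>s. 0 \<le> s) M' \<longrightarrow> M' = M"
    and g_inc: "mono_on {0<..<M} g"
    and g_dec: "antimono_on {M<..<B} g"
    and ustar_le_M: "ustar \<le> M"
  shows "steady_state \<Omega> T \<tau> h f g (\<lambda>_. ustar) \<and> globally_attractive \<Omega> T \<tau> h f g ustar"
proof -
  obtain L where L: "L-lipschitz_on UNIV f" using f_lip by blast
  have gc: "continuous_on UNIV g" using g_lip lipschitz_on_continuous_on by blast
  have fc: "continuous_on UNIV f" using L lipschitz_on_continuous_on by blast
  have bdd: "bdd_above (g ` {a..b})" "bdd_below (g ` {a..b})" for a b :: real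
    using compact_continuous_image[OF continuous_on_subset[OF gc] compact_Icc[of a b], THEN compact_imp_bounded]
    by (auto intro: bounded_imp_bdd_above bounded_imp_bdd_below)
  have below': "f s < g v" if "0 < s" "s < ustar" "s \<le> v" "v \<le> ustar" for s v
  proof -
    have "(INF \<sigma>\<in>{s..ustar}. g \<sigma>) \<le> g v" using that by (intro cINF_lower bdd) auto
    then show ?thesis using below that by fastforce
  qed
  \<comment> \<open>Monotonicity of \<open>g\<close> is given on the open interval only; \<open>v = 0\<close> and \<open>ustar = M\<close> are covered by the minimality
    of \<open>g 0\<close> and the maximality of \<open>g M\<close>.\<close>
  have rising: "g v \<le> g ustar" if v: "0 \<le> v" "v \<le> ustar" for v
  proof -
    consider "v = 0" | "ustar = M" | "0 < v" "ustar < M" using v ustar_le_M by linarith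
    then show ?thesis
    proof cases
      case 1 then show ?thesis using g_gt ustar_pos by (simp add: less_imp_le)
    next
      case 2 then show ?thesis using M_max v by (auto simp: is_arg_max_def not_less)
    next
      case 3 then show ?thesis using v ustar_pos by (intro mono_onD[OF g_inc]) auto
    qed
  qed
  have above': "g v < f s" if s: "ustar < s" and v: "0 \<le> v" "v \<le> s" for s v
  proof (cases "s \<le> B")
    case False
    have "g v \<le> (SUP v\<in>{0..s}. g v)" using v by (intro cSUP_upper bdd) auto
    then show ?thesis using T2[rule_format, of s] False by simp
  next
    case True
    have "g v' \<le> (SUP \<sigma>\<in>{ustar..s}. g \<sigma>)" if "ustar \<le> v'" "v' \<le> s" for v'
      using that by (intro cSUP_upper bdd) auto
    then have less: "g v' < f s" if "ustar \<le> v'" "v' \<le> s" for v' using above s True that by fastforce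
    show ?thesis
    proof (cases "ustar \<le> v")
      case False
      then show ?thesis using rising[of v] less[of ustar] v s by simp
    qed (use less v in blast)
  qed
  interpret delayed_reaction_diffusion \<Omega> T \<tau> h f g L
    using domain semigroup tau h_pos h_int h_total L gc by unfold_locales auto
  have "f ustar = g ustar"
    using below' above' ustar_pos by (intro crossing_point_eq[OF fc gc ustar_pos]) auto
  then have "steady_state \<Omega> T \<tau> h f g (\<lambda>_. ustar)"
    using ustar_pos by (intro equilibrium_is_steady_state) auto
  moreover have "globally_attractive \<Omega> T \<tau> h f g ustar"
    unfolding globally_attractive_def
  proof (intro ballI allI impI)
    fix \<phi> u
    assume nz: "\<exists>x\<in>closure \<Omega>. \<exists>t\<in>{-\<tau>..0}. \<phi> x t \<noteq> 0" and mild: "mild_solution \<Omega> T \<tau> h f g \<phi> u"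
    interpret crossing_feedback_solution \<Omega> T \<tau> h f g L \<phi> u ustar
      using mild fg0 g_gt ustar_pos above' below' by unfold_locales auto
    show "uniform_limit (closure \<Omega>) (\<lambda>t x. u x t) (\<lambda>_. ustar) at_top"
      using nz converges_to_ustar by blast
  qed
  ultimately show ?thesis by blast
qed

end
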